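(* Consider the linear-Gaussian inverse problem on $\mathcal{H}$, its $n$-dimensional discretizations, and the ensemble Kalman approximation with ensemble size $J$, as described in the context. Let $\widehat\varepsilon_C=\mathbb{E}\|\mathcal{C}_{\text{post}}-P^*\widehat C_{\text{post}}P\|_{op}$ be the expected error between the infinite-dimensional posterior covariance and the ensemble posterior covariance. Assume: (i) there are a constant $r_1\in\mathbb{R}$ and a function $\psi_1:\mathbb{N}\to\mathbb{R}$ with $\lim_{n\to\infty}\psi_1(n)=0$ such that $\|\mathcal{C}_0-P^*C_0P\|_{op}\le r_1\psi_1(n)$; (ii) there are a constant $r_2\in\mathbb{R}$ and a function $\psi_2:\mathbb{N}\to\mathbb{R}$ with $\lim_{n\to\infty}\psi_2(n)=0$ such that $\|\mathcal{F}-FP\|_{op}\le r_2\psi_2(n)$; (iii) there are a Hilbert space $\mathcal{H}'$ continuously embedded in $\mathcal{H}$, a constant $r_3\in\mathbb{R}$ and a function $\psi_3:\mathbb{N}\to\mathbb{R}$ with $\lim_{n\to\infty}\psi_3(n)=0$ such that $\|(I-P^*P)u\|_{\mathcal{H}}\le r_3\psi_3(n)\|u\|_{\mathcal{H}'}$ for every $u\in\mathcal{H}'$. Assume further that for $n$ sufficiently large $r_M(C_0)\le c\,r(\mathcal{C}_0)$ for some constant $c$ independent of $n$, and that $J\ge r_M(C_0)$. Then $$\widehat\varepsilon_C\le r_1'\psi_1(n)+r_2'\psi_2(n)+r_3'\frac1{\sqrt J},$$ where the constants $r_1',r_2',r_3'$ are independent of the discretization dimension $n$ and the ensemble size $J$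.
   Context: Continuum problem: $\mathcal{H}$ is an infinite-dimensional separable real Hilbert space, $\mathcal{F}:\mathcal{H}\to\mathbb{R}^{d_y}$ is linear and bounded, $\Gamma$ is a symmetric positive definite $d_y\times d_y$ matrix, $y\in\mathbb{R}^{d_y}$ is given data, and the prior is the Gaussian measure $\mathcal{N}(m_0,\mathcal{C}_0)$ on $\mathcal{H}$, with $\mathcal{C}_0$ a trace-class covariance operator and $m_0\in\mathrm{Im}(\mathcal{C}_0^{1/2})$. The posterior for the model $y=\mathcal{F}u+\eta$, $\eta\sim\mathcal{N}(0,\Gamma)$, is Gaussian with covariance $\mathcal{C}_{\text{post}}=\mathcal{C}_0-\mathcal{C}_0\mathcal{F}^*(\mathcal{F}\mathcal{C}_0\mathcal{F}^*+\Gamma)^{-1}\mathcal{F}\mathcal{C}_0$. Discretization (for each $n$; dependence on $n$ suppressed): $\mathcal{V}\subset\mathcal{H}$ is $n$-dimensional with basis $\phi_1,\dots,\phi_n$; $M_{ij}=\langle\phi_i,\phi_j\rangle_{\mathcal{H}}$; $\mathbb{R}^n_M$ is $\mathbb{R}^n$ with inner product $\langle\vec u,\vec v\rangle_M=\vec u^TM\vec v$; $P:\mathcal{H}\to\mathbb{R}^n_M$ sends $u$ to the coefficients of its orthogonal projection onto $\mathcal{V}$; $P^*\vec u=\sum_iu_i\phi_i$ is its adjoint. $F:\mathbb{R}^n_M\to\mathbb{R}^{d_y}$ is linear with adjoint $F^\natural=M^{-1}F^T$; $C_0:\mathbb{R}^n_M\to\mathbb{R}^n_M$ is an invertible covariance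 operator (self-adjoint, positive definite for $\langle\cdot,\cdot\rangle_M$); $\vec m_0=Pm_0$. Ensemble Kalman update (perturbed observations): $u^{(1)},\dots,u^{(J)}$ are independent draws from $\mathcal{N}(\vec m_0,C_0)$ on $\mathbb{R}^n_M$ (i.e. $u^{(j)}=\vec m_0+L\xi^{(j)}$, $\xi^{(j)}\sim\mathcal{N}(0,I)$ on $\mathbb{R}^n$, $C_0=LL^TM$), $\widehat m_0=\frac1J\sum_ju^{(j)}$, $\widehat C_0=\frac1{J-1}\sum_j(u^{(j)}-\widehat m_0)(u^{(j)}-\widehat m_0)^TM$, and $$v^{(j)}=u^{(j)}+\widehat C_0F^\natural(F\widehat C_0F^\natural+\Gamma)^{-1}(y-Fu^{(j)}+\eta^{(j)}),\qquad \eta^{(j)}\overset{\text{i.i.d.}}{\sim}\mathcal{N}(0,\Gamma),$$ with the $\eta^{(j)}$ independent of the $u^{(j)}$; $\widehat m_{\text{post}}=\frac1J\sum_{j=1}^Jv^{(j)}$ and $\widehat C_{\text{post}}=\frac1{J-1}\sum_{j=1}^J(v^{(j)}-\widehat m_{\text{post}})(v^{(j)}-\widehat m_{\text{post}})^TM$. $\mathbb{E}$ is expectation over the $u^{(j)},\eta^{(j)}$. Effective dimensions: $r_M(C_0)=\mathrm{Tr}(C_0)/\|C_0\|_{op}$ with $\|\cdot\|_{op}$ the operator norm on $\mathbb{R}^n_M$; $r(\mathcal{C}_0)=\mathrm{Tr}(\mathcal{C}_0)/\|\mathcal{C}_0\|_{op}$ with the operator norm on $\mathcal{H}$. Elsewhere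 $\|\cdot\|_{op}$ is the operator norm between the relevant normed spaces. *)

theory Defs
  imports "HOL-Probability.Probability"
begin

section \<open>Operators on a Hilbert space\<close>

definition self_adjoint :: "('a::real_inner \<Rightarrow> 'a) \<Rightarrow> bool" where
  "self_adjoint T \<longleftrightarrow> (\<forall>x y. T x \<bullet> y = x \<bullet> T y)"

definition positive_op :: "('a::real_inner \<Rightarrow> 'a) \<Rightarrow> bool" where
  "positive_op T \<longleftrightarrow> (\<forall>x. 0 \<le> x \<bullet> T x)"

definition orthonormal_basis :: "'a::real_inner set \<Rightarrow> bool" where
  "orthonormal_basis B \<longleftrightarrow>
     pairwise orthogonal B \<and> (\<forall>b\<in>B. norm b = 1) \<and> closure (span B) = UNIV"

text \<open>For a positive operator, being trace class means that the sum of the diagonal entries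
  converges in one (equivalently, in every) orthonormal basis.\<close>

definition trace_class_covariance :: "('a::real_inner \<Rightarrow> 'a) \<Rightarrow> bool" where
  "trace_class_covariance T \<longleftrightarrow>
     bounded_linear T \<and> self_adjoint T \<and> positive_op T \<and>
     (\<exists>B. orthonormal_basis B \<and> (\<lambda>b. b \<bullet> T b) summable_on B)"

text \<open>The value does not depend on the chosen basis when \<open>T\<close> is trace class.\<close>

definition op_trace :: "('a::real_inner \<Rightarrow> 'a) \<Rightarrow> real" where
  "op_trace T = (\<Sum>\<^sub>\<infinity>b\<in>(SOME B. orthonormal_basis B). b \<bullet> T b)"

definition effective_dim :: "('a::real_inner \<Rightarrow> 'a) \<Rightarrow> real" where
  "effective_dim T = op_trace T / onorm T"

definition op_sqrt :: "('a::real_inner \<Rightarrow> 'a) \<Rightarrow> 'a \<Rightarrow> 'a" where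
  "op_sqrt T = (THE S. bounded_linear S \<and> self_adjoint S \<and> positive_op S \<and> (\<forall>x. S (S x) = T x))"

definition posterior_cov ::
  "('h::real_inner \<Rightarrow> 'h) \<Rightarrow> ('h \<Rightarrow> real^'d) \<Rightarrow> real^'d^'d \<Rightarrow> 'h \<Rightarrow> 'h" where
  "posterior_cov C \<F> \<Gamma> h =
     C h - C (adjoint \<F> (matrix_inv (matrix (\<lambda>w. \<F> (C (adjoint \<F> w))) + \<Gamma>) *v \<F> (C h)))"


section \<open>Gaussian measures\<close>

text \<open>The normal law on the line with variance \<open>v\<close>; a point mass if \<open>v = 0\<close>.\<close>

definition normal_law :: "real \<Rightarrow> real \<Rightarrow> real measure" where
  "normal_law m v =
     (if v = 0 then return borel m else density lborel (\<lambda>x. ennreal (normal_density m (sqrt v) x)))"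

text \<open>\<open>\<mu> = N(m, C)\<close>: every one-dimensional marginal is normal, with mean and variance given by
  \<open>m\<close> and \<open>C\<close>.\<close>

definition is_gaussian :: "'a::real_inner measure \<Rightarrow> 'a \<Rightarrow> ('a \<Rightarrow> 'a) \<Rightarrow> bool" where
  "is_gaussian \<mu> m C \<longleftrightarrow>
     prob_space \<mu> \<and> sets \<mu> = sets borel \<and>
     (\<forall>a. distr \<mu> borel (\<lambda>x. a \<bullet> x) = normal_law (a \<bullet> m) (a \<bullet> C a))"


section \<open>The coefficient space\<close>

text \<open>Since the dimension \<open>n\<close> varies inside the theorem, \<open>\<real>\<^sup>n\<close> is the set of extensional
  functions on \<open>{..<n}\<close>, and an \<open>n \<times> n\<close> matrix is a function of two indices of which only the
  values below \<open>n\<close> matter. A \<open>d \<times> n\<close> matrix \<open>F\<close> is given by its columns \<open>F 0, \<dots>, F (n - 1)\<close>.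
  \<open>G\<close> stands for the Gram matrix defining the inner product.\<close>

definition Rn :: "nat \<Rightarrow> (nat \<Rightarrow> real) set" where
  "Rn n = ({..<n} \<rightarrow>\<^sub>E UNIV)"

definition inner_G :: "nat \<Rightarrow> (nat \<Rightarrow> nat \<Rightarrow> real) \<Rightarrow> (nat \<Rightarrow> real) \<Rightarrow> (nat \<Rightarrow> real) \<Rightarrow> real" where
  "inner_G n G x y = (\<Sum>i<n. \<Sum>k<n. x i * G i k * y k)"

definition norm_G :: "nat \<Rightarrow> (nat \<Rightarrow> nat \<Rightarrow> real) \<Rightarrow> (nat \<Rightarrow> real) \<Rightarrow> real" where
  "norm_G n G x = sqrt (inner_G n G x x)"

definition mat_vec :: "nat \<Rightarrow> (nat \<Rightarrow> nat \<Rightarrow> real) \<Rightarrow> (nat \<Rightarrow> real) \<Rightarrow> nat \<Rightarrow> real" where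
  "mat_vec n A x = (\<lambda>i\<in>{..<n}. \<Sum>k<n. A i k * x k)"

definition mat_inverse :: "nat \<Rightarrow> (nat \<Rightarrow> nat \<Rightarrow> real) \<Rightarrow> nat \<Rightarrow> nat \<Rightarrow> real" where
  "mat_inverse n A = (SOME B. \<forall>i<n. \<forall>k<n.
     (\<Sum>l<n. A i l * B l k) = of_bool (i = k) \<and> (\<Sum>l<n. B i l * A l k) = of_bool (i = k))"

definition opnorm_G :: "nat \<Rightarrow> (nat \<Rightarrow> nat \<Rightarrow> real) \<Rightarrow> (nat \<Rightarrow> nat \<Rightarrow> real) \<Rightarrow> real" where
  "opnorm_G n G A =
     (SUP x\<in>{x \<in> Rn n. \<exists>i<n. x i \<noteq> 0}. norm_G n G (mat_vec n A x) / norm_G n G x)"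

definition effective_dim_G :: "nat \<Rightarrow> (nat \<Rightarrow> nat \<Rightarrow> real) \<Rightarrow> (nat \<Rightarrow> nat \<Rightarrow> real) \<Rightarrow> real" where
  "effective_dim_G n G A = (\<Sum>i<n. A i i) / opnorm_G n G A"

text \<open>Positive definiteness makes the operator invertible.\<close>

definition pos_def_covariance_G :: "nat \<Rightarrow> (nat \<Rightarrow> nat \<Rightarrow> real) \<Rightarrow> (nat \<Rightarrow> nat \<Rightarrow> real) \<Rightarrow> bool" where
  "pos_def_covariance_G n G A \<longleftrightarrow>
     (\<forall>x\<in>Rn n. \<forall>y\<in>Rn n. inner_G n G (mat_vec n A x) y = inner_G n G x (mat_vec n A y)) \<and>
     (\<forall>x\<in>Rn n. (\<exists>i<n. x i \<noteq> 0) \<longrightarrow> 0 < inner_G n G x (mat_vec n A x))"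

text \<open>\<open>N(m, C)\<close> on \<open>\<real>\<^sup>n\<close> with the inner product of \<open>G\<close>: the law of \<open>m + L \<xi>\<close> where \<open>\<xi>\<close> is
  standard normal and \<open>C = L L\<^sup>T G\<close>. It does not depend on the choice of \<open>L\<close>.\<close>

definition is_gaussian_G ::
  "nat \<Rightarrow> (nat \<Rightarrow> nat \<Rightarrow> real) \<Rightarrow> (nat \<Rightarrow> real) measure \<Rightarrow> (nat \<Rightarrow> real) \<Rightarrow> (nat \<Rightarrow> nat \<Rightarrow> real) \<Rightarrow> bool" where
  "is_gaussian_G n G \<mu> m C \<longleftrightarrow>
     (\<exists>L. (\<forall>i<n. \<forall>k<n. C i k = (\<Sum>l<n. (\<Sum>a<n. L i a * L l a) * G l k)) \<and>
          \<mu> = distr (\<Pi>\<^sub>M i\<in>{..<n}. normal_law 0 1) (\<Pi>\<^sub>M i\<in>{..<n}. borel)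
                (\<lambda>\<xi>. \<lambda>i\<in>{..<n}. m i + (\<Sum>a<n. L i a * \<xi> a)))"


section \<open>Discretization\<close>

definition gram :: "(nat \<Rightarrow> 'h::real_inner) \<Rightarrow> nat \<Rightarrow> nat \<Rightarrow> real" where
  "gram \<phi> i k = \<phi> i \<bullet> \<phi> k"

definition synth :: "nat \<Rightarrow> (nat \<Rightarrow> 'h::real_inner) \<Rightarrow> (nat \<Rightarrow> real) \<Rightarrow> 'h" where
  "synth n \<phi> a = (\<Sum>i<n. a i *\<^sub>R \<phi> i)"

text \<open>Coefficients of the orthogonal projection onto the span of \<open>\<phi> 0, \<dots>, \<phi> (n - 1)\<close>; its
  adjoint is \<open>synth n \<phi>\<close>.\<close>

definition proj_coeffs :: "nat \<Rightarrow> (nat \<Rightarrow> 'h::real_inner) \<Rightarrow> 'h \<Rightarrow> nat \<Rightarrow> real" where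
  "proj_coeffs n \<phi> u =
     (THE a. a \<in> Rn n \<and> (\<forall>v\<in>span (\<phi> ` {..<n}). orthogonal (u - synth n \<phi> a) v))"

definition lift_op ::
  "nat \<Rightarrow> (nat \<Rightarrow> 'h::real_inner) \<Rightarrow> (nat \<Rightarrow> nat \<Rightarrow> real) \<Rightarrow> 'h \<Rightarrow> 'h" where
  "lift_op n \<phi> A h = synth n \<phi> (mat_vec n A (proj_coeffs n \<phi> h))"

definition obs :: "nat \<Rightarrow> (nat \<Rightarrow> real^'d) \<Rightarrow> (nat \<Rightarrow> real) \<Rightarrow> real^'d" where
  "obs n F x = (\<Sum>k<n. x k *\<^sub>R F k)"

text \<open>The adjoint \<open>G\<^sup>-\<^sup>1 F\<^sup>T\<close> of \<open>obs n F\<close> with respect to the inner product of \<open>G\<close>.\<close>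

definition obs_adj ::
  "nat \<Rightarrow> (nat \<Rightarrow> nat \<Rightarrow> real) \<Rightarrow> (nat \<Rightarrow> real^'d) \<Rightarrow> real^'d \<Rightarrow> nat \<Rightarrow> real" where
  "obs_adj n G F w = mat_vec n (mat_inverse n G) (\<lambda>k\<in>{..<n}. F k \<bullet> w)"


section \<open>Ensemble Kalman update with perturbed observations\<close>

definition ens_mean :: "nat \<Rightarrow> (nat \<Rightarrow> nat \<Rightarrow> real) \<Rightarrow> nat \<Rightarrow> real" where
  "ens_mean J u i = (\<Sum>j<J. u j i) / real J"

definition ens_cov ::
  "nat \<Rightarrow> (nat \<Rightarrow> nat \<Rightarrow> real) \<Rightarrow> nat \<Rightarrow> (nat \<Rightarrow> nat \<Rightarrow> real) \<Rightarrow> nat \<Rightarrow> nat \<Rightarrow> real" where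
  "ens_cov n G J u i k =
     (\<Sum>j<J. \<Sum>l<n. (u j i - ens_mean J u i) * (u j l - ens_mean J u l) * G l k) / (real J - 1)"

definition kalman_gain ::
  "nat \<Rightarrow> (nat \<Rightarrow> nat \<Rightarrow> real) \<Rightarrow> (nat \<Rightarrow> real^'d) \<Rightarrow> real^'d^'d \<Rightarrow> (nat \<Rightarrow> nat \<Rightarrow> real) \<Rightarrow>
   real^'d \<Rightarrow> nat \<Rightarrow> real" where
  "kalman_gain n G F \<Gamma> C w =
     mat_vec n C (obs_adj n G F
       (matrix_inv (matrix (\<lambda>z. obs n F (mat_vec n C (obs_adj n G F z))) + \<Gamma>) *v w))"

definition enkf_update ::
  "nat \<Rightarrow> (nat \<Rightarrow> nat \<Rightarrow> real) \<Rightarrow> (nat \<Rightarrow> real^'d) \<Rightarrow> real^'d^'d \<Rightarrow> real^'d \<Rightarrow> nat \<Rightarrow>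
   (nat \<Rightarrow> nat \<Rightarrow> real) \<Rightarrow> (nat \<Rightarrow> real^'d) \<Rightarrow> nat \<Rightarrow> nat \<Rightarrow> real" where
  "enkf_update n G F \<Gamma> y J u \<eta> j =
     (\<lambda>i\<in>{..<n}. u j i + kalman_gain n G F \<Gamma> (ens_cov n G J u) (y - obs n F (u j) + \<eta> j) i)"

definition enkf_post_cov ::
  "nat \<Rightarrow> (nat \<Rightarrow> nat \<Rightarrow> real) \<Rightarrow> (nat \<Rightarrow> real^'d) \<Rightarrow> real^'d^'d \<Rightarrow> real^'d \<Rightarrow> nat \<Rightarrow>
   (nat \<Rightarrow> nat \<Rightarrow> real) \<Rightarrow> (nat \<Rightarrow> real^'d) \<Rightarrow> nat \<Rightarrow> nat \<Rightarrow> real" where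
  "enkf_post_cov n G F \<Gamma> y J u \<eta> = ens_cov n G J (enkf_update n G F \<Gamma> y J u \<eta>)"

text \<open>On the probability space \<open>\<Omega>\<close>, the \<open>u j\<close> are independent draws from \<open>N(m, C)\<close>, the \<open>\<eta> j\<close>
  are independent draws from \<open>N(0, \<Gamma>)\<close>, and the two families are independent.\<close>

definition enkf_sample ::
  "'w measure \<Rightarrow> nat \<Rightarrow> (nat \<Rightarrow> nat \<Rightarrow> real) \<Rightarrow> (nat \<Rightarrow> real) \<Rightarrow> (nat \<Rightarrow> nat \<Rightarrow> real) \<Rightarrow> real^'d^'d \<Rightarrow>
   nat \<Rightarrow> (nat \<Rightarrow> 'w \<Rightarrow> nat \<Rightarrow> real) \<Rightarrow> (nat \<Rightarrow> 'w \<Rightarrow> real^'d) \<Rightarrow> bool" where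
  "enkf_sample \<Omega> n G m C \<Gamma> J u \<eta> \<longleftrightarrow>
     prob_space \<Omega> \<and>
     prob_space.indep_vars \<Omega> (\<lambda>j. \<Pi>\<^sub>M i\<in>{..<n}. borel) u {..<J} \<and>
     (\<forall>j<J. is_gaussian_G n G (distr \<Omega> (\<Pi>\<^sub>M i\<in>{..<n}. borel) (u j)) m C) \<and>
     prob_space.indep_vars \<Omega> (\<lambda>j. borel) \<eta> {..<J} \<and>
     (\<forall>j<J. is_gaussian (distr \<Omega> borel (\<eta> j)) 0 ((*v) \<Gamma>)) \<and>
     prob_space.indep_set \<Omega>
       (sets (vimage_algebra (space \<Omega>) (\<lambda>\<omega>. \<lambda>j\<in>{..<J}. u j \<omega>) (\<Pi>\<^sub>M j\<in>{..<J}. \<Pi>\<^sub>M i\<in>{..<n}. borel)))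
       (sets (vimage_algebra (space \<Omega>) (\<lambda>\<omega>. \<lambda>j\<in>{..<J}. \<eta> j \<omega>) (\<Pi>\<^sub>M j\<in>{..<J}. borel)))"

definition enkf_cov_error ::
  "('h::real_inner \<Rightarrow> 'h) \<Rightarrow> ('h \<Rightarrow> real^'d) \<Rightarrow> real^'d^'d \<Rightarrow> real^'d \<Rightarrow> nat \<Rightarrow> (nat \<Rightarrow> 'h) \<Rightarrow>
   (nat \<Rightarrow> real^'d) \<Rightarrow> nat \<Rightarrow> (nat \<Rightarrow> nat \<Rightarrow> real) \<Rightarrow> (nat \<Rightarrow> real^'d) \<Rightarrow> real" where
  "enkf_cov_error C \<F> \<Gamma> y n \<phi> F J u \<eta> =
     onorm (\<lambda>h. posterior_cov C \<F> \<Gamma> h - lift_op n \<phi> (enkf_post_cov n (gram \<phi>) F \<Gamma> y J u \<eta>) h)"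

end

theory Submission
  imports Defs
begin

text \<open>The effective dimension hypothesis together with the convergence of the discretized prior
  covariances bounds the traces of the \<open>C\<^sub>0 n\<close> uniformly in \<open>n\<close>. Hence Hilbert-Schmidt norms, whose
  second moments are computed from fourth moments of normal variables, suffice to control the
  sampling errors: the sample covariance of the ensemble, that of the noise, and the
  cross-covariance of the two all have mean square error of order \<open>1 / J\<close>, with a constant
  quadratic in the traces.

  Everything is lifted to the Hilbert space by \<open>synth\<close>. The lifted ensemble covariance is the
  posterior covariance map evaluated at the sample covariance (Joseph form), plus one term linear
  in the error of the noise covariance and two terms linear in the cross-covariance. The two
  posterior covariances are compared by an exact identity. Since the Kalman gain is bounded by
  the square root of the norm of the covariance, the resulting bound on the error is at most
  quadratic in the sampling errors, so that second moments are enough to integrate it.\<close>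


section \<open>Inner product spaces and the discretization\<close>

text \<open>Since the constants may depend on the trace bound, the coarse Hilbert-Schmidt norm can
  stand in for the operator norm, whose sharp sampling theory is far deeper. The price is that only
  second moments of the sampling errors are at hand, and this shapes the estimates. A gain bound
  linear in the norm of the covariance would make the noise term cubic, because the gain enters it
  twice; with the square root it stays quadratic. An error \<open>t\<close> that enters linearly is
  replaced, pathwise, through \<open>2 * t \<le> s * t\<^sup>2 + 1 / s\<close> with
  \<open>s = sqrt J\<close>: as the mean of the square of \<open>t\<close> is of order
  \<open>1 / J\<close>, both summands contribute order \<open>1 / sqrt J\<close>. The continuum
  posterior is compared directly with the Riccati update at the sample covariance, with no
  discretized posterior in between, so discretization and sampling errors simply add up in the
  difference of the two covariances. On the probabilistic side, the first, second and fourth moments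
  of scalar marginals carry the whole argument.\<close>

text \<open>Dirichlet's principle: the representing vector minimises \<open>\<Phi>\<close>, which is
  a completed square up to a constant. Completeness provides the minimiser, because minimising
  sequences are Cauchy.\<close>

lemma riesz_representation:
  fixes f :: "'a::{real_inner, complete_space} \<Rightarrow> real"
  assumes "bounded_linear f"
  obtains z where "\<And>x. f x = x \<bullet> z"
proof -
  interpret f: bounded_linear f by fact
  define \<Phi> where "\<Phi> x = (norm x)\<^sup>2 - 2 * f x" for x
  obtain K where K: "\<And>x. norm (f x) \<le> norm x * K" using f.bounded by blast
  have lower: "- K\<^sup>2 \<le> \<Phi> x" for x
  proof -
    have "f x \<le> norm x * K" using K[of x] by simp
    moreover have "0 \<le> (norm x - K)\<^sup>2" by simp
    ultimately show ?thesis unfolding \<Phi>_def by (simp add: power2_diff)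
  qed
  define d where "d = (INF x. \<Phi> x)"
  have bdd: "bdd_below (range \<Phi>)" using lower by (auto intro!: bdd_belowI2)
  have d_le: "d \<le> \<Phi> x" for x unfolding d_def using bdd by (intro cINF_lower) auto
  have "\<exists>x. \<Phi> x < d + inverse (real (Suc n))" for n
  proof -
    have "d < d + inverse (real (Suc n))" by simp
    then show ?thesis unfolding d_def using cINF_less_iff[OF _ bdd, of "(INF x. \<Phi> x) + inverse (real (Suc n))"]
      by (simp del: of_nat_Suc)
  qed
  then obtain X where X: "\<And>n. \<Phi> (X n) < d + inverse (real (Suc n))" by metis
  \<comment> \<open>Parallelogram identity: the midpoint costs at least \<open>d\<close>, so two
    near-minimisers are close to each other.\<close>
  have par: "(norm (x - y))\<^sup>2 \<le> 2 * (\<Phi> x - d) + 2 * (\<Phi> y - d)" for x y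
  proof -
    have "(norm (x - y))\<^sup>2 = 2 * \<Phi> x + 2 * \<Phi> y - 4 * \<Phi> ((1/2) *\<^sub>R (x + y))"
      unfolding \<Phi>_def power2_norm_eq_inner f.scaleR f.add
      by (simp add: inner_diff inner_add inner_commute algebra_simps)
    then show ?thesis using d_le[of "(1/2) *\<^sub>R (x + y)"] by simp
  qed
  have "Cauchy X"
  proof (rule metric_CauchyI)
    fix e :: real assume e: "0 < e"
    obtain M where M: "inverse (real (Suc M)) < e\<^sup>2 / 8"
      using reals_Archimedean[of "e\<^sup>2 / 8"] e by auto
    have "dist (X m) (X n) < e" if "M \<le> m" "M \<le> n" for m n
    proof -
      have "inverse (real (Suc m)) \<le> inverse (real (Suc M))"
        "inverse (real (Suc n)) \<le> inverse (real (Suc M))"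
        using that by (auto intro!: le_imp_inverse_le)
      then have "(norm (X m - X n))\<^sup>2 < e\<^sup>2"
        using par[of "X m" "X n"] X[of m] X[of n] M e zero_less_power[OF e, of 2] by argo
      then show ?thesis unfolding dist_norm using e by (simp add: power_less_imp_less_base)
    qed
    then show "\<exists>M. \<forall>m\<ge>M. \<forall>n\<ge>M. dist (X m) (X n) < e" by blast
  qed
  then obtain z where z: "X \<longlonglongrightarrow> z" using Cauchy_convergent_iff convergent_def by blast
  have "(\<lambda>n. \<Phi> (X n)) \<longlonglongrightarrow> \<Phi> z"
    unfolding \<Phi>_def by (intro tendsto_intros f.tendsto z)
  moreover have "(\<lambda>n. d + inverse (real (Suc n))) \<longlonglongrightarrow> d + 0"
    by (intro tendsto_intros LIMSEQ_inverse_real_of_nat)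
  ultimately have "\<Phi> z \<le> d"
    using X by (intro LIMSEQ_le[of "\<lambda>n. \<Phi> (X n)" _ "\<lambda>n. d + inverse (real (Suc n))"])
      (auto intro: less_imp_le)
  then have min: "\<Phi> z \<le> \<Phi> x" for x using d_le[of x] by linarith
  have "f x = x \<bullet> z" for x
  proof (cases "x = 0")
    case False
    define g where "g = x \<bullet> z - f x"
    \<comment> \<open>The minimiser of \<open>\<Phi>\<close> on the line through \<open>z\<close> in
      direction \<open>x\<close>. It would beat \<open>z\<close> unless the first variation
      \<open>g\<close> vanishes.\<close>
    define t where "t = - g / (norm x)\<^sup>2"
    have nz: "(norm x)\<^sup>2 > 0" using False by simp
    have "\<Phi> (z + t *\<^sub>R x) = \<Phi> z + 2 * t * g + t\<^sup>2 * (norm x)\<^sup>2"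
      unfolding \<Phi>_def g_def power2_norm_eq_inner f.scaleR f.add
      by (simp add: inner_diff inner_add inner_commute algebra_simps power2_eq_square)
    also have "\<dots> = \<Phi> z - g\<^sup>2 / (norm x)\<^sup>2"
      unfolding t_def using nz by (simp add: field_simps power2_eq_square)
    finally have "g\<^sup>2 / (norm x)\<^sup>2 \<le> 0" using min[of "z + t *\<^sub>R x"] by simp
    then have "g = 0" using nz by (simp add: divide_le_0_iff)
    then show ?thesis by (simp add: g_def)
  qed (simp add: f.zero)
  then show ?thesis using that by blast
qed

text \<open>\<open>adjoint\<close> is a choice among the maps satisfying this identity, so the
  content is that one exists. Riesz supplies its value at each \<open>w\<close>; this is where
  completeness of the domain enters.\<close>

lemma adjoint_bounded_linear_works:
  fixes f :: "'a::{real_inner, complete_space} \<Rightarrow> 'b::euclidean_space"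
  assumes "bounded_linear f"
  shows "f x \<bullet> w = x \<bullet> adjoint f w"
proof -
  have "\<exists>z. \<forall>x. f x \<bullet> w = x \<bullet> z" for w
  proof -
    have "bounded_linear (\<lambda>x. f x \<bullet> w)"
      using bounded_linear_compose[OF bounded_linear_inner_left assms] .
    from riesz_representation[OF this] show ?thesis by metis
  qed
  then have "\<exists>g. \<forall>x w. f x \<bullet> w = x \<bullet> g w" by metis
  then have "\<forall>x w. f x \<bullet> w = x \<bullet> adjoint f w" unfolding adjoint_def by (rule someI_ex)
  then show ?thesis by blast
qed

section \<open>Finite orthonormal families and Bessel's inequality\<close>

lemma finite_span_orthonormal_basis:
  fixes B :: "'a::real_inner set"
  assumes "finite B"
  obtains E where "finite E" "span E = span B" "pairwise orthogonal E" "\<And>e. e \<in> E \<Longrightarrow> norm e = 1"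
proof -
  obtain C where C: "finite C" "span C = span B" "pairwise orthogonal C"
    using basis_orthogonal[OF assms] by blast
  \<comment> \<open>Orthogonalisation may produce the zero vector, which cannot be normalised and
    adds nothing to the span.\<close>
  define E where "E = (\<lambda>x. x /\<^sub>R norm x) ` (C - {0})"
  have n1: "norm e = 1" if "e \<in> E" for e using that unfolding E_def by auto (metis left_inverse norm_eq_zero)
  have fE: "finite E" using C(1) unfolding E_def by simp
  have "pairwise orthogonal E"
    using C(3) unfolding E_def pairwise_image
    by (auto simp: pairwise_def orthogonal_clauses)
  moreover have "span E = span C"
  proof
    show "span E \<subseteq> span C" unfolding E_def
      by (intro span_minimal subsetI) (auto intro!: span_scale intro: span_base)
    have "c \<in> span E" if "c \<in> C" for c
    proof (cases "c = 0")
      case False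
      then have "c /\<^sub>R norm c \<in> span E" using that unfolding E_def by (intro span_base) auto
      then have "norm c *\<^sub>R (c /\<^sub>R norm c) \<in> span E" by (rule span_scale)
      then show ?thesis using False by simp
    qed (simp add: span_zero)
    then show "span C \<subseteq> span E" by (intro span_minimal subsetI) auto
  qed
  ultimately show ?thesis using that[OF fE _ _ n1] C(2) by simp
qed

locale orthonormal_family =
  fixes E :: "'a::real_inner set"
  assumes finE: "finite E" and ortho: "pairwise orthogonal E" and norm1: "\<And>e. e \<in> E \<Longrightarrow> norm e = 1"
begin

lemma inner_E: "e \<in> E \<Longrightarrow> f \<in> E \<Longrightarrow> e \<bullet> f = of_bool (e = f)"
  using ortho norm1 by (auto simp: pairwise_def orthogonal_def dot_square_norm)

lemma residual_orthogonal:
  assumes "v \<in> span E"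
  shows "(x - (\<Sum>e\<in>E. (e \<bullet> x) *\<^sub>R e)) \<bullet> v = 0"
proof -
  have "orthogonal (x - (\<Sum>e\<in>E. (e \<bullet> x) *\<^sub>R e)) f" if "f \<in> E" for f
  proof -
    have "(\<Sum>e\<in>E. (e \<bullet> x) * (e \<bullet> f)) = (\<Sum>e\<in>E. if e = f then e \<bullet> x else 0)"
      using that by (intro sum.cong) (auto simp: inner_E)
    also have "\<dots> = f \<bullet> x" using that finE by simp
    finally show ?thesis
      by (simp add: orthogonal_def inner_diff_left inner_sum_left) (simp add: inner_commute)
  qed
  then show ?thesis using orthogonal_to_span[OF assms] by (simp add: orthogonal_def)
qed

lemma span_expansion:
  assumes "v \<in> span E"
  shows "v = (\<Sum>e\<in>E. (e \<bullet> v) *\<^sub>R e)"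
proof -
  let ?r = "v - (\<Sum>e\<in>E. (e \<bullet> v) *\<^sub>R e)"
  have "?r \<in> span E" using assms by (intro span_diff span_sum span_scale) (auto intro: span_base)
  then have "?r \<bullet> ?r = 0" by (rule residual_orthogonal)
  then show ?thesis by simp
qed

lemma inner_span:
  assumes "v \<in> span E"
  shows "v \<bullet> x = (\<Sum>e\<in>E. (e \<bullet> v) * (e \<bullet> x))"
  by (subst span_expansion[OF assms]) (simp add: inner_sum_left)

lemma norm_span:
  assumes "v \<in> span E"
  shows "(norm v)\<^sup>2 = (\<Sum>e\<in>E. (e \<bullet> v)\<^sup>2)"
  unfolding power2_norm_eq_inner by (subst inner_span[OF assms]) (simp add: power2_eq_square)

lemma bessel: "(\<Sum>e\<in>E. (e \<bullet> x)\<^sup>2) \<le> (norm x)\<^sup>2"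
proof -
  let ?p = "\<Sum>e\<in>E. (e \<bullet> x) *\<^sub>R e"
  have p: "?p \<in> span E" by (intro span_sum span_scale span_base)
  have "?p \<bullet> x = ?p \<bullet> ?p" using residual_orthogonal[OF p, of x]
    by (simp add: inner_diff_left) (simp add: inner_commute)
  moreover have "?p \<bullet> x = (\<Sum>e\<in>E. (e \<bullet> x)\<^sup>2)" by (simp add: inner_sum_left power2_eq_square)
  moreover have "0 \<le> (x - ?p) \<bullet> (x - ?p)" by simp
  ultimately show ?thesis unfolding power2_norm_eq_inner
    by (simp add: inner_diff_left inner_diff_right inner_commute)
qed

end

section \<open>Biorthogonal bases and the coefficients of the orthogonal projection\<close>

text \<open>The dual vector of \<open>\<phi> k\<close> is its component orthogonal to the other
  basis vectors, rescaled to pair to 1 with \<open>\<phi> k\<close>. Independence keeps that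
  component nonzero.\<close>

lemma dual_basis_exists:
  fixes \<phi> :: "nat \<Rightarrow> 'h::real_inner"
  assumes inj: "inj_on \<phi> {..<n}" and ind: "independent (\<phi> ` {..<n})"
  obtains \<psi> where "\<And>i. i < n \<Longrightarrow> \<psi> i \<in> span (\<phi> ` {..<n})"
    "\<And>i k. i < n \<Longrightarrow> k < n \<Longrightarrow> \<phi> i \<bullet> \<psi> k = of_bool (i = k)"
proof -
  have "\<exists>p. p \<in> span (\<phi> ` {..<n}) \<and> (\<forall>i<n. \<phi> i \<bullet> p = of_bool (i = k))" if k: "k < n" for k
  proof -
    let ?W = "\<phi> ` ({..<n} - {k})"
    obtain E where E: "finite E" "span E = span ?W" "pairwise orthogonal E"
      "\<And>e. e \<in> E \<Longrightarrow> norm e = 1"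
      using finite_span_orthonormal_basis[of ?W] by auto
    interpret orthonormal_family E by standard (use E in auto)
    define q where "q = (\<Sum>e\<in>E. (e \<bullet> \<phi> k) *\<^sub>R e)"
    define r where "r = \<phi> k - q"
    have q: "q \<in> span ?W" unfolding q_def E(2)[symmetric] by (intro span_sum span_scale span_base)
    have orth: "v \<bullet> r = 0" if "v \<in> span ?W" for v
      using residual_orthogonal[of v "\<phi> k"] that E(2) unfolding r_def q_def
      by (simp add: inner_commute)
    have W: "?W = \<phi> ` {..<n} - {\<phi> k}" using inj k by (auto simp: inj_on_def)
    have "\<phi> k \<notin> span ?W" using ind k unfolding W dependent_def by auto
    then have r0: "r \<noteq> 0" using q unfolding r_def by auto
    have rr: "\<phi> k \<bullet> r = r \<bullet> r"
      using orth[OF q] unfolding r_def by (simp add: inner_diff_left)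
    have "\<phi> i \<bullet> (r /\<^sub>R (r \<bullet> r)) = of_bool (i = k)" if "i < n" for i
    proof (cases "i = k")
      case True then show ?thesis using rr r0 by simp
    next
      case False
      then have "\<phi> i \<bullet> r = 0" using that by (intro orth span_base) auto
      then show ?thesis using False by simp
    qed
    moreover have "r /\<^sub>R (r \<bullet> r) \<in> span (\<phi> ` {..<n})"
    proof -
      have "q \<in> span (\<phi> ` {..<n})" using q span_mono[of ?W "\<phi> ` {..<n}"] by auto
      then show ?thesis unfolding r_def using k by (intro span_scale span_diff) (auto intro: span_base)
    qed
    ultimately show ?thesis by blast
  qed
  then show ?thesis using that by metis
qed

locale discretization =
  fixes n :: nat and \<phi> :: "nat \<Rightarrow> 'h::real_inner"
  assumes inj: "inj_on \<phi> {..<n}" and ind: "independent (\<phi> ` {..<n})"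
begin

abbreviation "V \<equiv> span (\<phi> ` {..<n})"

text \<open>The biorthogonal basis: pairing with it reads off coefficients, both of elements of
  \<open>V\<close> and of orthogonal projections, and its Gram matrix inverts that of
  \<open>\<phi>\<close>.\<close>

definition "dual_basis = (SOME \<psi>. (\<forall>i<n. \<psi> i \<in> V) \<and> (\<forall>i<n. \<forall>k<n. \<phi> i \<bullet> \<psi> k = of_bool (i = k)))"

lemma dual_basis:
  shows dual_in_V: "i < n \<Longrightarrow> dual_basis i \<in> V"
    and dual_inner: "i < n \<Longrightarrow> k < n \<Longrightarrow> \<phi> i \<bullet> dual_basis k = of_bool (i = k)"
proof -
  have "\<exists>\<psi>. (\<forall>i<n. \<psi> i \<in> V) \<and> (\<forall>i<n. \<forall>k<n. \<phi> i \<bullet> \<psi> k = of_bool (i = k))"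
    using dual_basis_exists[OF inj ind] by metis
  from someI_ex[OF this]
  show "i < n \<Longrightarrow> dual_basis i \<in> V"
    "i < n \<Longrightarrow> k < n \<Longrightarrow> \<phi> i \<bullet> dual_basis k = of_bool (i = k)"
    unfolding dual_basis_def by blast+
qed

lemma synth_in_V: "synth n \<phi> a \<in> V"
  unfolding synth_def by (intro span_sum span_scale span_base) auto

lemma dual_expansion:
  assumes "v \<in> V"
  shows "v = (\<Sum>l<n. (v \<bullet> dual_basis l) *\<^sub>R \<phi> l)"
proof (rule span_induct[OF assms])
  show "subspace {v. v = (\<Sum>l<n. (v \<bullet> dual_basis l) *\<^sub>R \<phi> l)}"
    unfolding subspace_def
    by (auto simp: inner_add_left scaleR_add_left sum.distrib scaleR_sum_right[symmetric]
        simp flip: scaleR_scaleR)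
  fix v assume "v \<in> \<phi> ` {..<n}"
  then obtain k where k: "k < n" "v = \<phi> k" by auto
  have "(\<Sum>l<n. (\<phi> k \<bullet> dual_basis l) *\<^sub>R \<phi> l) = (\<Sum>l<n. if l = k then \<phi> l else 0)"
    using k by (intro sum.cong) (auto simp: dual_inner)
  then show "v = (\<Sum>l<n. (v \<bullet> dual_basis l) *\<^sub>R \<phi> l)" using k by simp
qed

lemma synth_inner_dual: "k < n \<Longrightarrow> synth n \<phi> a \<bullet> dual_basis k = a k"
proof -
  assume k: "k < n"
  have "synth n \<phi> a \<bullet> dual_basis k = (\<Sum>i<n. if i = k then a i else 0)"
    unfolding synth_def inner_sum_left using k by (intro sum.cong) (auto simp: dual_inner)
  then show ?thesis using k by simp
qed

lemma proj_exists:
  obtains p where "p \<in> V" "\<And>v. v \<in> V \<Longrightarrow> (x - p) \<bullet> v = 0"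
proof -
  obtain E where E: "finite E" "span E = V" "pairwise orthogonal E"
    "\<And>e. e \<in> E \<Longrightarrow> norm e = 1"
    using finite_span_orthonormal_basis[of "\<phi> ` {..<n}"] by auto
  interpret orthonormal_family E by standard (use E in auto)
  show ?thesis
  proof (rule that)
    show "(\<Sum>e\<in>E. (e \<bullet> x) *\<^sub>R e) \<in> V" unfolding E(2)[symmetric]
      by (intro span_sum span_scale span_base)
  qed (use residual_orthogonal E(2) in auto)
qed

text \<open>The dual vectors lie in \<open>V\<close> and so do not see the residual of the
  projection. Pairing with them settles both existence and uniqueness for the definite
  description.\<close>

lemma proj_coeffs_eq: "proj_coeffs n \<phi> h = (\<lambda>i\<in>{..<n}. h \<bullet> dual_basis i)"
  and synth_proj_coeffs_residual: "v \<in> V \<Longrightarrow> (h - synth n \<phi> (proj_coeffs n \<phi> h)) \<bullet> v = 0"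
proof -
  let ?a = "\<lambda>i\<in>{..<n}. h \<bullet> dual_basis i"
  obtain p where p: "p \<in> V" "\<And>v. v \<in> V \<Longrightarrow> (h - p) \<bullet> v = 0" using proj_exists by blast
  have "p = (\<Sum>l<n. (p \<bullet> dual_basis l) *\<^sub>R \<phi> l)" using p(1) by (rule dual_expansion)
  also have "\<dots> = synth n \<phi> ?a" unfolding synth_def
    using p(2)[OF dual_in_V] by (intro sum.cong) (auto simp: inner_diff_left)
  finally have pa: "p = synth n \<phi> ?a" .
  show eq: "proj_coeffs n \<phi> h = ?a" unfolding proj_coeffs_def
  proof (rule the_equality)
    show "?a \<in> Rn n \<and> (\<forall>v\<in>V. orthogonal (h - synth n \<phi> ?a) v)"
      using p(2) pa by (auto simp: Rn_def orthogonal_def)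
    fix a assume a: "a \<in> Rn n \<and> (\<forall>v\<in>V. orthogonal (h - synth n \<phi> a) v)"
    show "a = ?a"
    proof (rule PiE_ext)
      show "a \<in> ({..<n} \<rightarrow>\<^sub>E UNIV)" using a by (simp add: Rn_def)
      show "?a \<in> ({..<n} \<rightarrow>\<^sub>E UNIV)" by auto
      fix i assume i: "i \<in> {..<n}"
      then have "(h - synth n \<phi> a) \<bullet> dual_basis i = 0"
        using a dual_in_V by (auto simp: orthogonal_def)
      then show "a i = ?a i" using i synth_inner_dual[of i a] by (simp add: inner_diff_left)
    qed
  qed
  show "v \<in> V \<Longrightarrow> (h - synth n \<phi> (proj_coeffs n \<phi> h)) \<bullet> v = 0" unfolding eq using p(2) pa by simp
qed

lemma synth_cong: "(\<And>i. i < n \<Longrightarrow> a i = b i) \<Longrightarrow> synth n \<phi> a = synth n \<phi> b"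
  unfolding synth_def by (intro sum.cong) auto

lemma proj_coeffs_synth: "i < n \<Longrightarrow> proj_coeffs n \<phi> (synth n \<phi> a) i = a i"
  by (simp add: proj_coeffs_eq synth_inner_dual)

lemma gram_sum: "(\<Sum>k<n. gram \<phi> i k * b k) = \<phi> i \<bullet> synth n \<phi> b"
  by (simp add: gram_def synth_def inner_sum_right mult.commute)

lemma inner_gram: "inner_G n (gram \<phi>) a b = synth n \<phi> a \<bullet> synth n \<phi> b"
  unfolding inner_G_def synth_def inner_sum_left gram_def
  by (simp add: inner_sum_right sum_distrib_left ac_simps)

lemma norm_gram: "norm_G n (gram \<phi>) a = norm (synth n \<phi> a)"
  by (simp add: norm_G_def inner_gram norm_eq_sqrt_inner)

text \<open>Orthogonality of the residual; through this, pairings with projected vectors in the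
  weighted inner product become pairings with \<open>h\<close> itself.\<close>

lemma synth_inner_proj: "synth n \<phi> a \<bullet> synth n \<phi> (proj_coeffs n \<phi> h) = synth n \<phi> a \<bullet> h"
  using synth_proj_coeffs_residual[OF synth_in_V, of h a]
  by (simp only: inner_commute[of _ "synth n \<phi> a"] inner_diff_right)

text \<open>\<open>mat_inverse\<close> chooses a two-sided inverse, so one must be exhibited: the
  Gram matrix of the dual basis, by expanding a dual vector in the \<open>\<phi> l\<close>.\<close>

lemma mat_inverse_gram:
  assumes "i < n" "k < n"
  shows "(\<Sum>l<n. gram \<phi> i l * mat_inverse n (gram \<phi>) l k) = of_bool (i = k)"
proof -
  define B where "B l k = dual_basis l \<bullet> dual_basis k" for l k
  have right: "(\<Sum>l<n. gram \<phi> i l * B l k) = of_bool (i = k)" if "i < n" "k < n" for i k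
  proof -
    have "(\<Sum>l<n. gram \<phi> i l * B l k) = \<phi> i \<bullet> (\<Sum>l<n. (dual_basis k \<bullet> dual_basis l) *\<^sub>R \<phi> l)"
      unfolding gram_def B_def inner_sum_right by (intro sum.cong) (auto simp: inner_commute)
    also have "\<dots> = \<phi> i \<bullet> dual_basis k" using dual_expansion[OF dual_in_V[OF that(2)]] by simp
    finally show ?thesis using that dual_inner by simp
  qed
  have left: "(\<Sum>l<n. B i l * gram \<phi> l k) = of_bool (i = k)" if "i < n" "k < n" for i k
  proof -
    have "(\<Sum>l<n. B i l * gram \<phi> l k) = (\<Sum>l<n. gram \<phi> k l * B l i)"
      unfolding gram_def B_def by (intro sum.cong) (auto simp: inner_commute)
    then show ?thesis using right[OF that(2,1)] by auto
  qed
  have "\<exists>B. \<forall>i<n. \<forall>k<n. (\<Sum>l<n. gram \<phi> i l * B l k) = of_bool (i = k) \<and>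
      (\<Sum>l<n. B i l * gram \<phi> l k) = of_bool (i = k)"
    using left right by blast
  from someI_ex[OF this] show ?thesis unfolding mat_inverse_def using assms by blast
qed

text \<open>The observation map and its weighted adjoint, transported to the Hilbert space. There
  they are adjoint for the plain inner product, and the Gram matrix disappears from the
  analysis.\<close>

definition "lift_obs F h = obs n F (proj_coeffs n \<phi> h)"
definition "lift_obs_adj F w = synth n \<phi> (obs_adj n (gram \<phi>) F w)"

text \<open>Pairing with \<open>\<phi> i\<close> produces a row of the Gram matrix, which cancels
  the inverse built into \<open>obs_adj\<close>.\<close>

lemma inner_lift_obs_adj: "i < n \<Longrightarrow> \<phi> i \<bullet> lift_obs_adj F w = F i \<bullet> w"
proof -
  assume i: "i < n"
  let ?B = "mat_inverse n (gram \<phi>)"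
  have "\<phi> i \<bullet> lift_obs_adj F w = (\<Sum>l<n. gram \<phi> i l * (\<Sum>k<n. ?B l k * (F k \<bullet> w)))"
    unfolding lift_obs_adj_def gram_sum[symmetric]
    by (intro sum.cong) (auto simp: obs_adj_def mat_vec_def)
  also have "\<dots> = (\<Sum>k<n. (\<Sum>l<n. gram \<phi> i l * ?B l k) * (F k \<bullet> w))"
    unfolding sum_distrib_left sum_distrib_right by (subst sum.swap) (simp add: ac_simps)
  also have "\<dots> = (\<Sum>k<n. if k = i then F k \<bullet> w else 0)"
    using i by (intro sum.cong) (auto simp: mat_inverse_gram)
  finally show ?thesis using i by simp
qed

lemma lift_obs_adjoint: "lift_obs F h \<bullet> w = h \<bullet> lift_obs_adj F w"
proof -
  have "lift_obs F h \<bullet> w = (\<Sum>k<n. proj_coeffs n \<phi> h k * (\<phi> k \<bullet> lift_obs_adj F w))"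
    unfolding lift_obs_def obs_def inner_sum_left by (intro sum.cong) (auto simp: inner_lift_obs_adj)
  also have "\<dots> = synth n \<phi> (proj_coeffs n \<phi> h) \<bullet> lift_obs_adj F w"
    by (simp add: synth_def inner_sum_left)
  finally show ?thesis unfolding lift_obs_adj_def
    by (simp only: synth_inner_proj inner_commute[of _ "synth n \<phi> (obs_adj n (gram \<phi>) F w)"])
qed

lemma lift_obs_synth: "lift_obs F (synth n \<phi> a) = obs n F a"
  unfolding lift_obs_def obs_def by (intro sum.cong) (auto simp: proj_coeffs_synth)

lemma bounded_linear_proj_coeffs: "i < n \<Longrightarrow> bounded_linear (\<lambda>h. proj_coeffs n \<phi> h i)"
  by (simp add: proj_coeffs_eq bounded_linear_inner_left)

lemma bounded_linear_lift_obs: "bounded_linear (lift_obs F)"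
  unfolding lift_obs_def[abs_def] obs_def
  by (intro bounded_linear_sum bounded_linear_compose[OF bounded_linear_scaleR_left]
      bounded_linear_proj_coeffs) auto

lemma lift_op_eq: "lift_op n \<phi> A h = (\<Sum>i<n. (\<Sum>k<n. A i k * proj_coeffs n \<phi> h k) *\<^sub>R \<phi> i)"
  unfolding lift_op_def synth_def mat_vec_def by simp

lemma bounded_linear_lift_op: "bounded_linear (lift_op n \<phi> A)"
  unfolding lift_op_eq[abs_def]
  by (intro bounded_linear_sum bounded_linear_compose[OF bounded_linear_scaleR_left]
      bounded_linear_const_mult bounded_linear_proj_coeffs) auto

lemma lift_op_synth: "lift_op n \<phi> A (synth n \<phi> a) = synth n \<phi> (mat_vec n A a)"
  unfolding lift_op_eq unfolding synth_def mat_vec_def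
  by (intro sum.cong) (auto simp: proj_coeffs_synth[unfolded synth_def])

end

section \<open>The posterior covariance map\<close>

text \<open>The quadratic form attains its minimum on the compact unit sphere; homogeneity of degree
  two extends the bound to all vectors.\<close>

lemma pos_def_lower_bound:
  fixes \<Gamma> :: "real^'d^'d"
  assumes pos: "\<And>w. w \<noteq> 0 \<Longrightarrow> 0 < w \<bullet> (\<Gamma> *v w)"
  obtains \<gamma> where "0 < \<gamma>" "\<And>w. \<gamma> * (norm w)\<^sup>2 \<le> w \<bullet> (\<Gamma> *v w)"
proof -
  let ?S = "sphere 0 1 :: (real^'d) set"
  have "axis undefined 1 \<in> ?S" by simp
  then have ne: "?S \<noteq> {}" by blast
  have "continuous_on ?S (\<lambda>w. w \<bullet> (\<Gamma> *v w))"
    by (intro continuous_intros matrix_vector_mult_linear_continuous_on)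
  then obtain z where z: "z \<in> ?S" "\<And>w. w \<in> ?S \<Longrightarrow> z \<bullet> (\<Gamma> *v z) \<le> w \<bullet> (\<Gamma> *v w)"
    using continuous_attains_inf[OF compact_sphere ne] by metis
  have "z \<bullet> (\<Gamma> *v z) * (norm w)\<^sup>2 \<le> w \<bullet> (\<Gamma> *v w)" for w
  proof (cases "w = 0")
    case False
    have "z \<bullet> (\<Gamma> *v z) \<le> (w /\<^sub>R norm w) \<bullet> (\<Gamma> *v (w /\<^sub>R norm w))"
      using False by (intro z(2)) simp
    also have "\<dots> = (w \<bullet> (\<Gamma> *v w)) / (norm w)\<^sup>2"
      by (simp add: matrix_vector_mult_scaleR power2_eq_square divide_inverse)
    finally show ?thesis using False by (simp add: field_simps)
  qed simp
  moreover have "z \<noteq> 0" using z(1) by auto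
  then have "0 < z \<bullet> (\<Gamma> *v z)" by (rule pos)
  ultimately show ?thesis using that by blast
qed

lemma matrix_inv_mult:
  assumes "invertible (M :: real^'n^'n)"
  shows "M ** matrix_inv M = mat 1" "matrix_inv M ** M = mat 1"
  using someI_ex[OF assms[unfolded invertible_def]] unfolding matrix_inv_def by auto

text \<open>Test the adjoint relation at \<open>x = G w\<close> and cancel one factor
  \<open>norm (G w)\<close>. An arbitrary adjoint pair is allowed because the lemma serves gains,
  observation maps and cross-covariances alike.\<close>

lemma norm_adjoint_le:
  fixes F :: "'a::real_inner \<Rightarrow> 'b::real_inner"
  assumes adj: "\<And>x w. F x \<bullet> w = x \<bullet> G w"
    and f: "\<And>x. norm (F x) \<le> f * norm x" and f0: "0 \<le> f"
  shows "norm (G w) \<le> f * norm w"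
proof (cases "G w = 0")
  case False
  have "norm (G w) * norm (G w) = F (G w) \<bullet> w"
    by (simp add: adj flip: power2_norm_eq_inner power2_eq_square)
  also have "\<dots> \<le> norm (F (G w)) * norm w" by (rule norm_cauchy_schwarz)
  also have "\<dots> \<le> (f * norm (G w)) * norm w" by (intro mult_right_mono f) auto
  finally show ?thesis using False by simp
qed (simp add: f0)

section \<open>Kalman gain and Riccati update for a general covariance operator\<close>

locale noise_covariance =
  fixes \<Gamma> :: "real^'d^'d" and \<gamma> :: real
  assumes sym: "transpose \<Gamma> = \<Gamma>" and \<gamma>_pos: "0 < \<gamma>"
    and \<gamma>_bound: "\<And>w. \<gamma> * (norm w)\<^sup>2 \<le> w \<bullet> (\<Gamma> *v w)"

text \<open>With the adjoint \<open>Fs\<close> as a parameter, the continuum data and the lifted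
  ensemble data are two instances of one locale, so that their posteriors can be compared by one
  formula.\<close>

locale kalman = noise_covariance \<Gamma> \<gamma> for \<Gamma> :: "real^'d^'d" and \<gamma> :: real +
  fixes C :: "'h::real_inner \<Rightarrow> 'h" and F :: "'h \<Rightarrow> real^'d" and Fs :: "real^'d \<Rightarrow> 'h"
  assumes C_lin: "bounded_linear C" and C_sa: "self_adjoint C" and C_pos: "positive_op C"
    and F_lin: "bounded_linear F" and F_adj: "\<And>x w. F x \<bullet> w = x \<bullet> Fs w"
begin

lemma F_adj': "w \<bullet> F x = Fs w \<bullet> x"
  using F_adj by (simp add: inner_commute)

lemma C_sym: "C x \<bullet> y = x \<bullet> C y"
  using C_sa by (simp add: self_adjoint_def)

lemma C_nonneg: "0 \<le> x \<bullet> C x"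
  using C_pos by (simp add: positive_op_def)

sublocale C: bounded_linear C by (rule C_lin)
sublocale F: bounded_linear F by (rule F_lin)

lemma linear_Fs: "linear Fs"
proof (rule linearI)
  show "Fs (v + w) = Fs v + Fs w" for v w
    by (subst vector_eq_rdot[symmetric]) (simp add: F_adj'[symmetric] inner_add_left)
  show "Fs (c *\<^sub>R v) = c *\<^sub>R Fs v" for c v
    by (subst vector_eq_rdot[symmetric]) (simp add: F_adj'[symmetric])
qed

sublocale Fs: bounded_linear Fs
  using linear_Fs by (simp add: linear_linear[symmetric])

text \<open>The objects of Kalman filtering: \<open>S\<close> is the innovation covariance,
  \<open>R\<close> its inverse, \<open>K\<close> the gain, \<open>A\<close> stands for
  \<open>I - K F\<close>, and \<open>post\<close> is the Riccati update. In \<open>Fs\<close>,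
  \<open>Ks\<close> and \<open>As\<close> the suffix marks the adjoint.\<close>

definition "S = matrix (\<lambda>w. F (C (Fs w))) + \<Gamma>"
definition "R w = matrix_inv S *v w"
definition "K w = C (Fs (R w))"
definition "Ks h = R (F (C h))"
definition "A h = h - K (F h)"
definition "As h = h - Fs (Ks h)"
definition "post h = C h - K (F (C h))"

lemma S_mult: "S *v w = F (C (Fs w)) + \<Gamma> *v w"
proof -
  have "linear (\<lambda>w. F (C (Fs w)))"
    by (intro bounded_linear.linear bounded_linear_intros F_lin C_lin Fs.bounded_linear_axioms
       bounded_linear_compose[OF F_lin] bounded_linear_compose[OF C_lin])
  then have "matrix (\<lambda>w. F (C (Fs w))) *v w = F (C (Fs w))" by (simp add: matrix_vector_mul(1)[symmetric])
  then show ?thesis by (simp add: S_def matrix_vector_mult_add_rdistrib)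
qed

text \<open>As \<open>C\<close> is positive, \<open>S\<close> dominates the noise covariance. Hence
  \<open>S\<close> is invertible even for a degenerate sample covariance, with a lower bound that
  does not depend on \<open>C\<close>.\<close>

lemma S_lower: "\<gamma> * (norm w)\<^sup>2 \<le> w \<bullet> (S *v w)"
  using \<gamma>_bound[of w] C_nonneg[of "Fs w"] by (simp add: S_mult inner_add_right F_adj')

lemma S_invertible: "invertible S"
proof -
  have "w = 0" if "S *v w = 0" for w
    using S_lower[of w] \<gamma>_pos that by (simp add: mult_le_0_iff)
  then have "inj ((*v) S)"
    by (intro linear_injective_0[THEN iffD2]) auto
  then show ?thesis by (simp add: invertible_left_inverse matrix_left_invertible_injective)
qed

lemma S_R: "S *v R w = w"
  using S_invertible by (simp add: R_def matrix_vector_mul_assoc matrix_inv_mult(1))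

lemma R_S: "R (S *v w) = w"
  using S_invertible by (simp add: R_def matrix_vector_mul_assoc matrix_inv_mult(2))

lemma \<Gamma>_sym: "(\<Gamma> *v v) \<bullet> w = v \<bullet> (\<Gamma> *v w)"
  by (metis sym dot_lmul_matrix vector_transpose_matrix)

lemma S_sym: "(S *v v) \<bullet> w = v \<bullet> (S *v w)"
  by (simp add: S_mult inner_add_left inner_add_right F_adj F_adj' C_sym \<Gamma>_sym)

lemma R_sym: "R v \<bullet> w = v \<bullet> R w"
  by (metis S_sym S_R)

lemma R_lin: "bounded_linear R"
  unfolding R_def[abs_def] by (rule matrix_vector_mul_bounded_linear)

sublocale R: bounded_linear R by (rule R_lin)

lemma K_lin: "bounded_linear K"
  unfolding K_def[abs_def]
  by (intro bounded_linear_compose[OF C_lin] bounded_linear_compose[OF Fs.bounded_linear_axioms] R_lin)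

lemma Ks_lin: "bounded_linear Ks"
  unfolding Ks_def[abs_def]
  by (intro bounded_linear_compose[OF R_lin] bounded_linear_compose[OF F_lin] C_lin)

sublocale K: bounded_linear K by (rule K_lin)
sublocale Ks: bounded_linear Ks by (rule Ks_lin)

lemma A_lin: "bounded_linear A"
  unfolding A_def[abs_def]
  by (intro bounded_linear_sub bounded_linear_ident bounded_linear_compose[OF K_lin] F_lin)

lemma post_lin: "bounded_linear post"
  unfolding post_def[abs_def]
  by (intro bounded_linear_sub C_lin bounded_linear_compose[OF K_lin] bounded_linear_compose[OF F_lin])

sublocale A: bounded_linear A by (rule A_lin)
sublocale post: bounded_linear post by (rule post_lin)

lemma K_adj: "K w \<bullet> h = w \<bullet> Ks h"
  by (simp add: K_def Ks_def C_sym F_adj'[symmetric] R_sym)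

lemma A_adj: "A g \<bullet> h = g \<bullet> As h"
  by (simp add: A_def As_def inner_diff_left inner_diff_right K_adj F_adj)

lemma post_eq_A: "post h = A (C h)"
  by (simp add: post_def A_def)

lemma post_eq_As: "post h = C (As h)"
  by (simp add: post_def As_def C.diff K_def Ks_def)

text \<open>From \<open>K S = C Fs\<close> and \<open>S = F C Fs + \<Gamma>\<close>: subtracting the
  gain term leaves only \<open>K \<Gamma>\<close>. The next lemma is the adjoint identity; the two
  produce the cancellations in the comparison of posteriors.\<close>

lemma post_Fs: "post (Fs w) = K (\<Gamma> *v w)"
proof -
  have "K (S *v w) = C (Fs w)" by (simp add: K_def R_S)
  then show ?thesis by (simp add: post_def S_mult K.add algebra_simps)
qed

lemma F_post: "F (post h) = \<Gamma> *v (Ks h)"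
proof -
  have "F (C h) = F (C (Fs (Ks h))) + \<Gamma> *v Ks h" using S_R[of "F (C h)"] by (simp add: S_mult Ks_def)
  then show ?thesis unfolding post_def F.diff by (simp add: K_def Ks_def algebra_simps)
qed

text \<open>Expanding \<open>As\<close> gives
  \<open>A (C (As h)) = post h - post (Fs (Ks h))\<close>, and \<open>post_Fs\<close> evaluates the
  last term. The left side is the shape that the covariance of an updated ensemble takes: a signal
  part plus a noise part.\<close>

lemma joseph_form: "A (C (As h)) + K (\<Gamma> *v Ks h) = post h"
  using post_Fs[of "Ks h"] by (simp add: As_def C.diff A.diff post_eq_A[symmetric])

text \<open>Let \<open>z = Ks h\<close>, so \<open>S z = F C h\<close>. Positivity of
  \<open>C\<close> at \<open>h - Fs z\<close> gives \<open>Fs z \<bullet> C (Fs z) + 2 * (z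
  \<bullet> (\<Gamma> *v z)) \<le> h \<bullet> C h\<close>. The result is quadratic in
  \<open>Ks h\<close> but linear in \<open>C\<close>, whence the square root in the gain
  bound.\<close>

lemma Ks_bound: "\<gamma> * (norm (Ks h))\<^sup>2 \<le> h \<bullet> C h"
proof -
  let ?z = "Ks h"
  have "?z \<bullet> F (C h) = Fs ?z \<bullet> C (Fs ?z) + ?z \<bullet> (\<Gamma> *v ?z)"
    using S_R[of "F (C h)"] by (metis Ks_def S_mult inner_add_right F_adj')
  moreover have "?z \<bullet> F (C h) = Fs ?z \<bullet> C h" "h \<bullet> C (Fs ?z) = Fs ?z \<bullet> C h"
    by (simp add: F_adj') (metis C_sym inner_commute)
  moreover have "0 \<le> (h - Fs ?z) \<bullet> C (h - Fs ?z)" by (rule C_nonneg)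
  moreover have "0 \<le> Fs ?z \<bullet> C (Fs ?z)" by (rule C_nonneg)
  moreover have "0 \<le> \<gamma> * (norm ?z)\<^sup>2" using \<gamma>_pos by simp
  ultimately show ?thesis using \<gamma>_bound[of ?z]
    by (simp add: C.diff inner_diff_left inner_diff_right)
qed

section \<open>Operator bounds in terms of the norms of the covariance and the observation
  map\<close>

context
  fixes c f :: real
  assumes c: "\<And>h. norm (C h) \<le> c * norm h" and c0: "0 \<le> c"
    and f: "\<And>x. norm (F x) \<le> f * norm x" and f0: "0 \<le> f"
begin

lemma Ks_norm: "norm (Ks h) \<le> sqrt (c / \<gamma>) * norm h"
proof (rule power2_le_imp_le)
  have "\<gamma> * (norm (Ks h))\<^sup>2 \<le> norm h * norm (C h)"
    using Ks_bound norm_cauchy_schwarz order_trans by blast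
  also have "\<dots> \<le> norm h * (c * norm h)" by (intro mult_left_mono c) auto
  finally show "(norm (Ks h))\<^sup>2 \<le> (sqrt (c / \<gamma>) * norm h)\<^sup>2"
    using \<gamma>_pos c0 by (simp add: power_mult_distrib field_simps power2_eq_square)
qed (use c0 \<gamma>_pos in simp)

lemma K_norm: "norm (K w) \<le> sqrt (c / \<gamma>) * norm w"
  using c0 \<gamma>_pos K_adj
  by (intro norm_adjoint_le[of Ks K, OF _ Ks_norm]) (auto simp: inner_commute)

lemma A_norm: "norm (A h) \<le> (1 + sqrt (c / \<gamma>) * f) * norm h"
proof -
  have "norm (A h) \<le> norm h + norm (K (F h))" unfolding A_def by (rule norm_triangle_ineq4)
  also have "norm (K (F h)) \<le> sqrt (c / \<gamma>) * (f * norm h)"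
    using c0 \<gamma>_pos by (intro order_trans[OF K_norm] mult_left_mono f) auto
  finally show ?thesis by (simp add: algebra_simps)
qed

lemma As_norm: "norm (As h) \<le> (1 + sqrt (c / \<gamma>) * f) * norm h"
proof -
  have "norm (As h) \<le> norm h + norm (Fs (Ks h))" unfolding As_def by (rule norm_triangle_ineq4)
  also have "norm (Fs (Ks h)) \<le> f * (sqrt (c / \<gamma>) * norm h)"
    by (intro order_trans[OF norm_adjoint_le[OF F_adj f f0]] mult_left_mono Ks_norm f0)
  finally show ?thesis by (simp add: algebra_simps)
qed

lemma post_norm: "norm (post h) \<le> (1 + sqrt (c / \<gamma>) * f) * (c * norm h)"
  unfolding post_eq_A using c0 f0 \<gamma>_pos
  by (intro order_trans[OF A_norm] mult_left_mono c) auto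

end

end

text \<open>An exact difference formula, linear in \<open>C - C'\<close> and \<open>F - F'\<close>; comparing the Riccati maps
  through it avoids differentiating the matrix inverse.\<close>

lemma posterior_difference:
  assumes k: "kalman \<Gamma> \<gamma> C F Fs" and k': "kalman \<Gamma> \<gamma> C' F' Fs'"
  shows "kalman.post \<Gamma> C F Fs h - kalman.post \<Gamma> C' F' Fs' h =
    kalman.A \<Gamma> C F Fs (C (kalman.As \<Gamma> C' F' Fs' h) - C' (kalman.As \<Gamma> C' F' Fs' h))
    + kalman.post \<Gamma> C F Fs (Fs' (kalman.Ks \<Gamma> C' F' Fs' h) - Fs (kalman.Ks \<Gamma> C' F' Fs' h))
    - kalman.K \<Gamma> C F Fs (F (kalman.post \<Gamma> C' F' Fs' h) - F' (kalman.post \<Gamma> C' F' Fs' h))"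
proof -
  interpret k: kalman \<Gamma> \<gamma> C F Fs by fact
  interpret k': kalman \<Gamma> \<gamma> C' F' Fs' by fact
  show ?thesis
    by (simp add: k.A.diff k.post.diff k.K.diff k.post_eq_A[symmetric] k'.post_eq_As[symmetric]
        k.post_Fs k'.F_post k.A_def[of "k'.post h"])
       (simp add: k'.As_def k.post.diff)
qed

lemma posterior_cov_eq_post:
  assumes "kalman \<Gamma> \<gamma> C F (adjoint F)"
  shows "posterior_cov C F \<Gamma> h = kalman.post \<Gamma> C F (adjoint F) h"
proof -
  interpret kalman \<Gamma> \<gamma> C F "adjoint F" by fact
  show ?thesis by (simp add: posterior_cov_def post_def K_def R_def S_def)
qed

section \<open>Sample covariances\<close>

definition sample_mean :: "nat \<Rightarrow> (nat \<Rightarrow> 'a::real_vector) \<Rightarrow> 'a" where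
  "sample_mean J a = (\<Sum>j<J. a j) /\<^sub>R real J"

text \<open>The samples may live in different spaces, so that one operator covers the ensemble
  covariance, the noise covariance and both cross-covariances; exchanging the samples gives the
  adjoint. Its matrix entries are values of \<open>scalar_cov\<close>.\<close>

definition sample_cov :: "nat \<Rightarrow> (nat \<Rightarrow> 'a::real_vector) \<Rightarrow> (nat \<Rightarrow> 'b::real_inner) \<Rightarrow> 'b \<Rightarrow> 'a" where
  "sample_cov J a b w =
     (\<Sum>j<J. ((b j - sample_mean J b) \<bullet> w) *\<^sub>R (a j - sample_mean J a)) /\<^sub>R (real J - 1)"

definition scalar_cov :: "nat \<Rightarrow> (nat \<Rightarrow> real) \<Rightarrow> (nat \<Rightarrow> real) \<Rightarrow> real" where
  "scalar_cov J x y = (\<Sum>j<J. (x j - sample_mean J x) * (y j - sample_mean J y)) / (real J - 1)"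

lemma linear_sample_mean:
  assumes "linear f"
  shows "f (sample_mean J a) = sample_mean J (\<lambda>j. f (a j))"
  by (simp add: sample_mean_def linear_scale[OF assms] linear_sum[OF assms])

lemma sample_mean_add: "sample_mean J (\<lambda>j. a j + b j) = sample_mean J a + sample_mean J b"
  by (simp add: sample_mean_def sum.distrib scaleR_add_right)

lemma sample_mean_const: "0 < J \<Longrightarrow> sample_mean J (\<lambda>j. a) = a"
  by (simp add: sample_mean_def sum_constant_scaleR)

lemma inner_sample_mean: "e \<bullet> sample_mean J a = sample_mean J (\<lambda>j. e \<bullet> a j)"
  by (rule linear_sample_mean) (simp add: bounded_linear.linear bounded_linear_inner_right)

lemma inner_sample_cov: "e \<bullet> sample_cov J a b w = scalar_cov J (\<lambda>j. e \<bullet> a j) (\<lambda>j. w \<bullet> b j)"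
  unfolding sample_cov_def scalar_cov_def
  by (simp add: inner_sum_right inner_diff_left inner_diff_right inner_sample_mean[symmetric]
     inner_commute[of _ w] divide_inverse ac_simps sum_distrib_left)

lemma scalar_cov_commute: "scalar_cov J x y = scalar_cov J y x"
  by (simp add: scalar_cov_def mult.commute)

lemma sample_cov_adjoint: "sample_cov J a b w \<bullet> v = w \<bullet> sample_cov J b a v"
  using inner_sample_cov[of v J a b w] inner_sample_cov[of w J b a v]
  by (simp add: inner_commute scalar_cov_commute)

lemma bounded_linear_sample_cov:
  fixes a :: "nat \<Rightarrow> 'a::real_normed_vector"
  shows "bounded_linear (sample_cov J a b)"
  unfolding sample_cov_def[abs_def]
  by (intro bounded_linear_const_scaleR bounded_linear_sum
      bounded_linear_compose[OF bounded_linear_scaleR_left] bounded_linear_inner_right)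

lemma self_adjoint_sample_cov: "self_adjoint (sample_cov J a a)"
  by (simp add: self_adjoint_def sample_cov_adjoint)

lemma positive_sample_cov:
  assumes "1 \<le> J" shows "positive_op (sample_cov J a a)"
  unfolding positive_op_def inner_sample_cov scalar_cov_def
  using assms by (auto intro!: divide_nonneg_nonneg sum_nonneg)

text \<open>Covariance is bilinear in the deviations from the mean; the mixed products give the two
  cross terms.\<close>

lemma sample_cov_linear_combination:
  assumes v: "\<And>j. j < J \<Longrightarrow> v j - sample_mean J v = A (a j - sample_mean J a) + K (b j - sample_mean J b)"
    and A: "linear A" "\<And>x h. A x \<bullet> h = x \<bullet> As h"
    and K: "linear K" "\<And>x h. K x \<bullet> h = x \<bullet> Ks h"
  shows "sample_cov J v v h = A (sample_cov J a a (As h)) + K (sample_cov J b b (Ks h))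
    + (A (sample_cov J a b (Ks h)) + K (sample_cov J b a (As h)))"
proof -
  let ?a = "\<lambda>j. a j - sample_mean J a" and ?b = "\<lambda>j. b j - sample_mean J b"
  let ?r = "inverse (real J - 1)"
  have "sample_cov J v v h =
      ?r *\<^sub>R (\<Sum>j<J. (?a j \<bullet> As h + ?b j \<bullet> Ks h) *\<^sub>R (A (?a j) + K (?b j)))"
    unfolding sample_cov_def by (auto simp: v inner_add_left A(2) K(2) intro!: sum.cong)
  also have "\<dots> = ?r *\<^sub>R ((\<Sum>j<J. (?a j \<bullet> As h) *\<^sub>R A (?a j)) + (\<Sum>j<J. (?b j \<bullet> Ks h) *\<^sub>R K (?b j))
     + ((\<Sum>j<J. (?b j \<bullet> Ks h) *\<^sub>R A (?a j)) + (\<Sum>j<J. (?a j \<bullet> As h) *\<^sub>R K (?b j))))"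
    unfolding sum.distrib[symmetric]
    by (intro arg_cong[where f="scaleR ?r"] sum.cong) (auto simp: scaleR_add_left scaleR_add_right)
  also have "\<dots> = A (sample_cov J a a (As h)) + K (sample_cov J b b (Ks h))
    + (A (sample_cov J a b (Ks h)) + K (sample_cov J b a (As h)))"
    unfolding sample_cov_def linear_scale[OF A(1)] linear_scale[OF K(1)] linear_sum[OF A(1)]
      linear_sum[OF K(1)] by (simp add: scaleR_add_right)
  finally show ?thesis .
qed

text \<open>The double sum is the squared Hilbert-Schmidt norm. By \<open>rep\<close>, each row
  functional of \<open>T\<close> is represented inside \<open>span G\<close>, so finitely many
  entries control \<open>T\<close> on the whole space; Cauchy-Schwarz is applied row by row.\<close>

lemma hilbert_schmidt_bound:
  fixes T :: "'b::real_inner \<Rightarrow> 'a::real_inner"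
  assumes E: "orthonormal_family E" and G: "orthonormal_family G"
    and range: "T w \<in> span E"
    and rep: "\<And>e. e \<in> E \<Longrightarrow> \<exists>t\<in>span G. \<forall>w. e \<bullet> T w = t \<bullet> w"
  shows "norm (T w) \<le> sqrt (\<Sum>e\<in>E. \<Sum>g\<in>G. (e \<bullet> T g)\<^sup>2) * norm w"
proof -
  interpret E: orthonormal_family E by fact
  interpret G: orthonormal_family G by fact
  have "(e \<bullet> T w)\<^sup>2 \<le> (\<Sum>g\<in>G. (e \<bullet> T g)\<^sup>2) * (norm w)\<^sup>2" if e: "e \<in> E" for e
  proof -
    obtain t where t: "t \<in> span G" "\<And>w. e \<bullet> T w = t \<bullet> w" using rep[OF e] by blast
    have "(e \<bullet> T w)\<^sup>2 \<le> (norm t)\<^sup>2 * (norm w)\<^sup>2"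
      unfolding t(2) using Cauchy_Schwarz_ineq[of t w] by (simp add: power2_norm_eq_inner)
    also have "(norm t)\<^sup>2 = (\<Sum>g\<in>G. (e \<bullet> T g)\<^sup>2)"
      unfolding G.norm_span[OF t(1)] t(2) by (simp add: inner_commute)
    finally show ?thesis .
  qed
  then have "(norm (T w))\<^sup>2 \<le> (\<Sum>e\<in>E. (\<Sum>g\<in>G. (e \<bullet> T g)\<^sup>2) * (norm w)\<^sup>2)"
    unfolding E.norm_span[OF range] by (rule sum_mono)
  also have "\<dots> = (sqrt (\<Sum>e\<in>E. \<Sum>g\<in>G. (e \<bullet> T g)\<^sup>2) * norm w)\<^sup>2"
    by (simp add: sum_distrib_right power_mult_distrib sum_nonneg)
  finally show ?thesis by (rule power2_le_imp_le) (simp add: sum_nonneg)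
qed

lemma orthonormal_family_Basis: "orthonormal_family (Basis :: 'a::euclidean_space set)"
  by standard (auto simp: pairwise_def orthogonal_def inner_Basis)

section \<open>The ensemble update seen in the Hilbert space\<close>

context discretization
begin

lemma synth_minus: "synth n \<phi> a - synth n \<phi> b = synth n \<phi> (\<lambda>i. a i - b i)"
  by (simp add: synth_def sum_subtractf scaleR_diff_left)

lemma synth_plus: "synth n \<phi> a + synth n \<phi> b = synth n \<phi> (\<lambda>i. a i + b i)"
  by (simp add: synth_def sum.distrib scaleR_add_left)

lemma synth_ens_mean: "synth n \<phi> (ens_mean J v) = sample_mean J (\<lambda>j. synth n \<phi> (v j))"
proof -
  have "(\<Sum>j<J. \<Sum>i<n. v j i *\<^sub>R \<phi> i) = (\<Sum>i<n. (\<Sum>j<J. v j i) *\<^sub>R \<phi> i)"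
    by (subst sum.swap) (simp add: scaleR_sum_left)
  then show ?thesis
    unfolding synth_def ens_mean_def sample_mean_def
    by (simp add: scaleR_sum_right divide_inverse_commute)
qed

text \<open>The Gram matrix at the right end of \<open>ens_cov\<close> turns the action on
  \<open>proj_coeffs n \<phi> h\<close> into inner products of the lifted deviations with the
  projection of \<open>h\<close>, and \<open>synth_inner_proj\<close> replaces that projection by
  \<open>h\<close>.\<close>

lemma lift_ens_cov:
  "lift_op n \<phi> (ens_cov n (gram \<phi>) J v) = sample_cov J (\<lambda>j. synth n \<phi> (v j)) (\<lambda>j. synth n \<phi> (v j))"
proof
  fix h
  let ?d = "\<lambda>j i. v j i - ens_mean J v i"
  let ?p = "proj_coeffs n \<phi> h"
  have d: "synth n \<phi> (?d j) = synth n \<phi> (v j) - sample_mean J (\<lambda>j. synth n \<phi> (v j))" for j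
    by (simp add: synth_minus[symmetric] synth_ens_mean)
  have "(\<Sum>k<n. ens_cov n (gram \<phi>) J v i k * ?p k)
      = (\<Sum>j<J. ?d j i * (synth n \<phi> (?d j) \<bullet> h)) / (real J - 1)" for i
  proof -
    have "(\<Sum>k<n. (\<Sum>j<J. \<Sum>l<n. ?d j i * ?d j l * gram \<phi> l k) * ?p k)
       = (\<Sum>k<n. (\<Sum>j<J. ?d j i * (\<Sum>l<n. ?d j l * gram \<phi> l k * ?p k)))"
      by (simp add: sum_distrib_left sum_distrib_right ac_simps)
    also have "\<dots> = (\<Sum>j<J. ?d j i * (\<Sum>k<n. \<Sum>l<n. ?d j l * gram \<phi> l k * ?p k))"
      by (subst sum.swap) (simp add: sum_distrib_left)
    also have "\<dots> = (\<Sum>j<J. ?d j i * inner_G n (gram \<phi>) (?d j) ?p)"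
      unfolding inner_G_def by (subst (2) sum.swap) (rule refl)
    finally show ?thesis
      unfolding ens_cov_def inner_gram synth_inner_proj
      by (simp add: sum_divide_distrib[symmetric] sum_distrib_right[symmetric] times_divide_eq_left)
  qed
  then have "lift_op n \<phi> (ens_cov n (gram \<phi>) J v) h
      = (\<Sum>i<n. ((\<Sum>j<J. ?d j i * (synth n \<phi> (?d j) \<bullet> h)) / (real J - 1)) *\<^sub>R \<phi> i)"
    by (simp add: lift_op_eq)
  also have "\<dots> = (\<Sum>j<J. (synth n \<phi> (?d j) \<bullet> h) *\<^sub>R synth n \<phi> (?d j)) /\<^sub>R (real J - 1)"
  proof -
    let ?t = "\<lambda>j. synth n \<phi> (?d j) \<bullet> h"
    have "(\<Sum>j<J. ?t j *\<^sub>R synth n \<phi> (?d j)) = (\<Sum>j<J. \<Sum>i<n. (?d j i * ?t j) *\<^sub>R \<phi> i)"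
      by (subst (2) synth_def) (simp add: scaleR_sum_right mult.commute)
    also have "\<dots> = (\<Sum>i<n. (\<Sum>j<J. ?d j i * ?t j) *\<^sub>R \<phi> i)"
      by (subst sum.swap) (simp add: scaleR_sum_left)
    finally show ?thesis by (simp add: scaleR_sum_right divide_inverse_commute)
  qed
  finally show "lift_op n \<phi> (ens_cov n (gram \<phi>) J v) h
      = sample_cov J (\<lambda>j. synth n \<phi> (v j)) (\<lambda>j. synth n \<phi> (v j)) h"
    by (simp add: d sample_cov_def)
qed

lemma synth_kalman_gain:
  assumes "kalman \<Gamma> \<gamma> (lift_op n \<phi> C) (lift_obs F) (lift_obs_adj F)"
  shows "synth n \<phi> (kalman_gain n (gram \<phi>) F \<Gamma> C w)
    = kalman.K \<Gamma> (lift_op n \<phi> C) (lift_obs F) (lift_obs_adj F) w"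
proof -
  interpret k: kalman \<Gamma> \<gamma> "lift_op n \<phi> C" "lift_obs F" "lift_obs_adj F" by fact
  have "obs n F (mat_vec n C (obs_adj n (gram \<phi>) F z)) = lift_obs F (lift_op n \<phi> C (lift_obs_adj F z))" for z
    by (simp add: lift_obs_adj_def lift_op_synth lift_obs_synth)
  then show ?thesis
    by (simp add: kalman_gain_def k.K_def k.R_def k.S_def lift_op_synth[symmetric] lift_obs_adj_def)
qed

lemma kalman_sample_cov:
  assumes noise: "noise_covariance \<Gamma> \<gamma>" and J: "1 \<le> J"
  shows "kalman \<Gamma> \<gamma> (sample_cov J U U) (lift_obs F) (lift_obs_adj F)"
  by (intro kalman.intro noise kalman_axioms.intro bounded_linear_sample_cov self_adjoint_sample_cov
      positive_sample_cov J bounded_linear_lift_obs lift_obs_adjoint)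

lemma lift_enkf_post_cov:
  fixes u :: "nat \<Rightarrow> nat \<Rightarrow> real" and F :: "nat \<Rightarrow> real^'d" and J :: nat and \<Gamma> :: "real^'d^'d"
  defines "U \<equiv> \<lambda>j. synth n \<phi> (u j)"
  defines "C \<equiv> sample_cov J U U"
  defines "Ks \<equiv> kalman.Ks \<Gamma> C (lift_obs F) (lift_obs_adj F)"
    and "As \<equiv> kalman.As \<Gamma> C (lift_obs F) (lift_obs_adj F)"
    and "K \<equiv> kalman.K \<Gamma> C (lift_obs F) (lift_obs_adj F)"
    and "A \<equiv> kalman.A \<Gamma> C (lift_obs F) (lift_obs_adj F)"
    and "post \<equiv> kalman.post \<Gamma> C (lift_obs F) (lift_obs_adj F)"
  assumes noise: "noise_covariance \<Gamma> \<gamma>" and J: "1 \<le> J"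
  shows "lift_op n \<phi> (enkf_post_cov n (gram \<phi>) F \<Gamma> y J u \<eta>) h =
      post h + K (sample_cov J \<eta> \<eta> (Ks h) - \<Gamma> *v Ks h)
      + (A (sample_cov J U \<eta> (Ks h)) + K (sample_cov J \<eta> U (As h)))"
proof -
  let ?F = "lift_obs F" and ?Fs = "lift_obs_adj F"
  have C: "C = lift_op n \<phi> (ens_cov n (gram \<phi>) J u)"
    unfolding C_def U_def lift_ens_cov ..
  interpret k: kalman \<Gamma> \<gamma> C ?F ?Fs
    unfolding C_def using noise J by (rule kalman_sample_cov)
  note fold = Ks_def[symmetric] As_def[symmetric] K_def[symmetric] A_def[symmetric] post_def[symmetric]
  let ?v = "\<lambda>j. synth n \<phi> (enkf_update n (gram \<phi>) F \<Gamma> y J u \<eta> j)"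
  have v: "?v j = U j + K (y - ?F (U j) + \<eta> j)" for j
  proof -
    have "?v j = synth n \<phi> (\<lambda>i. u j i + kalman_gain n (gram \<phi>) F \<Gamma> (ens_cov n (gram \<phi>) J u)
        (y - obs n F (u j) + \<eta> j) i)"
      unfolding enkf_update_def by (rule synth_cong) simp
    also have "\<dots> = U j + K (y - ?F (U j) + \<eta> j)"
      unfolding synth_plus[symmetric] K_def using k.kalman_axioms unfolding C
      by (subst synth_kalman_gain) (auto simp: U_def lift_obs_synth)
    finally show ?thesis .
  qed
  \<comment> \<open>The data enter only through \<open>K y\<close>, which is the same for all
    members and cancels in the deviations from the mean. Hence the final bound does not involve
    \<open>y\<close>.\<close>
  have v': "?v j = K y + (A (U j) + K (\<eta> j))" for j
    unfolding v K_def A_def by (simp add: k.A_def k.K.add k.K.diff)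
  have "?v j - sample_mean J ?v = A (U j - sample_mean J U) + K (\<eta> j - sample_mean J \<eta>)" for j
  proof -
    have "sample_mean J ?v = K y + (A (sample_mean J U) + K (sample_mean J \<eta>))"
      unfolding v' sample_mean_add K_def A_def
      using J linear_sample_mean[OF bounded_linear.linear[OF k.A_lin], of J U]
        linear_sample_mean[OF bounded_linear.linear[OF k.K_lin], of J \<eta>]
      by (simp add: sample_mean_const)
    then show ?thesis unfolding v' K_def A_def by (simp add: k.K.diff k.A.diff)
  qed
  then have "sample_cov J ?v ?v h = A (sample_cov J U U (As h)) + K (sample_cov J \<eta> \<eta> (Ks h))
      + (A (sample_cov J U \<eta> (Ks h)) + K (sample_cov J \<eta> U (As h)))"
    unfolding K_def A_def Ks_def As_def
    by (intro sample_cov_linear_combination)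
      (auto simp: k.A_adj k.K_adj intro: bounded_linear.linear k.A_lin k.K_lin)
  \<comment> \<open>The signal part falls short of the posterior by exactly
    \<open>K \<Gamma> Ks\<close>, which turns the sampled noise covariance into its error relative
    to \<open>\<Gamma>\<close>.\<close>
  moreover have "A (sample_cov J U U (As h)) = post h - K (\<Gamma> *v Ks h)"
    using k.joseph_form[of h] unfolding C_def[symmetric] fold by (simp add: algebra_simps)
  moreover have "K (sample_cov J \<eta> \<eta> (Ks h) - \<Gamma> *v Ks h) = K (sample_cov J \<eta> \<eta> (Ks h)) - K (\<Gamma> *v Ks h)"
    unfolding K_def by (rule k.K.diff)
  ultimately show ?thesis unfolding enkf_post_cov_def lift_ens_cov by simp
qed

end

text \<open>Supplies the hypotheses of \<open>hilbert_schmidt_bound\<close>: a row of a sample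
  covariance is a value of the one with the samples exchanged, hence lies in
  \<open>span G\<close>.\<close>

lemma sample_cov_hilbert_schmidt:
  assumes E: "orthonormal_family E" and G: "orthonormal_family G"
    and a: "\<And>j. j < J \<Longrightarrow> a j \<in> span E" and b: "\<And>j. j < J \<Longrightarrow> b j \<in> span G"
  shows "sample_cov J a b w \<in> span E" "\<exists>t\<in>span G. \<forall>w. e \<bullet> sample_cov J a b w = t \<bullet> w"
proof -
  have mean: "sample_mean J c \<in> span X" if "\<And>j. j < J \<Longrightarrow> c j \<in> span X" for c :: "nat \<Rightarrow> 'c::real_inner" and X
    unfolding sample_mean_def by (intro span_scale span_sum that) auto
  have in_span: "sample_cov J c d h \<in> span X" if "\<And>j. j < J \<Longrightarrow> c j \<in> span X"
    for c :: "nat \<Rightarrow> 'c::real_inner" and d :: "nat \<Rightarrow> 'e::real_inner" and X h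
    unfolding sample_cov_def by (intro span_scale span_sum span_diff that mean) auto
  show "sample_cov J a b w \<in> span E" using a by (rule in_span)
  show "\<exists>t\<in>span G. \<forall>w. e \<bullet> sample_cov J a b w = t \<bullet> w"
    using in_span[of b G a e, OF b] 
    by (intro bexI[of _ "sample_cov J b a e"]) (auto, metis sample_cov_adjoint inner_commute)
qed

section \<open>Moments of sample covariances\<close>

text \<open>Splits the error into centred products, the correction for estimated means, and a
  leftover \<open>\<kappa>\<close>: the sum removes \<open>J\<close> copies of it while the
  denominator accounts for \<open>J - 1\<close>.\<close>

lemma scalar_cov_eq:
  assumes "2 \<le> J"
  shows "scalar_cov J x y - \<kappa> =
    ((\<Sum>j<J. (x j * y j - \<kappa>)) - (\<Sum>j<J. x j) * (\<Sum>j<J. y j) / real J + \<kappa>) / (real J - 1)"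
proof -
  have J: "real J \<noteq> 0" "real J - 1 \<noteq> 0" using assms by auto
  let ?x = "sample_mean J x" and ?y = "sample_mean J y"
  have sx: "(\<Sum>j<J. x j) = real J * ?x" "(\<Sum>j<J. y j) = real J * ?y"
    using J by (simp_all add: sample_mean_def)
  have "(\<Sum>j<J. (x j - ?x) * (y j - ?y)) = (\<Sum>j<J. x j * y j) - ?x * (\<Sum>j<J. y j) - ?y * (\<Sum>j<J. x j) + real J * (?x * ?y)"
    by (simp add: algebra_simps sum_subtractf sum.distrib sum_distrib_left)
  also have "\<dots> = (\<Sum>j<J. x j * y j) - real J * (?x * ?y)" unfolding sx by (simp add: algebra_simps)
  finally show ?thesis unfolding scalar_cov_def sx using J
    by (simp add: sum_subtractf field_simps)
qed

text \<open>The point mass \<open>v = 0\<close> is treated apart throughout, as the density formulas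
  require a positive deviation.\<close>

lemma normal_law_moments:
  assumes v: "0 \<le> v"
  shows "prob_space (normal_law 0 v)" "sets (normal_law 0 v) = sets borel"
    "integrable (normal_law 0 v) (\<lambda>x. x ^ 4)"
    "(\<integral>x. x \<partial>normal_law 0 v) = 0" "(\<integral>x. x\<^sup>2 \<partial>normal_law 0 v) = v"
    "(\<integral>x. x ^ 4 \<partial>normal_law 0 v) = 3 * v\<^sup>2"
proof -
  show "prob_space (normal_law 0 v)"
    using v prob_space_normal_density[of "sqrt v" 0] by (simp add: normal_law_def prob_space_return)
  show "sets (normal_law 0 v) = sets borel" by (simp add: normal_law_def)
  show "integrable (normal_law 0 v) (\<lambda>x. x ^ 4)"
  proof (cases "v = 0")
    case True
    interpret prob_space "return borel (0::real)" by (simp add: prob_space_return)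
    have "integrable (return borel (0::real)) (\<lambda>x. x ^ 4)"
      by (rule integrable_const_bound[of _ 0]) (auto simp: AE_return)
    then show ?thesis using True by (simp add: normal_law_def)
  next
    case False
    then show ?thesis using v integrable_normal_moment[of "sqrt v" 0 4]
      by (simp add: normal_law_def integrable_density normal_density_nonneg)
  qed
  show "(\<integral>x. x \<partial>normal_law 0 v) = 0"
  proof (cases "v = 0")
    case True then show ?thesis by (simp add: normal_law_def integral_return)
  next
    case False
    then show ?thesis using v integral_normal_moment_odd[of "sqrt v" 0 0]
      by (simp add: normal_law_def integral_density normal_density_nonneg)
  qed
  show "(\<integral>x. x\<^sup>2 \<partial>normal_law 0 v) = v"
  proof (cases "v = 0")
    case True then show ?thesis by (simp add: normal_law_def integral_return)
  next
    case False
    then show ?thesis using v integral_normal_moment_even[of "sqrt v" 0 1]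
      by (simp add: normal_law_def integral_density normal_density_nonneg)
  qed
  show "(\<integral>x. x ^ 4 \<partial>normal_law 0 v) = 3 * v\<^sup>2"
  proof (cases "v = 0")
    case True then show ?thesis by (simp add: normal_law_def integral_return)
  next
    case False
    then show ?thesis using v integral_normal_moment_even[of "sqrt v" 0 2]
      by (simp add: normal_law_def integral_density normal_density_nonneg fact_numeral power2_eq_square field_simps)
  qed
qed

section \<open>Moment calculus and the mean square error of one covariance entry\<close>

context prob_space
begin

text \<open>Up to the second moment these are the moments of a centred normal variable of variance \<open>v\<close>;
  the bound on the fourth one is an equality in the normal case.\<close>

definition normal_moments :: "('a \<Rightarrow> real) \<Rightarrow> real \<Rightarrow> bool" where
  "normal_moments X v \<longleftrightarrow> random_variable borel X \<and> integrable M (\<lambda>\<omega>. X \<omega> ^ 4) \<and>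
     expectation X = 0 \<and> expectation (\<lambda>\<omega>. (X \<omega>)\<^sup>2) = v \<and> expectation (\<lambda>\<omega>. X \<omega> ^ 4) \<le> 3 * v\<^sup>2"

lemma normal_momentsD:
  assumes "normal_moments X v"
  shows "random_variable borel X" "integrable M (\<lambda>\<omega>. X \<omega> ^ 4)"
    "expectation (\<lambda>\<omega>. X \<omega> ^ 4) \<le> 3 * v\<^sup>2" "expectation X = 0" "expectation (\<lambda>\<omega>. (X \<omega>)\<^sup>2) = v"
  using assms unfolding normal_moments_def by blast+

lemma integrable_lower_powers:
  assumes [measurable]: "random_variable borel X" and 4: "integrable M (\<lambda>\<omega>. X \<omega> ^ 4 :: real)"
    and k: "k \<le> 4"
  shows "integrable M (\<lambda>\<omega>. X \<omega> ^ k)"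
proof (rule Bochner_Integration.integrable_bound[of _ "\<lambda>\<omega>. 1 + X \<omega> ^ 4"])
  have "\<bar>x ^ k\<bar> \<le> 1 + x ^ 4" for x :: real
  proof (cases "\<bar>x\<bar> \<le> 1")
    case True
    then have "\<bar>x\<bar> ^ k \<le> 1" by (simp add: power_le_one)
    moreover have "0 \<le> x ^ 4" by simp
    ultimately show ?thesis unfolding power_abs by linarith
  next
    case False
    then have "\<bar>x\<bar> ^ k \<le> \<bar>x\<bar> ^ 4" by (intro power_increasing k) simp
    then show ?thesis unfolding power_abs by simp
  qed
  then show "AE \<omega> in M. norm (X \<omega> ^ k) \<le> norm (1 + X \<omega> ^ 4)"
    by (auto simp: intro!: AE_I2 order_trans[OF _ abs_ge_self])
qed (use 4 in auto)

lemma normal_moments_distr: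
  assumes X: "random_variable borel X" and d: "distr M borel X = normal_law 0 v" and v: "0 \<le> v"
  shows "normal_moments X v"
proof -
  note m = normal_law_moments[OF v, folded d]
  note [measurable] = X
  show ?thesis unfolding normal_moments_def
    using m(3-) X by (simp add: integrable_distr_eq integral_distr)
qed

text \<open>Mixed terms containing a first power drop out by independence and zero mean. What
  remains is \<open>6 * (v * w)\<close>, the cross term of \<open>3 * (v + w)\<^sup>2\<close>, so
  the fourth moment bound survives sums and the law of a sum never has to be identified.\<close>

lemma normal_moments_add:
  assumes X: "normal_moments X v" and Y: "normal_moments Y w" and ind: "indep_var borel X borel Y"
  shows "normal_moments (\<lambda>\<omega>. X \<omega> + Y \<omega>) (v + w)"
proof -
  have [measurable]: "random_variable borel X" "random_variable borel Y"
    using X Y by (auto simp: normal_moments_def)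
  have iX: "integrable M (\<lambda>\<omega>. X \<omega> ^ k)" and iY: "integrable M (\<lambda>\<omega>. Y \<omega> ^ k)" if "k \<le> 4" for k
    using X Y that by (auto simp: normal_moments_def intro: integrable_lower_powers)
  have ind': "indep_var borel (\<lambda>\<omega>. X \<omega> ^ k) borel (\<lambda>\<omega>. Y \<omega> ^ l)" for k l
    using indep_var_compose[OF ind, of "\<lambda>x. x ^ k" borel "\<lambda>x. x ^ l" borel] by (simp add: comp_def)
  have iXY: "integrable M (\<lambda>\<omega>. X \<omega> ^ k * Y \<omega> ^ l)"
    and eXY: "expectation (\<lambda>\<omega>. X \<omega> ^ k * Y \<omega> ^ l) = expectation (\<lambda>\<omega>. X \<omega> ^ k) * expectation (\<lambda>\<omega>. Y \<omega> ^ l)"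
    if "k \<le> 4" "l \<le> 4" for k l
    using that by (auto intro!: indep_var_integrable indep_var_lebesgue_integral iX iY ind')
  have e1: "expectation (\<lambda>\<omega>. X \<omega> ^ 1) = 0" "expectation (\<lambda>\<omega>. Y \<omega> ^ 1) = 0"
    and e2: "expectation (\<lambda>\<omega>. X \<omega> ^ 2) = v" "expectation (\<lambda>\<omega>. Y \<omega> ^ 2) = w"
    and e4: "expectation (\<lambda>\<omega>. X \<omega> ^ 4) \<le> 3 * v\<^sup>2" "expectation (\<lambda>\<omega>. Y \<omega> ^ 4) \<le> 3 * w\<^sup>2"
    using X Y by (auto simp: normal_moments_def)
  have sq: "(\<lambda>\<omega>. (X \<omega> + Y \<omega>)\<^sup>2) = (\<lambda>\<omega>. X \<omega> ^ 2 + Y \<omega> ^ 2 + 2 * (X \<omega> ^ 1 * Y \<omega> ^ 1))"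
    by (auto simp: power2_sum)
  have fourth: "(\<lambda>\<omega>. (X \<omega> + Y \<omega>) ^ 4) = (\<lambda>\<omega>. X \<omega> ^ 4 + Y \<omega> ^ 4 + 4 * (X \<omega> ^ 3 * Y \<omega> ^ 1)
      + 6 * (X \<omega> ^ 2 * Y \<omega> ^ 2) + 4 * (X \<omega> ^ 1 * Y \<omega> ^ 3))"
    by (auto simp: fun_eq_iff power4_eq_xxxx power3_eq_cube power2_eq_square algebra_simps)
  have "expectation (\<lambda>\<omega>. X \<omega> + Y \<omega>) = 0"
    using e1 iX[of 1] iY[of 1] by simp
  moreover have "expectation (\<lambda>\<omega>. (X \<omega> + Y \<omega>)\<^sup>2) = v + w"
    unfolding sq using iX[of 2] iY[of 2] iXY[of 1 1] eXY[of 1 1] e1 e2 by simp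
  moreover have "expectation (\<lambda>\<omega>. (X \<omega> + Y \<omega>) ^ 4) \<le> 3 * (v + w)\<^sup>2"
  proof -
    have "expectation (\<lambda>\<omega>. (X \<omega> + Y \<omega>) ^ 4)
        = expectation (\<lambda>\<omega>. X \<omega> ^ 4) + expectation (\<lambda>\<omega>. Y \<omega> ^ 4) + 6 * (v * w)"
      unfolding fourth using iX[of 4] iY[of 4] iXY[of 3 1] iXY[of 2 2] iXY[of 1 3]
        eXY[of 3 1] eXY[of 2 2] eXY[of 1 3] e1 e2 by simp
    then show ?thesis using e4 by (simp add: power2_sum)
  qed
  moreover have "integrable M (\<lambda>\<omega>. (X \<omega> + Y \<omega>) ^ 4)"
    unfolding fourth using iX[of 4] iY[of 4] iXY[of 3 1] iXY[of 2 2] iXY[of 1 3] by simp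
  ultimately show ?thesis unfolding normal_moments_def by simp
qed

lemma normal_moments_sum:
  fixes X :: "'i \<Rightarrow> 'a \<Rightarrow> real"
  assumes "finite I" and "indep_vars (\<lambda>_. borel) X I" and "\<And>i. i \<in> I \<Longrightarrow> normal_moments (X i) (v i)"
  shows "normal_moments (\<lambda>\<omega>. \<Sum>i\<in>I. X i \<omega>) (\<Sum>i\<in>I. v i)"
  using assms
proof (induction I rule: finite_induct)
  case empty
  then show ?case by (simp add: normal_moments_def)
next
  case (insert i I)
  have "normal_moments (\<lambda>\<omega>. \<Sum>i\<in>I. X i \<omega>) (\<Sum>i\<in>I. v i)"
    using insert.prems by (intro insert.IH) (auto intro: indep_vars_subset)
  moreover have "indep_var borel (X i) borel (\<lambda>\<omega>. \<Sum>i\<in>I. X i \<omega>)"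
    using insert by (intro indep_vars_sum) auto
  ultimately have "normal_moments (\<lambda>\<omega>. X i \<omega> + (\<Sum>i\<in>I. X i \<omega>)) (v i + (\<Sum>i\<in>I. v i))"
    using insert.prems by (intro normal_moments_add) auto
  then show ?case using insert.hyps by simp
qed

lemma normal_moments_mult:
  assumes "normal_moments X v"
  shows "normal_moments (\<lambda>\<omega>. c * X \<omega>) (c\<^sup>2 * v)"
proof -
  have "c ^ 4 * expectation (\<lambda>\<omega>. X \<omega> ^ 4) \<le> c ^ 4 * (3 * v\<^sup>2)"
    using assms by (intro mult_left_mono) (auto simp: normal_moments_def)
  then show ?thesis using assms
    by (auto simp: normal_moments_def power_mult_distrib power_mult[symmetric] algebra_simps)
qed

lemma uncorrelated_sum_second_moment:
  fixes Z :: "'i \<Rightarrow> 'a \<Rightarrow> real"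
  assumes fin: "finite I"
    and int: "\<And>i j. i \<in> I \<Longrightarrow> j \<in> I \<Longrightarrow> integrable M (\<lambda>\<omega>. Z i \<omega> * Z j \<omega>)"
    and unc: "\<And>i j. i \<in> I \<Longrightarrow> j \<in> I \<Longrightarrow> i \<noteq> j \<Longrightarrow> expectation (\<lambda>\<omega>. Z i \<omega> * Z j \<omega>) = 0"
    and sec: "\<And>i. i \<in> I \<Longrightarrow> expectation (\<lambda>\<omega>. (Z i \<omega>)\<^sup>2) \<le> V"
  shows "integrable M (\<lambda>\<omega>. (\<Sum>i\<in>I. Z i \<omega>)\<^sup>2)"
    "expectation (\<lambda>\<omega>. (\<Sum>i\<in>I. Z i \<omega>)\<^sup>2) \<le> real (card I) * V"
proof -
  have eq: "(\<lambda>\<omega>. (\<Sum>i\<in>I. Z i \<omega>)\<^sup>2) = (\<lambda>\<omega>. \<Sum>i\<in>I. \<Sum>j\<in>I. Z i \<omega> * Z j \<omega>)"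
    by (simp add: power2_eq_square sum_product)
  show "integrable M (\<lambda>\<omega>. (\<Sum>i\<in>I. Z i \<omega>)\<^sup>2)" unfolding eq using int by auto
  have "expectation (\<lambda>\<omega>. (\<Sum>i\<in>I. Z i \<omega>)\<^sup>2) = (\<Sum>i\<in>I. \<Sum>j\<in>I. expectation (\<lambda>\<omega>. Z i \<omega> * Z j \<omega>))"
    unfolding eq using int by (simp add: integral_sum)
  also have "\<dots> = (\<Sum>i\<in>I. \<Sum>j\<in>I. if i = j then expectation (\<lambda>\<omega>. (Z i \<omega>)\<^sup>2) else 0)"
    using unc by (intro sum.cong) (auto simp: power2_eq_square)
  also have "\<dots> = (\<Sum>i\<in>I. expectation (\<lambda>\<omega>. (Z i \<omega>)\<^sup>2))" using fin by simp
  also have "\<dots> \<le> real (card I) * V" using sum_bounded_above[of I _ V] sec by simp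
  finally show "expectation (\<lambda>\<omega>. (\<Sum>i\<in>I. Z i \<omega>)\<^sup>2) \<le> real (card I) * V" .
qed

text \<open>Weighted AM-GM with weights chosen so that the bound is homogeneous in the two variances.\<close>

lemma product_second_moment:
  fixes X Y :: "'a \<Rightarrow> real"
  assumes X: "random_variable borel X" "integrable M (\<lambda>\<omega>. X \<omega> ^ 4)" "expectation (\<lambda>\<omega>. X \<omega> ^ 4) \<le> 3 * \<alpha>\<^sup>2"
    and Y: "random_variable borel Y" "integrable M (\<lambda>\<omega>. Y \<omega> ^ 4)" "expectation (\<lambda>\<omega>. Y \<omega> ^ 4) \<le> 3 * \<beta>\<^sup>2"
    and pos: "0 < \<alpha>" "0 < \<beta>"
  shows "integrable M (\<lambda>\<omega>. (X \<omega> * Y \<omega>)\<^sup>2)" "expectation (\<lambda>\<omega>. (X \<omega> * Y \<omega>)\<^sup>2) \<le> 3 * \<alpha> * \<beta>"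
proof -
  have [measurable]: "random_variable borel X" "random_variable borel Y" by fact+
  let ?g = "\<lambda>\<omega>. (\<beta> / \<alpha> * X \<omega> ^ 4 + \<alpha> / \<beta> * Y \<omega> ^ 4) / 2"
  have le: "(x * y)\<^sup>2 \<le> (\<beta> / \<alpha> * x ^ 4 + \<alpha> / \<beta> * y ^ 4) / 2" for x y :: real
  proof -
    have "0 \<le> (\<beta> * x\<^sup>2 - \<alpha> * y\<^sup>2)\<^sup>2 / (\<alpha> * \<beta>)" using pos by simp
    also have "\<dots> = \<beta> / \<alpha> * x ^ 4 + \<alpha> / \<beta> * y ^ 4 - 2 * (x * y)\<^sup>2"
      using pos by (simp add: field_simps power2_diff) (simp add: power2_eq_square power4_eq_xxxx algebra_simps)
    finally show ?thesis by simp
  qed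
  have ig: "integrable M ?g" using X Y by auto
  show i: "integrable M (\<lambda>\<omega>. (X \<omega> * Y \<omega>)\<^sup>2)"
    by (rule Bochner_Integration.integrable_bound[OF ig])
       (auto intro!: AE_I2 order_trans[OF le abs_ge_self] simp del: times_divide_eq_left divide_eq_eq_numeral1 divide_le_eq_numeral1 le_divide_eq_numeral1 abs_divide)
  have "expectation (\<lambda>\<omega>. (X \<omega> * Y \<omega>)\<^sup>2) \<le> expectation ?g"
    using i ig le by (rule integral_mono)
  also have "\<dots> = (\<beta> / \<alpha> * expectation (\<lambda>\<omega>. X \<omega> ^ 4) + \<alpha> / \<beta> * expectation (\<lambda>\<omega>. Y \<omega> ^ 4)) / 2"
    using X Y by simp
  also have "\<dots> \<le> (\<beta> / \<alpha> * (3 * \<alpha>\<^sup>2) + \<alpha> / \<beta> * (3 * \<beta>\<^sup>2)) / 2"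
    using X Y pos by (intro divide_right_mono add_mono mult_left_mono) auto
  also have "\<dots> = 3 * \<alpha> * \<beta>" using pos by (simp add: field_simps power2_eq_square)
  finally show "expectation (\<lambda>\<omega>. (X \<omega> * Y \<omega>)\<^sup>2) \<le> 3 * \<alpha> * \<beta>" .
qed

text \<open>Hypothesis \<open>unc\<close> asks only that the products at different indices be
  uncorrelated. In this form the estimate applies both to a sample paired with itself and to two
  independent samples.\<close>

lemma scalar_cov_second_moment:
  fixes x y :: "nat \<Rightarrow> 'a \<Rightarrow> real"
  assumes J: "2 \<le> J" and pos: "0 < \<alpha>" "0 < \<beta>"
    and x: "\<And>j. j < J \<Longrightarrow> normal_moments (x j) \<alpha>" and sx: "normal_moments (\<lambda>\<omega>. \<Sum>j<J. x j \<omega>) (real J * \<alpha>)"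
    and y: "\<And>j. j < J \<Longrightarrow> normal_moments (y j) \<beta>" and sy: "normal_moments (\<lambda>\<omega>. \<Sum>j<J. y j \<omega>) (real J * \<beta>)"
    and \<kappa>: "\<And>j. j < J \<Longrightarrow> expectation (\<lambda>\<omega>. x j \<omega> * y j \<omega>) = \<kappa>"
    and unc: "\<And>j k. j < J \<Longrightarrow> k < J \<Longrightarrow> j \<noteq> k \<Longrightarrow>
      expectation (\<lambda>\<omega>. (x j \<omega> * y j \<omega>) * (x k \<omega> * y k \<omega>)) = \<kappa>\<^sup>2"
  shows "integrable M (\<lambda>\<omega>. (scalar_cov J (\<lambda>j. x j \<omega>) (\<lambda>j. y j \<omega>) - \<kappa>)\<^sup>2)"
    "expectation (\<lambda>\<omega>. (scalar_cov J (\<lambda>j. x j \<omega>) (\<lambda>j. y j \<omega>) - \<kappa>)\<^sup>2) \<le> 72 * \<alpha> * \<beta> / real J"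
proof -
  have rv[measurable]: "random_variable borel (x j)" "random_variable borel (y j)" if "j < J" for j
    using x y that by (auto simp: normal_moments_def)
  have pm: "integrable M (\<lambda>\<omega>. (x j \<omega> * y j \<omega>)\<^sup>2)" "expectation (\<lambda>\<omega>. (x j \<omega> * y j \<omega>)\<^sup>2) \<le> 3 * \<alpha> * \<beta>"
    if "j < J" for j
    using product_second_moment[OF normal_momentsD(1-3)[OF x[OF that]] normal_momentsD(1-3)[OF y[OF that]] pos]
    by blast+
  have ip: "integrable M (\<lambda>\<omega>. x j \<omega> * y j \<omega>)" if "j < J" for j
    by (rule square_integrable_imp_integrable[OF borel_measurable_times[OF rv[OF that]] pm(1)[OF that]])
  have ipp: "integrable M (\<lambda>\<omega>. (x j \<omega> * y j \<omega>) * (x k \<omega> * y k \<omega>))" if "j < J" "k < J" for j k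
  proof (rule Bochner_Integration.integrable_bound)
    show "integrable M (\<lambda>\<omega>. (x j \<omega> * y j \<omega>)\<^sup>2 + (x k \<omega> * y k \<omega>)\<^sup>2)"
      by (intro Bochner_Integration.integrable_add pm that)
    have "\<bar>a * b\<bar> \<le> a\<^sup>2 + b\<^sup>2" for a b :: real
    proof -
      have "2 * \<bar>a\<bar> * \<bar>b\<bar> \<le> a\<^sup>2 + b\<^sup>2" using sum_squares_bound[of "\<bar>a\<bar>" "\<bar>b\<bar>"] by simp
      moreover have "0 \<le> \<bar>a\<bar> * \<bar>b\<bar>" by simp
      ultimately show ?thesis unfolding abs_mult by linarith
    qed
    then show "AE \<omega> in M. norm (x j \<omega> * y j \<omega> * (x k \<omega> * y k \<omega>)) \<le> norm ((x j \<omega> * y j \<omega>)\<^sup>2 + (x k \<omega> * y k \<omega>)\<^sup>2)"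
      by (auto intro!: AE_I2)
  qed (intro borel_measurable_times rv that)
  \<comment> \<open>A nonnegative variance bounds the squared mean by the second moment.\<close>
  have \<kappa>2: "\<kappa>\<^sup>2 \<le> 3 * \<alpha> * \<beta>"
  proof -
    have 0: "0 < J" using J by simp
    have "0 \<le> variance (\<lambda>\<omega>. x 0 \<omega> * y 0 \<omega>)" by simp
    also have "\<dots> = expectation (\<lambda>\<omega>. (x 0 \<omega> * y 0 \<omega>)\<^sup>2) - \<kappa>\<^sup>2"
      using ip[OF 0] pm(1)[OF 0] \<kappa>[OF 0] by (subst variance_eq) auto
    finally show ?thesis using pm(2)[OF 0] by simp
  qed
  let ?Z = "\<lambda>j \<omega>. x j \<omega> * y j \<omega> - \<kappa>"
  have Zexp: "(\<lambda>\<omega>. ?Z j \<omega> * ?Z k \<omega>) = (\<lambda>\<omega>. (x j \<omega> * y j \<omega>) * (x k \<omega> * y k \<omega>) - \<kappa> * (x j \<omega> * y j \<omega>) - \<kappa> * (x k \<omega> * y k \<omega>) + \<kappa>\<^sup>2)" for j k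
    by (auto simp: algebra_simps power2_eq_square)
  have Zint: "integrable M (\<lambda>\<omega>. ?Z j \<omega> * ?Z k \<omega>)" if "j < J" "k < J" for j k
    unfolding Zexp using ipp[OF that] ip that by auto
  have EZ: "expectation (\<lambda>\<omega>. ?Z j \<omega> * ?Z k \<omega>) = expectation (\<lambda>\<omega>. (x j \<omega> * y j \<omega>) * (x k \<omega> * y k \<omega>)) - \<kappa>\<^sup>2" if "j < J" "k < J" for j k
    unfolding Zexp using ipp[OF that] ip that \<kappa> by (simp add: prob_space power2_eq_square)
  have Z: "integrable M (\<lambda>\<omega>. (\<Sum>j<J. ?Z j \<omega>)\<^sup>2)"
    "expectation (\<lambda>\<omega>. (\<Sum>j<J. ?Z j \<omega>)\<^sup>2) \<le> real (card {..<J}) * (3 * \<alpha> * \<beta>)"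
  proof -
    have sec: "expectation (\<lambda>\<omega>. (?Z j \<omega>)\<^sup>2) \<le> 3 * \<alpha> * \<beta>" if j: "j \<in> {..<J}" for j
    proof -
      have "j < J" using j by simp
      have "expectation (\<lambda>\<omega>. (?Z j \<omega>)\<^sup>2) = expectation (\<lambda>\<omega>. (x j \<omega> * y j \<omega>)\<^sup>2) - \<kappa>\<^sup>2"
        using EZ[OF \<open>j < J\<close> \<open>j < J\<close>] by (simp only: power2_eq_square)
      then show ?thesis using pm(2)[OF \<open>j < J\<close>] zero_le_power2[of \<kappa>] by linarith
    qed
    have int: "integrable M (\<lambda>\<omega>. ?Z j \<omega> * ?Z k \<omega>)" if "j \<in> {..<J}" "k \<in> {..<J}" for j k
      using Zint that by simp
    have orth: "expectation (\<lambda>\<omega>. ?Z j \<omega> * ?Z k \<omega>) = 0"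
      if "j \<in> {..<J}" "k \<in> {..<J}" "j \<noteq> k" for j k
      using EZ[of j k] unc[of j k] that by simp
    note u = uncorrelated_sum_second_moment[of "{..<J}" ?Z "3 * \<alpha> * \<beta>", OF finite_lessThan int orth sec]
    show "integrable M (\<lambda>\<omega>. (\<Sum>j<J. ?Z j \<omega>)\<^sup>2)" by (rule u(1))
    show "expectation (\<lambda>\<omega>. (\<Sum>j<J. ?Z j \<omega>)\<^sup>2) \<le> real (card {..<J}) * (3 * \<alpha> * \<beta>)" by (rule u(2))
  qed
  let ?W = "\<lambda>\<omega>. (\<Sum>j<J. x j \<omega>) * (\<Sum>j<J. y j \<omega>)"
  have W: "integrable M (\<lambda>\<omega>. (?W \<omega>)\<^sup>2)" "expectation (\<lambda>\<omega>. (?W \<omega>)\<^sup>2) \<le> 3 * (real J * \<alpha>) * (real J * \<beta>)"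
  proof -
    have "0 < real J * \<alpha>" "0 < real J * \<beta>" using pos J by simp_all
    from product_second_moment[OF normal_momentsD(1-3)[OF sx] normal_momentsD(1-3)[OF sy] this]
    show "integrable M (\<lambda>\<omega>. (?W \<omega>)\<^sup>2)" "expectation (\<lambda>\<omega>. (?W \<omega>)\<^sup>2) \<le> 3 * (real J * \<alpha>) * (real J * \<beta>)"
      by blast+
  qed
  \<comment> \<open>The three parts of \<open>scalar_cov_eq\<close>, separated at the cost of a
    factor 3.\<close>
  let ?B = "\<lambda>\<omega>. 3 / (real J - 1)\<^sup>2 * ((\<Sum>j<J. ?Z j \<omega>)\<^sup>2 + (?W \<omega>)\<^sup>2 / (real J)\<^sup>2 + \<kappa>\<^sup>2)"
  have le: "(scalar_cov J (\<lambda>j. x j \<omega>) (\<lambda>j. y j \<omega>) - \<kappa>)\<^sup>2 \<le> ?B \<omega>" for \<omega>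
  proof -
    have "(a - b + c)\<^sup>2 \<le> 3 * (a\<^sup>2 + b\<^sup>2 + c\<^sup>2)" for a b c :: real
    proof -
      have "0 \<le> (a + b)\<^sup>2 + (a - c)\<^sup>2 + (b + c)\<^sup>2" by simp
      then show ?thesis by (simp add: power2_eq_square algebra_simps)
    qed
    from divide_right_mono[OF this, of "(real J - 1)\<^sup>2" "\<Sum>j<J. ?Z j \<omega>" "?W \<omega> / real J" \<kappa>]
    show ?thesis unfolding scalar_cov_eq[OF J] power_divide by simp
  qed
  have iB: "integrable M ?B" using Z W by auto
  have [measurable]: "random_variable borel (\<lambda>\<omega>. scalar_cov J (\<lambda>j. x j \<omega>) (\<lambda>j. y j \<omega>))"
    unfolding scalar_cov_def sample_mean_def
    by (intro borel_measurable_divide borel_measurable_sum borel_measurable_times borel_measurable_diff borel_measurable_const borel_measurable_scaleR)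
       auto
  show i: "integrable M (\<lambda>\<omega>. (scalar_cov J (\<lambda>j. x j \<omega>) (\<lambda>j. y j \<omega>) - \<kappa>)\<^sup>2)"
    using le by (intro Bochner_Integration.integrable_bound[OF iB]) (auto intro!: AE_I2 order_trans[OF le])
  have s1: "expectation (\<lambda>\<omega>. (scalar_cov J (\<lambda>j. x j \<omega>) (\<lambda>j. y j \<omega>) - \<kappa>)\<^sup>2) \<le> expectation ?B"
    using i iB le by (rule integral_mono)
  have s2: "expectation ?B = 3 / (real J - 1)\<^sup>2 * (expectation (\<lambda>\<omega>. (\<Sum>j<J. ?Z j \<omega>)\<^sup>2)
      + expectation (\<lambda>\<omega>. (?W \<omega>)\<^sup>2) / (real J)\<^sup>2 + \<kappa>\<^sup>2)"
    using Z W by (simp add: prob_space)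
  have s3: "3 / (real J - 1)\<^sup>2 * (expectation (\<lambda>\<omega>. (\<Sum>j<J. ?Z j \<omega>)\<^sup>2)
      + expectation (\<lambda>\<omega>. (?W \<omega>)\<^sup>2) / (real J)\<^sup>2 + \<kappa>\<^sup>2)
      \<le> 3 / (real J - 1)\<^sup>2 * (real J * (3 * \<alpha> * \<beta>) + 3 * \<alpha> * \<beta> + 3 * \<alpha> * \<beta>)"
  proof (intro mult_left_mono add_mono)
    have "expectation (\<lambda>\<omega>. (?W \<omega>)\<^sup>2) / (real J)\<^sup>2 \<le> 3 * (real J * \<alpha>) * (real J * \<beta>) / (real J)\<^sup>2"
      using W(2) by (rule divide_right_mono) simp
    also have "\<dots> = 3 * \<alpha> * \<beta>" using J by (simp add: power2_eq_square)
    finally show "expectation (\<lambda>\<omega>. (?W \<omega>)\<^sup>2) / (real J)\<^sup>2 \<le> 3 * \<alpha> * \<beta>" .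
    show "expectation (\<lambda>\<omega>. (\<Sum>j<J. ?Z j \<omega>)\<^sup>2) \<le> real J * (3 * \<alpha> * \<beta>)" using Z(2) by simp
    show "\<kappa>\<^sup>2 \<le> 3 * \<alpha> * \<beta>" by (rule \<kappa>2)
  qed simp
  have s4: "3 / (real J - 1)\<^sup>2 * (real J * (3 * \<alpha> * \<beta>) + 3 * \<alpha> * \<beta> + 3 * \<alpha> * \<beta>) \<le> 72 * \<alpha> * \<beta> / real J"
  proof -
    have J1: "0 < real J" "0 < (real J - 1)\<^sup>2" using J by auto
    \<comment> \<open>This product is the difference of the two sides of the next inequality. It
      vanishes at \<open>J = 2\<close>, which is where the constant 72 comes from.\<close>
    have "0 \<le> (real J - 2) * (63 * real J - 36)" using J by (intro mult_nonneg_nonneg) auto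
    then have "9 * (real J + 2) * real J \<le> 72 * (real J - 1)\<^sup>2"
      by (simp add: power2_eq_square algebra_simps)
    then have "9 * (real J + 2) / (real J - 1)\<^sup>2 \<le> 72 / real J"
      using J1 by (simp only: pos_divide_le_eq[OF J1(2)] times_divide_eq_left pos_le_divide_eq[OF J1(1)])
    then have "9 * (real J + 2) / (real J - 1)\<^sup>2 * (\<alpha> * \<beta>) \<le> 72 / real J * (\<alpha> * \<beta>)"
      using pos by (intro mult_right_mono) auto
    moreover have "3 / D * (real J * (3 * \<alpha> * \<beta>) + 3 * \<alpha> * \<beta> + 3 * \<alpha> * \<beta>)
        = 9 * (real J + 2) / D * (\<alpha> * \<beta>)" for D
      by (simp add: divide_inverse algebra_simps)
    moreover have "72 / real J * (\<alpha> * \<beta>) = 72 * \<alpha> * \<beta> / real J" by simp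
    ultimately show ?thesis by metis
  qed
  show "expectation (\<lambda>\<omega>. (scalar_cov J (\<lambda>j. x j \<omega>) (\<lambda>j. y j \<omega>) - \<kappa>)\<^sup>2) \<le> 72 * \<alpha> * \<beta> / real J"
    by (rule order_trans[OF s1[unfolded s2] order_trans[OF s3 s4]])
qed

end

section \<open>Covariance entries of independent samples\<close>

context prob_space
begin

lemma normal_moments_integrable: "normal_moments X v \<Longrightarrow> integrable M X"
  using integrable_lower_powers[of X 1] by (simp add: normal_moments_def)

text \<open>Polarisation: the covariance is recovered from the variances of \<open>X\<close>,
  \<open>Y\<close> and their sum, all of them one-dimensional marginals.\<close>

lemma normal_moments_product_expectation:
  assumes X: "normal_moments X \<alpha>" and Y: "normal_moments Y \<beta>"
    and XY: "normal_moments (\<lambda>\<omega>. X \<omega> + Y \<omega>) (\<alpha> + \<beta> + 2 * \<kappa>)"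
  shows "expectation (\<lambda>\<omega>. X \<omega> * Y \<omega>) = \<kappa>"
proof -
  have i: "integrable M (\<lambda>\<omega>. (X \<omega>)\<^sup>2)" "integrable M (\<lambda>\<omega>. (Y \<omega>)\<^sup>2)" "integrable M (\<lambda>\<omega>. (X \<omega> + Y \<omega>)\<^sup>2)"
    using assms by (auto intro!: integrable_lower_powers simp: normal_moments_def)
  have "(\<lambda>\<omega>. X \<omega> * Y \<omega>) = (\<lambda>\<omega>. ((X \<omega> + Y \<omega>)\<^sup>2 - (X \<omega>)\<^sup>2 - (Y \<omega>)\<^sup>2) / 2)"
    by (auto simp: power2_sum)
  then have "expectation (\<lambda>\<omega>. X \<omega> * Y \<omega>) =
      (expectation (\<lambda>\<omega>. (X \<omega> + Y \<omega>)\<^sup>2) - expectation (\<lambda>\<omega>. (X \<omega>)\<^sup>2) - expectation (\<lambda>\<omega>. (Y \<omega>)\<^sup>2)) / 2"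
    using i by simp
  then show ?thesis using assms by (simp add: normal_moments_def)
qed

lemma normal_moments_product_integrable:
  assumes X: "normal_moments X \<alpha>" and Y: "normal_moments Y \<beta>"
  shows "integrable M (\<lambda>\<omega>. X \<omega> * Y \<omega>)"
proof (rule Bochner_Integration.integrable_bound)
  have rv: "random_variable borel X" "random_variable borel Y" using X Y by (auto simp: normal_moments_def)
  then show "random_variable borel (\<lambda>\<omega>. X \<omega> * Y \<omega>)" by simp
  show "integrable M (\<lambda>\<omega>. (X \<omega>)\<^sup>2 + (Y \<omega>)\<^sup>2)"
    using assms by (auto intro!: Bochner_Integration.integrable_add integrable_lower_powers simp: normal_moments_def)
  have "\<bar>a * b\<bar> \<le> a\<^sup>2 + b\<^sup>2" for a b :: real
  proof -
    have "2 * \<bar>a\<bar> * \<bar>b\<bar> \<le> a\<^sup>2 + b\<^sup>2" using sum_squares_bound[of "\<bar>a\<bar>" "\<bar>b\<bar>"] by simp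
    moreover have "0 \<le> \<bar>a\<bar> * \<bar>b\<bar>" by simp
    ultimately show ?thesis unfolding abs_mult by linarith
  qed
  then show "AE \<omega> in M. norm (X \<omega> * Y \<omega>) \<le> norm ((X \<omega>)\<^sup>2 + (Y \<omega>)\<^sup>2)" by (auto intro!: AE_I2)
qed

lemma indep_vars_imp_indep_var:
  assumes "indep_vars N X I" "i \<in> I" "j \<in> I" "i \<noteq> j"
  shows "indep_var (N i) (X i) (N j) (X j)"
proof -
  have "indep_var (N i) ((\<lambda>f. f i) \<circ> (\<lambda>\<omega>. restrict (\<lambda>k. X k \<omega>) {i}))
      (N j) ((\<lambda>f. f j) \<circ> (\<lambda>\<omega>. restrict (\<lambda>k. X k \<omega>) {j}))"
    using assms by (intro indep_var_compose[OF indep_var_restrict[OF assms(1)]]) auto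
  then show ?thesis by (simp add: comp_def)
qed

lemma indep_var_compose':
  assumes "indep_var N1 X N2 Y" "p \<in> borel_measurable N1" "q \<in> borel_measurable N2"
  shows "indep_var borel (\<lambda>\<omega>. p (X \<omega>) :: real) borel (\<lambda>\<omega>. q (Y \<omega>) :: real)"
  using indep_var_compose[OF assms] by (simp add: comp_def)

text \<open>The independence of two families is given through the sigma-algebras that they generate;
  a real function of a family generates a smaller one.\<close>

lemma indep_var_of_indep_set_vimage:
  assumes ind: "indep_set (sets (vimage_algebra (space M) S N)) (sets (vimage_algebra (space M) T N'))"
    and S: "S \<in> measurable M N" and T: "T \<in> measurable M N'"
    and p: "p \<in> borel_measurable N" and q: "q \<in> borel_measurable N'"
  shows "indep_var borel (\<lambda>\<omega>. p (S \<omega>) :: real) borel (\<lambda>\<omega>. q (T \<omega>) :: real)"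
proof -
  have sub: "sigma_sets (space M) {(\<lambda>\<omega>. h (R \<omega>)) -` A \<inter> space M |A. A \<in> sets borel}
      \<subseteq> sets (vimage_algebra (space M) R K)"
    if "h \<in> borel_measurable K" "R \<in> measurable M K" for h :: "'z \<Rightarrow> real" and R K
  proof -
    have "{(\<lambda>\<omega>. h (R \<omega>)) -` A \<inter> space M |A. A \<in> sets borel} \<subseteq> sets (vimage_algebra (space M) R K)"
    proof clarify
      fix A :: "real set" assume "A \<in> sets borel"
      then have "h -` A \<inter> space K \<in> sets K" using that by auto
      then have "R -` (h -` A \<inter> space K) \<inter> space M \<in> sets (vimage_algebra (space M) R K)"
        by (rule in_vimage_algebra)
      also have "R -` (h -` A \<inter> space K) \<inter> space M = (\<lambda>\<omega>. h (R \<omega>)) -` A \<inter> space M"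
        using measurable_space[OF that(2)] by auto
      finally show "(\<lambda>\<omega>. h (R \<omega>)) -` A \<inter> space M \<in> sets (vimage_algebra (space M) R K)" .
    qed
    from sets.sigma_sets_subset[OF this] show ?thesis by simp
  qed
  note [measurable] = S T p q
  show ?thesis
    unfolding indep_var_eq
  proof (intro conjI)
    show "indep_set (sigma_sets (space M) {(\<lambda>\<omega>. p (S \<omega>)) -` A \<inter> space M |A. A \<in> sets borel})
        (sigma_sets (space M) {(\<lambda>\<omega>. q (T \<omega>)) -` A \<inter> space M |A. A \<in> sets borel})"
      using ind unfolding indep_set_def
      by (rule indep_sets_mono_sets) (use sub[OF p S] sub[OF q T] in \<open>auto split: bool.split\<close>)
  qed measurable
qed

lemma normal_moments_iid_sum:
  fixes p :: "'x \<Rightarrow> real"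
  assumes ind: "indep_vars (\<lambda>_. N) X {..<J::nat}" and p: "p \<in> borel_measurable N"
    and "\<And>j. j < J \<Longrightarrow> normal_moments (\<lambda>\<omega>. p (X j \<omega>)) \<alpha>"
  shows "normal_moments (\<lambda>\<omega>. \<Sum>j<J. p (X j \<omega>)) (real J * \<alpha>)"
  using normal_moments_sum[of "{..<J}" "\<lambda>j \<omega>. p (X j \<omega>)" "\<lambda>_. \<alpha>"] assms(3)
    indep_vars_compose2[OF ind, of "\<lambda>_. p" "\<lambda>_. borel"] p by simp

lemma sample_cov_error_same:
  fixes p q :: "'x \<Rightarrow> real"
  assumes J: "2 \<le> J" and pos: "0 < \<alpha>" "0 < \<beta>"
    and ind: "indep_vars (\<lambda>_. N) X {..<J}"
    and p: "p \<in> borel_measurable N" and q: "q \<in> borel_measurable N"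
    and mp: "\<And>j. j < J \<Longrightarrow> normal_moments (\<lambda>\<omega>. p (X j \<omega>)) \<alpha>"
    and mq: "\<And>j. j < J \<Longrightarrow> normal_moments (\<lambda>\<omega>. q (X j \<omega>)) \<beta>"
    and mpq: "\<And>j. j < J \<Longrightarrow> normal_moments (\<lambda>\<omega>. p (X j \<omega>) + q (X j \<omega>)) (\<alpha> + \<beta> + 2 * \<kappa>)"
  shows "integrable M (\<lambda>\<omega>. (scalar_cov J (\<lambda>j. p (X j \<omega>)) (\<lambda>j. q (X j \<omega>)) - \<kappa>)\<^sup>2)"
    "expectation (\<lambda>\<omega>. (scalar_cov J (\<lambda>j. p (X j \<omega>)) (\<lambda>j. q (X j \<omega>)) - \<kappa>)\<^sup>2) \<le> 72 * \<alpha> * \<beta> / real J"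
proof -
  have \<kappa>: "expectation (\<lambda>\<omega>. p (X j \<omega>) * q (X j \<omega>)) = \<kappa>" if "j < J" for j
    using normal_moments_product_expectation[OF mp mq mpq] that by simp
  have int: "integrable M (\<lambda>\<omega>. p (X j \<omega>) * q (X j \<omega>))" if "j < J" for j
    using normal_moments_product_integrable[OF mp mq] that by simp
  have unc: "expectation (\<lambda>\<omega>. (p (X j \<omega>) * q (X j \<omega>)) * (p (X k \<omega>) * q (X k \<omega>))) = \<kappa>\<^sup>2"
    if "j < J" "k < J" "j \<noteq> k" for j k
  proof -
    have "indep_var N (X j) N (X k)"
      using indep_vars_imp_indep_var[OF ind] that by simp
    then have "indep_var borel (\<lambda>\<omega>. p (X j \<omega>) * q (X j \<omega>)) borel (\<lambda>\<omega>. p (X k \<omega>) * q (X k \<omega>))"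
      using p q by (intro indep_var_compose'[where p = "\<lambda>x. p x * q x" and q = "\<lambda>x. p x * q x"]) auto
    from indep_var_lebesgue_integral[OF this int[OF that(1)] int[OF that(2)]]
    show ?thesis using \<kappa> that by (simp add: power2_eq_square)
  qed
  note sp = normal_moments_iid_sum[OF ind p mp] and sq = normal_moments_iid_sum[OF ind q mq]
  note c = scalar_cov_second_moment[of J \<alpha> \<beta> "\<lambda>j \<omega>. p (X j \<omega>)" "\<lambda>j \<omega>. q (X j \<omega>)" \<kappa>,
      OF J pos mp sp mq sq \<kappa> unc]
  show "integrable M (\<lambda>\<omega>. (scalar_cov J (\<lambda>j. p (X j \<omega>)) (\<lambda>j. q (X j \<omega>)) - \<kappa>)\<^sup>2)"
    by (rule c(1))
  show "expectation (\<lambda>\<omega>. (scalar_cov J (\<lambda>j. p (X j \<omega>)) (\<lambda>j. q (X j \<omega>)) - \<kappa>)\<^sup>2) \<le> 72 * \<alpha> * \<beta> / real J"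
    by (rule c(2))
qed

text \<open>The true covariance is 0. For different indices the four factors are regrouped family by
  family: independence across the families separates the two pairs, and independence within
  \<open>X\<close> makes the mean of the first pair vanish.\<close>

lemma sample_cov_error_cross:
  fixes p :: "'x \<Rightarrow> real" and q :: "'y \<Rightarrow> real"
  assumes J: "2 \<le> J" and pos: "0 < \<alpha>" "0 < \<beta>"
    and ind: "indep_vars (\<lambda>_. N) X {..<J}" and ind': "indep_vars (\<lambda>_. N') Y {..<J}"
    and joint: "indep_set
      (sets (vimage_algebra (space M) (\<lambda>\<omega>. \<lambda>j\<in>{..<J}. X j \<omega>) (\<Pi>\<^sub>M j\<in>{..<J}. N)))
      (sets (vimage_algebra (space M) (\<lambda>\<omega>. \<lambda>j\<in>{..<J}. Y j \<omega>) (\<Pi>\<^sub>M j\<in>{..<J}. N')))"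
    and p: "p \<in> borel_measurable N" and q: "q \<in> borel_measurable N'"
    and mp: "\<And>j. j < J \<Longrightarrow> normal_moments (\<lambda>\<omega>. p (X j \<omega>)) \<alpha>"
    and mq: "\<And>j. j < J \<Longrightarrow> normal_moments (\<lambda>\<omega>. q (Y j \<omega>)) \<beta>"
  shows "integrable M (\<lambda>\<omega>. (scalar_cov J (\<lambda>j. p (X j \<omega>)) (\<lambda>j. q (Y j \<omega>)))\<^sup>2)"
    "expectation (\<lambda>\<omega>. (scalar_cov J (\<lambda>j. p (X j \<omega>)) (\<lambda>j. q (Y j \<omega>)))\<^sup>2) \<le> 72 * \<alpha> * \<beta> / real J"
proof -
  have S: "(\<lambda>\<omega>. \<lambda>j\<in>{..<J}. X j \<omega>) \<in> measurable M (\<Pi>\<^sub>M j\<in>{..<J}. N)"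
    using ind by (intro measurable_restrict) (auto simp: indep_vars_def2)
  have T: "(\<lambda>\<omega>. \<lambda>j\<in>{..<J}. Y j \<omega>) \<in> measurable M (\<Pi>\<^sub>M j\<in>{..<J}. N')"
    using ind' by (intro measurable_restrict) (auto simp: indep_vars_def2)
  note joint' = indep_var_of_indep_set_vimage[OF joint S T]
  have i1: "integrable M (\<lambda>\<omega>. p (X j \<omega>))" "integrable M (\<lambda>\<omega>. q (Y j \<omega>))" if "j < J" for j
    by (rule normal_moments_integrable[OF mp[OF that]], rule normal_moments_integrable[OF mq[OF that]])
  have ip: "integrable M (\<lambda>\<omega>. p (X j \<omega>) * p (X k \<omega>))" "integrable M (\<lambda>\<omega>. q (Y j \<omega>) * q (Y k \<omega>))" if "j < J" "k < J" for j k
    by (rule normal_moments_product_integrable[OF mp[OF that(1)] mp[OF that(2)]],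
        rule normal_moments_product_integrable[OF mq[OF that(1)] mq[OF that(2)]])
  have \<kappa>: "expectation (\<lambda>\<omega>. p (X j \<omega>) * q (Y j \<omega>)) = 0" if "j < J" for j
  proof -
    have "indep_var borel (\<lambda>\<omega>. p ((\<lambda>j\<in>{..<J}. X j \<omega>) j)) borel (\<lambda>\<omega>. q ((\<lambda>j\<in>{..<J}. Y j \<omega>) j))"
      using that p q by (intro joint'[where p = "\<lambda>f. p (f j)" and q = "\<lambda>f. q (f j)"]) auto
    then have "indep_var borel (\<lambda>\<omega>. p (X j \<omega>)) borel (\<lambda>\<omega>. q (Y j \<omega>))" using that by simp
    from indep_var_lebesgue_integral[OF this i1[OF that]] show ?thesis
      using mp[OF that] by (simp add: normal_moments_def)
  qed
  have unc: "expectation (\<lambda>\<omega>. (p (X j \<omega>) * q (Y j \<omega>)) * (p (X k \<omega>) * q (Y k \<omega>))) = 0\<^sup>2"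
    if "j < J" "k < J" "j \<noteq> k" for j k
  proof -
    have "indep_var borel (\<lambda>\<omega>. p ((\<lambda>j\<in>{..<J}. X j \<omega>) j) * p ((\<lambda>j\<in>{..<J}. X j \<omega>) k))
        borel (\<lambda>\<omega>. q ((\<lambda>j\<in>{..<J}. Y j \<omega>) j) * q ((\<lambda>j\<in>{..<J}. Y j \<omega>) k))"
      using that p q
      by (intro joint'[where p = "\<lambda>f. p (f j) * p (f k)" and q = "\<lambda>f. q (f j) * q (f k)"]
          borel_measurable_times) auto
    then have "indep_var borel (\<lambda>\<omega>. p (X j \<omega>) * p (X k \<omega>)) borel (\<lambda>\<omega>. q (Y j \<omega>) * q (Y k \<omega>))"
      using that by simp
    from indep_var_lebesgue_integral[OF this ip[OF that(1,2)]]
    have "expectation (\<lambda>\<omega>. p (X j \<omega>) * p (X k \<omega>) * (q (Y j \<omega>) * q (Y k \<omega>)))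
      = expectation (\<lambda>\<omega>. p (X j \<omega>) * p (X k \<omega>)) * expectation (\<lambda>\<omega>. q (Y j \<omega>) * q (Y k \<omega>))" .
    moreover have "expectation (\<lambda>\<omega>. p (X j \<omega>) * p (X k \<omega>)) = 0"
    proof -
      have "indep_var borel (\<lambda>\<omega>. p (X j \<omega>)) borel (\<lambda>\<omega>. p (X k \<omega>))"
        using indep_vars_imp_indep_var[OF ind] that p by (intro indep_var_compose') auto
      from indep_var_lebesgue_integral[OF this i1(1)[OF that(1)] i1(1)[OF that(2)]]
      show ?thesis using mp[OF that(1)] by (simp add: normal_moments_def)
    qed
    moreover have "(\<lambda>\<omega>. (p (X j \<omega>) * q (Y j \<omega>)) * (p (X k \<omega>) * q (Y k \<omega>)))
      = (\<lambda>\<omega>. p (X j \<omega>) * p (X k \<omega>) * (q (Y j \<omega>) * q (Y k \<omega>)))" by (auto simp: ac_simps)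
    ultimately show ?thesis by simp
  qed
  note sp = normal_moments_iid_sum[OF ind p mp] and sq = normal_moments_iid_sum[OF ind' q mq]
  note c = scalar_cov_second_moment[of J \<alpha> \<beta> "\<lambda>j \<omega>. p (X j \<omega>)" "\<lambda>j \<omega>. q (Y j \<omega>)" 0,
      OF J pos mp sp mq sq \<kappa> unc]
  show "integrable M (\<lambda>\<omega>. (scalar_cov J (\<lambda>j. p (X j \<omega>)) (\<lambda>j. q (Y j \<omega>)))\<^sup>2)"
    using c(1) by simp
  show "expectation (\<lambda>\<omega>. (scalar_cov J (\<lambda>j. p (X j \<omega>)) (\<lambda>j. q (Y j \<omega>)))\<^sup>2) \<le> 72 * \<alpha> * \<beta> / real J"
    using c(2) by simp
qed

end

lemma normal_moments_distr_iff:
  assumes "prob_space M" and f: "f \<in> measurable M N" and X: "X \<in> borel_measurable N"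
  shows "prob_space.normal_moments (distr M N f) X v \<longleftrightarrow> prob_space.normal_moments M (\<lambda>\<omega>. X (f \<omega>)) v"
proof -
  interpret prob_space M by fact
  interpret D: prob_space "distr M N f" using f by (rule prob_space_distr)
  note [measurable] = f X
  show ?thesis
    unfolding normal_moments_def D.normal_moments_def
    by (simp add: integrable_distr_eq integral_distr)
qed

text \<open>Lets the ensemble be recentred at its true mean, where the moment estimates
  apply.\<close>

lemma scalar_cov_shift:
  assumes "0 < J"
  shows "scalar_cov J (\<lambda>j. x j - a) (\<lambda>j. y j - b) = scalar_cov J x y"
proof -
  have "sample_mean J (\<lambda>j. z j - c) = sample_mean J z - c" for z :: "nat \<Rightarrow> real" and c
    using sample_mean_add[of J z "\<lambda>_. - c"] sample_mean_const[OF assms, of "-c"] by simp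
  then show ?thesis by (simp add: scalar_cov_def)
qed

section \<open>Sampling errors of the ensemble\<close>

lemma std_normal_product:
  fixes n :: nat
  assumes n: "1 \<le> n"
  defines "N \<equiv> \<Pi>\<^sub>M i\<in>{..<n}. normal_law 0 1"
  shows "prob_space N" "sets N = sets (\<Pi>\<^sub>M i\<in>{..<n}. borel)"
    "prob_space.indep_vars N (\<lambda>_. borel) (\<lambda>i \<xi>. \<xi> i) {..<n}"
    "\<And>i. i < n \<Longrightarrow> prob_space.normal_moments N (\<lambda>\<xi>. \<xi> i) 1"
proof -
  have P: "prob_space (normal_law 0 1)" and S: "sets (normal_law 0 1) = sets borel"
    using normal_law_moments[of 1] by auto
  show N: "prob_space N" unfolding N_def using P by (intro prob_space_PiM)
  interpret prob_space N by fact
  show sets: "sets N = sets (\<Pi>\<^sub>M i\<in>{..<n}. borel)" unfolding N_def by (intro sets_PiM_cong) (auto simp: S)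
  have d: "distr N borel (\<lambda>\<xi>. \<xi> i) = normal_law 0 1" if "i < n" for i
  proof -
    have "distr N borel (\<lambda>\<xi>. \<xi> i) = distr N (normal_law 0 1) (\<lambda>\<xi>. \<xi> i)"
      using S by (intro distr_cong) auto
    also have "\<dots> = normal_law 0 1" unfolding N_def using that P by (intro distr_PiM_component) auto
    finally show ?thesis .
  qed
  have rv: "random_variable borel (\<lambda>\<xi>. \<xi> i)" if "i < n" for i
    using that unfolding measurable_cong_sets[OF sets refl] by (intro measurable_component_singleton) auto
  have "distr N (\<Pi>\<^sub>M i\<in>{..<n}. borel) (\<lambda>x. \<lambda>i\<in>{..<n}. x i) = distr N N (\<lambda>x. x)"
  proof (rule distr_cong)
    fix x assume "x \<in> space N"
    then have "x \<in> space (\<Pi>\<^sub>M i\<in>{..<n}. borel :: real measure)" using sets_eq_imp_space_eq[OF sets] by simp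
    then show "(\<lambda>i\<in>{..<n}. x i) = x" by (auto simp: space_PiM PiE_def extensional_restrict)
  qed (simp_all add: sets)
  also have "\<dots> = N" by (rule distr_id)
  also have "\<dots> = (\<Pi>\<^sub>M i\<in>{..<n}. distr N borel (\<lambda>\<xi>. \<xi> i))"
    by (subst N_def) (intro PiM_cong refl d[symmetric], simp)
  \<comment> \<open>The characterisation of independence by product laws requires a nonempty index
    set, hence \<open>1 \<le> n\<close>.\<close>
  finally show "indep_vars (\<lambda>_. borel) (\<lambda>i \<xi>. \<xi> i) {..<n}"
    using n rv by (subst indep_vars_iff_distr_eq_PiM') (auto simp: lessThan_empty_iff bot_nat_def)
  show "normal_moments (\<lambda>\<xi>. \<xi> i) 1" if "i < n" for i
    using rv[OF that] d[OF that] by (intro normal_moments_distr) auto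
qed

section \<open>Gaussian laws on coefficients, lifted to the Hilbert space\<close>

context discretization
begin

lemma inner_lift_gaussian_measurable:
  "(\<lambda>x. (synth n \<phi> x - z) \<bullet> h) \<in> borel_measurable (\<Pi>\<^sub>M i\<in>{..<n}. borel)"
  unfolding synth_def inner_diff_left inner_sum_left inner_scaleR_left
  by (intro borel_measurable_diff borel_measurable_sum borel_measurable_times borel_measurable_const
      measurable_component_singleton) auto

text \<open>The \<open>\<Lambda> a\<close> are the columns of the factor \<open>L\<close>, lifted.
  The covariance becomes a sum of rank-one operators, its matrix trace a sum of squared norms, and
  the centred Gaussian a combination of the \<open>\<Lambda> a\<close> with independent standard
  normal coefficients.\<close>

lemma gaussian_G_factor:
  assumes g: "is_gaussian_G n (gram \<phi>) \<mu> m C" and n: "1 \<le> n"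
  obtains \<Lambda> where "\<And>a. \<Lambda> a \<in> V"
    "\<And>h. lift_op n \<phi> C h = (\<Sum>a<n. (\<Lambda> a \<bullet> h) *\<^sub>R \<Lambda> a)"
    "(\<Sum>i<n. C i i) = (\<Sum>a<n. (norm (\<Lambda> a))\<^sup>2)"
    "\<And>h. prob_space.normal_moments \<mu> (\<lambda>x. (synth n \<phi> x - synth n \<phi> m) \<bullet> h) (h \<bullet> lift_op n \<phi> C h)"
proof -
  let ?N = "\<Pi>\<^sub>M i\<in>{..<n}. normal_law 0 1"
  obtain L where C: "\<And>i k. i < n \<Longrightarrow> k < n \<Longrightarrow> C i k = (\<Sum>l<n. (\<Sum>a<n. L i a * L l a) * gram \<phi> l k)"
    and \<mu>: "\<mu> = distr ?N (\<Pi>\<^sub>M i\<in>{..<n}. borel) (\<lambda>\<xi>. \<lambda>i\<in>{..<n}. m i + (\<Sum>a<n. L i a * \<xi> a))"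
    using g unfolding is_gaussian_G_def by blast
  define \<Lambda> where "\<Lambda> a = synth n \<phi> (\<lambda>i. L i a)" for a
  have \<phi>proj: "\<phi> l \<bullet> synth n \<phi> (proj_coeffs n \<phi> h) = \<phi> l \<bullet> h" if "l < n" for l h
  proof -
    have "\<phi> l \<in> V" using that by (auto intro: span_base)
    from synth_proj_coeffs_residual[OF this, of h] show ?thesis
      by (simp add: inner_diff_left inner_commute[of "\<phi> l"])
  qed
  have row: "(\<Sum>k<n. C i k * b k) = (\<Sum>a<n. L i a * (\<Lambda> a \<bullet> synth n \<phi> b))" if "i < n" for i b
  proof -
    have "(\<Sum>k<n. C i k * b k) = (\<Sum>k<n. \<Sum>l<n. \<Sum>a<n. L i a * L l a * gram \<phi> l k * b k)"
      using that by (simp add: C sum_distrib_right)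
    also have "\<dots> = (\<Sum>l<n. \<Sum>a<n. L i a * L l a * (\<Sum>k<n. gram \<phi> l k * b k))"
      by (subst sum.swap, rule sum.cong, rule refl, subst sum.swap) (simp add: sum_distrib_left mult.assoc)
    also have "\<dots> = (\<Sum>a<n. \<Sum>l<n. L i a * L l a * (\<phi> l \<bullet> synth n \<phi> b))"
      unfolding gram_sum by (rule sum.swap)
    also have "\<dots> = (\<Sum>a<n. L i a * (\<Lambda> a \<bullet> synth n \<phi> b))"
      unfolding \<Lambda>_def synth_def[of n \<phi> "\<lambda>i. L i _"] inner_sum_left
      by (simp add: sum_distrib_left mult.assoc)
    finally show ?thesis .
  qed
  have CH: "lift_op n \<phi> C h = (\<Sum>a<n. (\<Lambda> a \<bullet> h) *\<^sub>R \<Lambda> a)" for h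
  proof -
    have "lift_op n \<phi> C h = (\<Sum>i<n. \<Sum>a<n. (\<Lambda> a \<bullet> h) *\<^sub>R L i a *\<^sub>R \<phi> i)"
      unfolding lift_op_eq
    proof (rule sum.cong[OF refl])
      fix i assume i: "i \<in> {..<n}"
      have "\<Lambda> a \<bullet> synth n \<phi> (proj_coeffs n \<phi> h) = \<Lambda> a \<bullet> h" for a
        unfolding \<Lambda>_def by (rule synth_inner_proj)
      then show "(\<Sum>k<n. C i k * proj_coeffs n \<phi> h k) *\<^sub>R \<phi> i = (\<Sum>a<n. (\<Lambda> a \<bullet> h) *\<^sub>R L i a *\<^sub>R \<phi> i)"
        using i by (simp add: row scaleR_sum_left mult.commute)
    qed
    also have "\<dots> = (\<Sum>a<n. (\<Lambda> a \<bullet> h) *\<^sub>R \<Lambda> a)"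
      by (subst sum.swap) (simp add: \<Lambda>_def synth_def scaleR_sum_right)
    finally show ?thesis .
  qed
  have tr: "(\<Sum>i<n. C i i) = (\<Sum>a<n. (norm (\<Lambda> a))\<^sup>2)"
  proof -
    have "C i i = (\<Sum>a<n. L i a * (\<Lambda> a \<bullet> \<phi> i))" if i: "i < n" for i
    proof -
      have "synth n \<phi> (\<lambda>k. of_bool (k = i)) = (\<Sum>k<n. if k = i then \<phi> i else 0)"
        unfolding synth_def by (intro sum.cong) auto
      then have "synth n \<phi> (\<lambda>k. of_bool (k = i)) = \<phi> i" using i by simp
      moreover have "(\<Sum>k<n. C i k * of_bool (k = i)) = (\<Sum>k<n. if k = i then C i i else 0)"
        by (intro sum.cong) auto
      ultimately show ?thesis using row[OF i, of "\<lambda>k. of_bool (k = i)"] i by simp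
    qed
    then have "(\<Sum>i<n. C i i) = (\<Sum>a<n. \<Sum>i<n. L i a * (\<Lambda> a \<bullet> \<phi> i))"
      by (subst sum.swap) simp
    also have "\<dots> = (\<Sum>a<n. \<Lambda> a \<bullet> (\<Sum>i<n. L i a *\<^sub>R \<phi> i))" by (simp add: inner_sum_right)
    also have "\<dots> = (\<Sum>a<n. (norm (\<Lambda> a))\<^sup>2)"
      by (simp add: power2_norm_eq_inner \<Lambda>_def synth_def[of n \<phi> "\<lambda>i. L i _", symmetric])
    finally show ?thesis .
  qed
  note N = std_normal_product[OF n]
  interpret N: prob_space ?N by (rule N(1))
  have meas: "(\<lambda>\<xi>. \<lambda>i\<in>{..<n}. m i + (\<Sum>a<n. L i a * \<xi> a)) \<in> measurable ?N (\<Pi>\<^sub>M i\<in>{..<n}. borel)"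
    unfolding measurable_cong_sets[OF N(2) refl]
    by (intro measurable_restrict borel_measurable_add borel_measurable_sum borel_measurable_times
        borel_measurable_const measurable_component_singleton) auto
  have nm: "prob_space.normal_moments \<mu> (\<lambda>x. (synth n \<phi> x - synth n \<phi> m) \<bullet> h) (h \<bullet> lift_op n \<phi> C h)" for h
    unfolding \<mu> normal_moments_distr_iff[OF N(1) meas inner_lift_gaussian_measurable]
  proof -
    have "N.normal_moments (\<lambda>\<xi>. \<Sum>a<n. (\<Lambda> a \<bullet> h) * \<xi> a) (\<Sum>a<n. (\<Lambda> a \<bullet> h)\<^sup>2 * 1)"
    proof (rule N.normal_moments_sum)
      show "N.indep_vars (\<lambda>_. borel) (\<lambda>a \<xi>. (\<Lambda> a \<bullet> h) * \<xi> a) {..<n}"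
        by (rule N.indep_vars_compose2[OF N(3)]) simp
      show "N.normal_moments (\<lambda>\<xi>. (\<Lambda> a \<bullet> h) * \<xi> a) ((\<Lambda> a \<bullet> h)\<^sup>2 * 1)" if "a \<in> {..<n}" for a
        using N(4) that by (intro N.normal_moments_mult) auto
    qed simp
    moreover have "(\<Sum>a<n. (\<Lambda> a \<bullet> h)\<^sup>2 * 1) = h \<bullet> lift_op n \<phi> C h"
      unfolding CH by (simp add: inner_sum_right power2_eq_square inner_commute)
    moreover have "(synth n \<phi> (\<lambda>i\<in>{..<n}. m i + (\<Sum>a<n. L i a * \<xi> a)) - synth n \<phi> m) \<bullet> h
        = (\<Sum>a<n. (\<Lambda> a \<bullet> h) * \<xi> a)" for \<xi>
    proof -
      have "synth n \<phi> (\<lambda>i\<in>{..<n}. m i + (\<Sum>a<n. L i a * \<xi> a)) - synth n \<phi> m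
          = synth n \<phi> (\<lambda>i. \<Sum>a<n. L i a * \<xi> a)"
        unfolding synth_minus by (rule synth_cong) simp
      also have "\<dots> = (\<Sum>a<n. \<xi> a *\<^sub>R \<Lambda> a)"
        unfolding \<Lambda>_def synth_def scaleR_sum_left scaleR_sum_right
        by (subst sum.swap) (simp add: mult.commute)
      finally show ?thesis by (simp add: inner_sum_left mult.commute)
    qed
    ultimately show "N.normal_moments
       (\<lambda>\<xi>. (synth n \<phi> (\<lambda>i\<in>{..<n}. m i + (\<Sum>a<n. L i a * \<xi> a)) - synth n \<phi> m) \<bullet> h)
       (h \<bullet> lift_op n \<phi> C h)" by simp
  qed
  have "\<Lambda> a \<in> V" for a unfolding \<Lambda>_def by (rule synth_in_V)
  then show ?thesis using that[of \<Lambda>] CH tr nm by blast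
qed

text \<open>Strictness matters because the weights in \<open>product_second_moment\<close> divide by
  the variances.\<close>

lemma lift_op_pos:
  assumes C: "pos_def_covariance_G n (gram \<phi>) C" and v: "v \<in> V" "v \<noteq> 0"
  shows "0 < v \<bullet> lift_op n \<phi> C v"
proof -
  let ?a = "proj_coeffs n \<phi> v"
  have "v = (\<Sum>l<n. (v \<bullet> dual_basis l) *\<^sub>R \<phi> l)" using v(1) by (rule dual_expansion)
  also have "\<dots> = synth n \<phi> ?a" unfolding synth_def by (intro sum.cong) (auto simp: proj_coeffs_eq)
  finally have va: "v = synth n \<phi> ?a" .
  have "?a \<in> Rn n" by (simp add: proj_coeffs_eq Rn_def)
  moreover have "\<exists>i<n. ?a i \<noteq> 0"
  proof (rule ccontr)
    assume "\<not> ?thesis"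
    then have "synth n \<phi> ?a = 0" by (auto simp: synth_def intro!: sum.neutral)
    then show False using va v(2) by simp
  qed
  ultimately have "0 < inner_G n (gram \<phi>) ?a (mat_vec n C ?a)"
    using C unfolding pos_def_covariance_G_def by blast
  then show ?thesis unfolding inner_gram lift_op_synth[symmetric] va[symmetric] .
qed

lemma orthonormal_V:
  obtains E where "orthonormal_family E" "span E = V"
proof -
  obtain E where E: "finite E" "span E = V" "pairwise orthogonal E"
    "\<And>e. e \<in> E \<Longrightarrow> norm e = 1"
    using finite_span_orthonormal_basis[of "\<phi> ` {..<n}"] by auto
  then have "orthonormal_family E" by unfold_locales
  then show ?thesis using that E by blast
qed

end

text \<open>The bound on each entry is a product in \<open>e\<close> and \<open>g\<close>, so the
  double sum factors into two traces.\<close>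

lemma (in prob_space) double_sum_second_moment:
  fixes f :: "'e \<Rightarrow> 'g \<Rightarrow> 'a \<Rightarrow> real"
  assumes int: "\<And>e g. e \<in> E \<Longrightarrow> g \<in> G \<Longrightarrow> integrable M (\<lambda>\<omega>. (f e g \<omega>)\<^sup>2)"
    and le: "\<And>e g. e \<in> E \<Longrightarrow> g \<in> G \<Longrightarrow> expectation (\<lambda>\<omega>. (f e g \<omega>)\<^sup>2) \<le> 72 * \<alpha> e * \<beta> g / J"
  shows "integrable M (\<lambda>\<omega>. \<Sum>e\<in>E. \<Sum>g\<in>G. (f e g \<omega>)\<^sup>2)"
    "expectation (\<lambda>\<omega>. \<Sum>e\<in>E. \<Sum>g\<in>G. (f e g \<omega>)\<^sup>2) \<le> 72 * (\<Sum>e\<in>E. \<alpha> e) * (\<Sum>g\<in>G. \<beta> g) / J"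
proof -
  show "integrable M (\<lambda>\<omega>. \<Sum>e\<in>E. \<Sum>g\<in>G. (f e g \<omega>)\<^sup>2)"
    by (intro Bochner_Integration.integrable_sum int)
  have "expectation (\<lambda>\<omega>. \<Sum>e\<in>E. \<Sum>g\<in>G. (f e g \<omega>)\<^sup>2)
      = (\<Sum>e\<in>E. \<Sum>g\<in>G. expectation (\<lambda>\<omega>. (f e g \<omega>)\<^sup>2))"
    by (subst Bochner_Integration.integral_sum, intro Bochner_Integration.integrable_sum int, assumption+)
       (intro sum.cong refl Bochner_Integration.integral_sum int)
  also have "\<dots> \<le> (\<Sum>e\<in>E. \<Sum>g\<in>G. 72 * \<alpha> e * \<beta> g / J)" by (intro sum_mono le)
  also have "\<dots> = 72 * (\<Sum>e\<in>E. \<alpha> e) * (\<Sum>g\<in>G. \<beta> g) / J"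
    by (simp only: mult.assoc sum_product) (simp add: sum_distrib_left sum_divide_distrib)
  finally show "expectation (\<lambda>\<omega>. \<Sum>e\<in>E. \<Sum>g\<in>G. (f e g \<omega>)\<^sup>2) \<le> 72 * (\<Sum>e\<in>E. \<alpha> e) * (\<Sum>g\<in>G. \<beta> g) / J" .
qed

text \<open>The orthonormal basis \<open>E\<close> of the discretization space is a parameter, so
  that all Hilbert-Schmidt sums below refer to the same one.\<close>

locale enkf_setting = discretization n \<phi> + noise_covariance \<Gamma> \<gamma> + O: prob_space \<Omega>
  for n and \<phi> :: "nat \<Rightarrow> 'h::real_inner" and \<Gamma> :: "real^'d^'d" and \<gamma> and \<Omega> :: "'w measure" +
  fixes m :: "nat \<Rightarrow> real" and C :: "nat \<Rightarrow> nat \<Rightarrow> real" and J :: nat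
    and u :: "nat \<Rightarrow> 'w \<Rightarrow> nat \<Rightarrow> real" and \<eta> :: "nat \<Rightarrow> 'w \<Rightarrow> real^'d"
    and E :: "'h set"
  assumes n: "1 \<le> n" and J: "2 \<le> J"
    and C: "pos_def_covariance_G n (gram \<phi>) C"
    and sample: "enkf_sample \<Omega> n (gram \<phi>) m C \<Gamma> J u \<eta>"
    and E: "orthonormal_family E" "span E = span (\<phi> ` {..<n})"
begin

definition "CH = lift_op n \<phi> C"
definition "U \<omega> j = synth n \<phi> (u j \<omega>)"
text \<open>Variances in the basis directions; over an orthonormal basis they sum to the traces of
  the two covariances.\<close>

definition "\<alpha> e = e \<bullet> CH e" for e
definition "\<beta> w = w \<bullet> (\<Gamma> *v w)" for w

lemma u_indep: "O.indep_vars (\<lambda>j. \<Pi>\<^sub>M i\<in>{..<n}. borel) u {..<J}"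
  and u_gauss: "j < J \<Longrightarrow> is_gaussian_G n (gram \<phi>) (distr \<Omega> (\<Pi>\<^sub>M i\<in>{..<n}. borel) (u j)) m C"
  and \<eta>_indep: "O.indep_vars (\<lambda>j. borel) \<eta> {..<J}"
  and \<eta>_gauss: "j < J \<Longrightarrow> is_gaussian (distr \<Omega> borel (\<eta> j)) 0 ((*v) \<Gamma>)"
  and joint: "O.indep_set
       (sets (vimage_algebra (space \<Omega>) (\<lambda>\<omega>. \<lambda>j\<in>{..<J}. u j \<omega>) (\<Pi>\<^sub>M j\<in>{..<J}. \<Pi>\<^sub>M i\<in>{..<n}. borel)))
       (sets (vimage_algebra (space \<Omega>) (\<lambda>\<omega>. \<lambda>j\<in>{..<J}. \<eta> j \<omega>) (\<Pi>\<^sub>M j\<in>{..<J}. borel)))"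
  using sample unfolding enkf_sample_def by blast+

lemma u_measurable: "j < J \<Longrightarrow> u j \<in> measurable \<Omega> (\<Pi>\<^sub>M i\<in>{..<n}. borel)"
  and \<eta>_measurable: "j < J \<Longrightarrow> \<eta> j \<in> borel_measurable \<Omega>"
  using u_indep \<eta>_indep unfolding O.indep_vars_def2 by simp_all

lemma J_pos: "0 < J" using J by simp

lemma obtain_factor:
  obtains \<Lambda> where "\<And>a. \<Lambda> a \<in> V" "\<And>h. CH h = (\<Sum>a<n. (\<Lambda> a \<bullet> h) *\<^sub>R \<Lambda> a)"
    "(\<Sum>i<n. C i i) = (\<Sum>a<n. (norm (\<Lambda> a))\<^sup>2)"
  by (rule gaussian_G_factor[OF u_gauss[OF J_pos] n]) (rule that, simp_all add: CH_def)

lemma CH_sym: "CH x \<bullet> y = x \<bullet> CH y"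
proof -
  obtain \<Lambda> where "\<And>h. CH h = (\<Sum>a<n. (\<Lambda> a \<bullet> h) *\<^sub>R \<Lambda> a)" using obtain_factor by metis
  then show ?thesis by (simp add: inner_sum_left inner_sum_right inner_commute mult.commute)
qed

lemma CH_in_V: "CH x \<in> span E"
  unfolding E(2) CH_def lift_op_def by (rule synth_in_V)

lemma CH_lin: "bounded_linear CH" unfolding CH_def by (rule bounded_linear_lift_op)

sublocale CH: bounded_linear CH by (rule CH_lin)

lemma \<alpha>_pos: "e \<in> E \<Longrightarrow> 0 < \<alpha> e"
proof -
  assume e: "e \<in> E"
  then have "e \<in> V" using E(2) span_base by blast
  moreover have "e \<noteq> 0" using orthonormal_family.norm1[OF E(1) e] by auto
  ultimately show ?thesis unfolding \<alpha>_def CH_def by (rule lift_op_pos[OF C])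
qed

lemma \<beta>_pos: "b \<in> Basis \<Longrightarrow> 0 < \<beta> b"
  using \<gamma>_bound[of b] \<gamma>_pos by (simp add: \<beta>_def)

text \<open>Bessel's inequality for each vector \<open>\<Lambda> a\<close> of the
  factorisation.\<close>

lemma \<alpha>_sum: "(\<Sum>e\<in>E. \<alpha> e) \<le> (\<Sum>i<n. C i i)"
proof -
  obtain \<Lambda> where \<Lambda>: "\<And>h. CH h = (\<Sum>a<n. (\<Lambda> a \<bullet> h) *\<^sub>R \<Lambda> a)"
    "(\<Sum>i<n. C i i) = (\<Sum>a<n. (norm (\<Lambda> a))\<^sup>2)" using obtain_factor by metis
  have "(\<Sum>e\<in>E. \<alpha> e) = (\<Sum>a<n. \<Sum>e\<in>E. (e \<bullet> \<Lambda> a)\<^sup>2)"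
    unfolding \<alpha>_def \<Lambda>(1) inner_sum_right inner_scaleR_right
    by (subst sum.swap) (simp add: power2_eq_square inner_commute)
  also have "\<dots> \<le> (\<Sum>a<n. (norm (\<Lambda> a))\<^sup>2)"
    by (intro sum_mono orthonormal_family.bessel E)
  finally show ?thesis by (simp add: \<Lambda>(2))
qed

lemma u_moments:
  assumes "j < J"
  shows "O.normal_moments (\<lambda>\<omega>. (synth n \<phi> (u j \<omega>) - synth n \<phi> m) \<bullet> h) (h \<bullet> CH h)"
proof -
  have "prob_space.normal_moments (distr \<Omega> (\<Pi>\<^sub>M i\<in>{..<n}. borel) (u j))
      (\<lambda>x. (synth n \<phi> x - synth n \<phi> m) \<bullet> h) (h \<bullet> CH h)"
    using gaussian_G_factor[OF u_gauss[OF assms] n] unfolding CH_def by metis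
  then show ?thesis
    unfolding normal_moments_distr_iff[OF O.prob_space_axioms u_measurable[OF assms] inner_lift_gaussian_measurable] .
qed

lemma \<eta>_moments:
  assumes j: "j < J"
  shows "O.normal_moments (\<lambda>\<omega>. w \<bullet> \<eta> j \<omega>) (w \<bullet> (\<Gamma> *v w))"
proof (rule O.normal_moments_distr)
  note [measurable] = \<eta>_measurable[OF j]
  show "O.random_variable borel (\<lambda>\<omega>. w \<bullet> \<eta> j \<omega>)" by measurable
  have "distr (distr \<Omega> borel (\<eta> j)) borel (\<lambda>x. w \<bullet> x) = normal_law (w \<bullet> 0) (w \<bullet> (\<Gamma> *v w))"
    using \<eta>_gauss[OF j] unfolding is_gaussian_def by blast
  then show "distr \<Omega> borel (\<lambda>\<omega>. w \<bullet> \<eta> j \<omega>) = normal_law 0 (w \<bullet> (\<Gamma> *v w))"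
    by (subst (asm) distr_distr) (auto simp: comp_def)
  have "0 \<le> \<gamma> * (norm w)\<^sup>2" using \<gamma>_pos by simp
  then show "0 \<le> w \<bullet> (\<Gamma> *v w)" using \<gamma>_bound[of w] by linarith
qed

lemma scalar_cov_U:
  "scalar_cov J (\<lambda>j. (synth n \<phi> (u j \<omega>) - synth n \<phi> m) \<bullet> e) y = scalar_cov J (\<lambda>j. e \<bullet> U \<omega> j) y"
  using scalar_cov_shift[OF J_pos, of "\<lambda>j. e \<bullet> U \<omega> j" "e \<bullet> synth n \<phi> m" y 0]
  by (simp add: U_def inner_diff_right inner_commute[of _ e])

text \<open>Squared Hilbert-Schmidt norms: their means are sums of entrywise second moments, and the
  pathwise bounds take square roots. \<open>errX\<close> records the spurious correlation of
  ensemble and noise, whose true covariance is zero.\<close>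

definition "errU \<omega> = (\<Sum>e\<in>E. \<Sum>f\<in>E. (e \<bullet> (sample_cov J (U \<omega>) (U \<omega>) f - CH f))\<^sup>2)"
definition "errN \<omega> = (\<Sum>e\<in>Basis. \<Sum>f\<in>Basis. (e \<bullet> (sample_cov J (\<lambda>j. \<eta> j \<omega>) (\<lambda>j. \<eta> j \<omega>) f - \<Gamma> *v f))\<^sup>2)"
definition "errX \<omega> = (\<Sum>e\<in>E. \<Sum>f\<in>Basis. (e \<bullet> sample_cov J (U \<omega>) (\<lambda>j. \<eta> j \<omega>) f)\<^sup>2)"

lemma errU_moment:
  "integrable \<Omega> errU" "O.expectation errU \<le> 72 * (\<Sum>e\<in>E. \<alpha> e) * (\<Sum>e\<in>E. \<alpha> e) / real J"
proof -
  let ?p = "\<lambda>e x. (synth n \<phi> x - synth n \<phi> m) \<bullet> e"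
  have eq: "e \<bullet> (sample_cov J (U \<omega>) (U \<omega>) f - CH f)
      = scalar_cov J (\<lambda>j. ?p e (u j \<omega>)) (\<lambda>j. ?p f (u j \<omega>)) - e \<bullet> CH f" for e f \<omega>
    unfolding inner_diff_right inner_sample_cov scalar_cov_U
    by (subst (2) scalar_cov_commute, subst scalar_cov_U, subst scalar_cov_commute) simp
  have b: "integrable \<Omega> (\<lambda>\<omega>. (e \<bullet> (sample_cov J (U \<omega>) (U \<omega>) f - CH f))\<^sup>2)"
    "O.expectation (\<lambda>\<omega>. (e \<bullet> (sample_cov J (U \<omega>) (U \<omega>) f - CH f))\<^sup>2) \<le> 72 * \<alpha> e * \<alpha> f / real J"
    if ef: "e \<in> E" "f \<in> E" for e f
  proof -
    \<comment> \<open>The variance in direction \<open>e + f\<close>; by polarisation it identifies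
      \<open>e \<bullet> CH f\<close> as the covariance of the two coordinates.\<close>
    have var: "(e + f) \<bullet> CH (e + f) = \<alpha> e + \<alpha> f + 2 * (e \<bullet> CH f)"
      using CH_sym[of e f] by (simp add: \<alpha>_def CH.add inner_add_left inner_add_right inner_commute)
    have pq: "O.normal_moments (\<lambda>\<omega>. ?p e (u j \<omega>) + ?p f (u j \<omega>)) (\<alpha> e + \<alpha> f + 2 * (e \<bullet> CH f))" if "j < J" for j
      using u_moments[OF that, of "e + f"] unfolding var by (simp add: inner_add_right)
    note c = O.sample_cov_error_same[where p = "?p e" and q = "?p f" and X = u and \<kappa> = "e \<bullet> CH f",
        OF J \<alpha>_pos[OF ef(1)] \<alpha>_pos[OF ef(2)] u_indep
          inner_lift_gaussian_measurable inner_lift_gaussian_measurable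
          u_moments[folded \<alpha>_def] u_moments[folded \<alpha>_def] pq]
    show "integrable \<Omega> (\<lambda>\<omega>. (e \<bullet> (sample_cov J (U \<omega>) (U \<omega>) f - CH f))\<^sup>2)"
      unfolding eq by (rule c(1))
    show "O.expectation (\<lambda>\<omega>. (e \<bullet> (sample_cov J (U \<omega>) (U \<omega>) f - CH f))\<^sup>2) \<le> 72 * \<alpha> e * \<alpha> f / real J"
      unfolding eq by (rule c(2))
  qed
  show "integrable \<Omega> errU" "O.expectation errU \<le> 72 * (\<Sum>e\<in>E. \<alpha> e) * (\<Sum>e\<in>E. \<alpha> e) / real J"
    unfolding errU_def[abs_def] by (rule O.double_sum_second_moment[OF b]; assumption)+
qed

lemma errN_moment:
  "integrable \<Omega> errN" "O.expectation errN \<le> 72 * (\<Sum>b\<in>Basis. \<beta> b) * (\<Sum>b\<in>Basis. \<beta> b) / real J"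
proof -
  have eq: "e \<bullet> (sample_cov J (\<lambda>j. \<eta> j \<omega>) (\<lambda>j. \<eta> j \<omega>) f - \<Gamma> *v f)
      = scalar_cov J (\<lambda>j. e \<bullet> \<eta> j \<omega>) (\<lambda>j. f \<bullet> \<eta> j \<omega>) - e \<bullet> (\<Gamma> *v f)" for e f \<omega>
    unfolding inner_diff_right inner_sample_cov by simp
  have b: "integrable \<Omega> (\<lambda>\<omega>. (e \<bullet> (sample_cov J (\<lambda>j. \<eta> j \<omega>) (\<lambda>j. \<eta> j \<omega>) f - \<Gamma> *v f))\<^sup>2)"
    "O.expectation (\<lambda>\<omega>. (e \<bullet> (sample_cov J (\<lambda>j. \<eta> j \<omega>) (\<lambda>j. \<eta> j \<omega>) f - \<Gamma> *v f))\<^sup>2) \<le> 72 * \<beta> e * \<beta> f / real J"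
    if ef: "e \<in> Basis" "f \<in> Basis" for e f :: "real^'d"
  proof -
    have "(\<Gamma> *v e) \<bullet> f = e \<bullet> (\<Gamma> *v f)" by (metis sym dot_lmul_matrix vector_transpose_matrix)
    then have var: "(e + f) \<bullet> (\<Gamma> *v (e + f)) = \<beta> e + \<beta> f + 2 * (e \<bullet> (\<Gamma> *v f))"
      by (simp add: \<beta>_def matrix_vector_right_distrib inner_add_left inner_add_right inner_commute)
    have pq: "O.normal_moments (\<lambda>\<omega>. e \<bullet> \<eta> j \<omega> + f \<bullet> \<eta> j \<omega>) (\<beta> e + \<beta> f + 2 * (e \<bullet> (\<Gamma> *v f)))" if "j < J" for j
      using \<eta>_moments[OF that, of "e + f"] unfolding var by (simp add: inner_add_left)
    have meas: "(\<lambda>x. w \<bullet> x) \<in> borel_measurable borel" for w :: "real^'d" by measurable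
    note c = O.sample_cov_error_same[where p = "\<lambda>x. e \<bullet> x" and q = "\<lambda>x. f \<bullet> x" and X = \<eta> and \<kappa> = "e \<bullet> (\<Gamma> *v f)",
        OF J \<beta>_pos[OF ef(1)] \<beta>_pos[OF ef(2)] \<eta>_indep meas meas \<eta>_moments[folded \<beta>_def] \<eta>_moments[folded \<beta>_def] pq]
    show "integrable \<Omega> (\<lambda>\<omega>. (e \<bullet> (sample_cov J (\<lambda>j. \<eta> j \<omega>) (\<lambda>j. \<eta> j \<omega>) f - \<Gamma> *v f))\<^sup>2)"
      unfolding eq by (rule c(1))
    show "O.expectation (\<lambda>\<omega>. (e \<bullet> (sample_cov J (\<lambda>j. \<eta> j \<omega>) (\<lambda>j. \<eta> j \<omega>) f - \<Gamma> *v f))\<^sup>2) \<le> 72 * \<beta> e * \<beta> f / real J"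
      unfolding eq by (rule c(2))
  qed
  show "integrable \<Omega> errN" "O.expectation errN \<le> 72 * (\<Sum>b\<in>Basis. \<beta> b) * (\<Sum>b\<in>Basis. \<beta> b) / real J"
    unfolding errN_def[abs_def] by (rule O.double_sum_second_moment[OF b]; assumption)+
qed

lemma errX_moment:
  "integrable \<Omega> errX" "O.expectation errX \<le> 72 * (\<Sum>e\<in>E. \<alpha> e) * (\<Sum>b\<in>Basis. \<beta> b) / real J"
proof -
  let ?p = "\<lambda>e x. (synth n \<phi> x - synth n \<phi> m) \<bullet> e"
  have eq: "e \<bullet> sample_cov J (U \<omega>) (\<lambda>j. \<eta> j \<omega>) f
      = scalar_cov J (\<lambda>j. ?p e (u j \<omega>)) (\<lambda>j. f \<bullet> \<eta> j \<omega>)" for e f \<omega>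
    unfolding inner_sample_cov scalar_cov_U by simp
  have b: "integrable \<Omega> (\<lambda>\<omega>. (e \<bullet> sample_cov J (U \<omega>) (\<lambda>j. \<eta> j \<omega>) f)\<^sup>2)"
    "O.expectation (\<lambda>\<omega>. (e \<bullet> sample_cov J (U \<omega>) (\<lambda>j. \<eta> j \<omega>) f)\<^sup>2) \<le> 72 * \<alpha> e * \<beta> f / real J"
    if ef: "e \<in> E" "f \<in> Basis" for e f
  proof -
    have meas: "(\<lambda>x. w \<bullet> x) \<in> borel_measurable borel" for w :: "real^'d" by measurable
    note c = O.sample_cov_error_cross[where p = "?p e" and q = "\<lambda>x. f \<bullet> x" and X = u and Y = \<eta>,
        OF J \<alpha>_pos[OF ef(1)] \<beta>_pos[OF ef(2)] u_indep \<eta>_indep joint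
          inner_lift_gaussian_measurable meas u_moments[folded \<alpha>_def] \<eta>_moments[folded \<beta>_def]]
    show "integrable \<Omega> (\<lambda>\<omega>. (e \<bullet> sample_cov J (U \<omega>) (\<lambda>j. \<eta> j \<omega>) f)\<^sup>2)"
      unfolding eq by (rule c(1))
    show "O.expectation (\<lambda>\<omega>. (e \<bullet> sample_cov J (U \<omega>) (\<lambda>j. \<eta> j \<omega>) f)\<^sup>2) \<le> 72 * \<alpha> e * \<beta> f / real J"
      unfolding eq by (rule c(2))
  qed
  show "integrable \<Omega> errX" "O.expectation errX \<le> 72 * (\<Sum>e\<in>E. \<alpha> e) * (\<Sum>b\<in>Basis. \<beta> b) / real J"
    unfolding errX_def[abs_def] by (rule O.double_sum_second_moment[OF b]; assumption)+
qed

lemma U_in_V: "U \<omega> j \<in> span E"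
  unfolding E(2) U_def by (rule synth_in_V)

text \<open>Valid on the whole space: both operators are symmetric with range in \<open>V\<close>,
  so every row of their difference is a vector of \<open>V\<close>.\<close>

lemma errU_bound: "norm (sample_cov J (U \<omega>) (U \<omega>) h - CH h) \<le> sqrt (errU \<omega>) * norm h"
  unfolding errU_def
proof (rule hilbert_schmidt_bound[OF E(1) E(1)])
  note s = sample_cov_hilbert_schmidt[OF E(1) E(1), of J "U \<omega>" "U \<omega>", OF U_in_V U_in_V]
  show "sample_cov J (U \<omega>) (U \<omega>) h - CH h \<in> span E" by (intro span_diff CH_in_V s(1))
  fix e assume "e \<in> E"
  obtain t where t: "t \<in> span E" "\<And>w. e \<bullet> sample_cov J (U \<omega>) (U \<omega>) w = t \<bullet> w" using s(2) by blast
  show "\<exists>t\<in>span E. \<forall>w. e \<bullet> (sample_cov J (U \<omega>) (U \<omega>) w - CH w) = t \<bullet> w"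
    by (rule bexI[of _ "t - CH e"]) (auto simp: inner_diff_right inner_diff_left t CH_sym intro: span_diff CH_in_V)
qed

lemma errN_bound: "norm (sample_cov J (\<lambda>j. \<eta> j \<omega>) (\<lambda>j. \<eta> j \<omega>) w - \<Gamma> *v w) \<le> sqrt (errN \<omega>) * norm w"
  unfolding errN_def
proof (rule hilbert_schmidt_bound[OF orthonormal_family_Basis orthonormal_family_Basis])
  have "e \<bullet> (sample_cov J (\<lambda>j. \<eta> j \<omega>) (\<lambda>j. \<eta> j \<omega>) w - \<Gamma> *v w)
      = (sample_cov J (\<lambda>j. \<eta> j \<omega>) (\<lambda>j. \<eta> j \<omega>) e - \<Gamma> *v e) \<bullet> w" for e w
  proof -
    have "(\<Gamma> *v e) \<bullet> w = e \<bullet> (\<Gamma> *v w)" by (metis sym dot_lmul_matrix vector_transpose_matrix)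
    then show ?thesis by (simp add: inner_diff_left inner_diff_right sample_cov_adjoint)
  qed
  then show "\<exists>t\<in>span Basis. \<forall>w. e \<bullet> (sample_cov J (\<lambda>j. \<eta> j \<omega>) (\<lambda>j. \<eta> j \<omega>) w - \<Gamma> *v w) = t \<bullet> w" for e
    by auto
qed simp

lemma errX_bound: "norm (sample_cov J (U \<omega>) (\<lambda>j. \<eta> j \<omega>) w) \<le> sqrt (errX \<omega>) * norm w"
  unfolding errX_def
proof (rule hilbert_schmidt_bound[OF E(1) orthonormal_family_Basis])
  have "\<eta> j \<omega> \<in> span Basis" for j by simp
  note s = sample_cov_hilbert_schmidt[OF E(1) orthonormal_family_Basis, of J "U \<omega>" "\<lambda>j. \<eta> j \<omega>", OF U_in_V this]
  show "sample_cov J (U \<omega>) (\<lambda>j. \<eta> j \<omega>) w \<in> span E" by (rule s(1))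
  show "\<exists>t\<in>span Basis. \<forall>w. e \<bullet> sample_cov J (U \<omega>) (\<lambda>j. \<eta> j \<omega>) w = t \<bullet> w" for e by (rule s(2))
qed

lemma errX_bound': "norm (sample_cov J (\<lambda>j. \<eta> j \<omega>) (U \<omega>) h) \<le> sqrt (errX \<omega>) * norm h"
proof (rule norm_adjoint_le[of "sample_cov J (U \<omega>) (\<lambda>j. \<eta> j \<omega>)"])
  show "0 \<le> sqrt (errX \<omega>)" by (simp add: errX_def sum_nonneg)
qed (rule sample_cov_adjoint, rule errX_bound)

end

section \<open>Measurability of the error\<close>

lemma borel_measurable_det:
  fixes A :: "'w \<Rightarrow> real^'d^'d"
  assumes "\<And>a b. (\<lambda>\<omega>. A \<omega> $ a $ b) \<in> borel_measurable M"
  shows "(\<lambda>\<omega>. det (A \<omega>)) \<in> borel_measurable M"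
  unfolding det_def
  by (intro borel_measurable_sum borel_measurable_times borel_measurable_const borel_measurable_prod assms)

text \<open>Cramer's rule gives each component as a quotient of determinants, which are polynomials
  in the entries.\<close>

lemma borel_measurable_matrix_inv_mult:
  fixes S :: "'w \<Rightarrow> real^'d^'d"
  assumes inv: "\<And>\<omega>. invertible (S \<omega>)"
    and S: "\<And>a b. (\<lambda>\<omega>. S \<omega> $ a $ b) \<in> borel_measurable M"
    and w: "\<And>a. (\<lambda>\<omega>. w \<omega> $ a) \<in> borel_measurable M"
  shows "(\<lambda>\<omega>. (matrix_inv (S \<omega>) *v w \<omega>) $ k) \<in> borel_measurable M"
proof -
  have eq: "(matrix_inv (S \<omega>) *v w \<omega>) $ k
      = det (\<chi> i j. if j = k then w \<omega> $ i else S \<omega> $ i $ j) / det (S \<omega>)" for \<omega>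
  proof -
    have "S \<omega> *v (matrix_inv (S \<omega>) *v w \<omega>) = w \<omega>"
      using inv by (simp add: matrix_vector_mul_assoc matrix_inv_mult(1))
    then have "matrix_inv (S \<omega>) *v w \<omega> = (\<chi> k. det (\<chi> i j. if j = k then w \<omega> $ i else S \<omega> $ i $ j) / det (S \<omega>))"
      using cramer[of "S \<omega>"] inv[of \<omega>] invertible_det_nz[of "S \<omega>"] by blast
    then show ?thesis by simp
  qed
  have num: "(\<lambda>\<omega>. det (\<chi> i j. if j = k then w \<omega> $ i else S \<omega> $ i $ j)) \<in> borel_measurable M"
  proof (rule borel_measurable_det)
    show "(\<lambda>\<omega>. (\<chi> i j. if j = k then w \<omega> $ i else S \<omega> $ i $ j) $ a $ b) \<in> borel_measurable M" for a b
      using S[of a b] w[of a] by (cases "b = k") simp_all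
  qed
  show ?thesis unfolding eq by (rule borel_measurable_divide[OF num borel_measurable_det[OF S]])
qed

text \<open>Sublevel sets are countable intersections: at a level \<open>a\<close> that is not
  negative, \<open>norm (T \<omega> x) \<le> a * norm x\<close> is a closed condition on
  \<open>x\<close>, so it suffices to test it on a countable dense set.\<close>

lemma borel_measurable_onorm:
  fixes T :: "'w \<Rightarrow> 'a::{real_normed_vector, second_countable_topology} \<Rightarrow> 'b::real_normed_vector"
  assumes lin: "\<And>\<omega>. bounded_linear (T \<omega>)"
    and meas: "\<And>h. (\<lambda>\<omega>. norm (T \<omega> h)) \<in> borel_measurable M"
  shows "(\<lambda>\<omega>. onorm (T \<omega>)) \<in> borel_measurable M"
proof -
  obtain D :: "'a set" where D: "countable D" "\<And>X. open X \<Longrightarrow> X \<noteq> {} \<Longrightarrow> \<exists>d\<in>D. d \<in> X"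
    using countable_dense_setE by blast
  have cl: "closure D = UNIV"
  proof (rule ccontr)
    assume "closure D \<noteq> UNIV"
    then have "\<exists>d\<in>D. d \<in> - closure D" by (intro D(2)) auto
    then show False using closure_subset[of D] by blast
  qed
  have iff: "onorm (T \<omega>) \<le> a \<longleftrightarrow> 0 \<le> a \<and> (\<forall>x\<in>D. norm (T \<omega> x) \<le> a * norm x)" for \<omega> a
  proof
    assume a: "onorm (T \<omega>) \<le> a"
    have "norm (T \<omega> x) \<le> a * norm x" for x
      using onorm[OF lin, of \<omega> x] mult_right_mono[OF a, of "norm x"] by simp
    then show "0 \<le> a \<and> (\<forall>x\<in>D. norm (T \<omega> x) \<le> a * norm x)"
      using a onorm_pos_le[OF lin, of \<omega>] by auto
  next
    assume a: "0 \<le> a \<and> (\<forall>x\<in>D. norm (T \<omega> x) \<le> a * norm x)"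
    have "closed {x. norm (T \<omega> x) \<le> a * norm x}"
      using lin[of \<omega>] by (intro closed_Collect_le continuous_intros linear_continuous_on)
    then have "closure D \<subseteq> {x. norm (T \<omega> x) \<le> a * norm x}"
      using a by (intro closure_minimal) auto
    then show "onorm (T \<omega>) \<le> a" using a cl by (intro onorm_bound) auto
  qed
  show ?thesis unfolding borel_measurable_iff_le
  proof
    fix a :: real
    show "{\<omega> \<in> space M. onorm (T \<omega>) \<le> a} \<in> sets M"
    proof (cases "0 \<le> a")
      case True
      have "{\<omega> \<in> space M. \<forall>x\<in>D. norm (T \<omega> x) \<le> a * norm x} \<in> sets M"
      proof -
        have "D \<noteq> {}" using cl by auto
        then have "{\<omega> \<in> space M. \<forall>x\<in>D. norm (T \<omega> x) \<le> a * norm x}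
            = (\<Inter>x\<in>D. {\<omega> \<in> space M. norm (T \<omega> x) \<le> a * norm x})" by auto
        also have "\<dots> \<in> sets M"
          using D(1) \<open>D \<noteq> {}\<close> borel_measurable_le[OF meas borel_measurable_const]
          by (intro sets.countable_INT') auto
        finally show ?thesis .
      qed
      then show ?thesis using True by (simp add: iff)
    qed (simp add: iff)
  qed
qed

lemma borel_measurable_ens_cov:
  assumes v: "\<And>j i. j < J \<Longrightarrow> i < n \<Longrightarrow> (\<lambda>\<omega>. v \<omega> j i) \<in> borel_measurable M" and i: "i < n"
  shows "(\<lambda>\<omega>. ens_cov n G J (v \<omega>) i k) \<in> borel_measurable M"
  unfolding ens_cov_def ens_mean_def
  by (intro borel_measurable_divide borel_measurable_sum borel_measurable_times borel_measurable_diff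
      borel_measurable_const v i) auto

lemma borel_measurable_mat_vec:
  assumes "\<And>k. k < n \<Longrightarrow> (\<lambda>\<omega>. A \<omega> i k) \<in> borel_measurable M"
    and "\<And>k. k < n \<Longrightarrow> (\<lambda>\<omega>. x \<omega> k) \<in> borel_measurable M" and "i < n"
  shows "(\<lambda>\<omega>. mat_vec n (A \<omega>) (x \<omega>) i :: real) \<in> borel_measurable M"
proof -
  have "(\<lambda>\<omega>. \<Sum>k<n. A \<omega> i k * x \<omega> k) \<in> borel_measurable M"
    using assms by (intro borel_measurable_sum borel_measurable_times) auto
  then show ?thesis using assms(3) by (simp add: mat_vec_def)
qed

lemma borel_measurable_obs:
  assumes "\<And>k. k < n \<Longrightarrow> (\<lambda>\<omega>. x \<omega> k) \<in> borel_measurable M"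
  shows "(\<lambda>\<omega>. obs n F (x \<omega>) $ a) \<in> borel_measurable M"
  unfolding obs_def sum_component vector_scaleR_component real_scaleR_def
  by (intro borel_measurable_sum borel_measurable_times borel_measurable_const assms) auto

lemma borel_measurable_obs_adj:
  fixes w :: "'w \<Rightarrow> real^'d"
  assumes w: "\<And>a. (\<lambda>\<omega>. w \<omega> $ a) \<in> borel_measurable M" and "i < n"
  shows "(\<lambda>\<omega>. obs_adj n G F (w \<omega>) i) \<in> borel_measurable M"
  unfolding obs_adj_def
proof (rule borel_measurable_mat_vec)
  fix k assume "k < n"
  moreover have "(\<lambda>\<omega>. F k \<bullet> w \<omega>) \<in> borel_measurable M"
    unfolding inner_vec_def inner_real_def
    by (intro borel_measurable_sum borel_measurable_times borel_measurable_const w)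
  ultimately show "(\<lambda>\<omega>. (\<lambda>k\<in>{..<n}. F k \<bullet> w \<omega>) k) \<in> borel_measurable M" by simp
qed (use assms in auto)

section \<open>Measurability of the ensemble posterior covariance\<close>

context enkf_setting
begin

lemma u_component_measurable: "j < J \<Longrightarrow> i < n \<Longrightarrow> (\<lambda>\<omega>. u j \<omega> i) \<in> borel_measurable \<Omega>"
  using measurable_compose[OF u_measurable measurable_component_singleton[of i "{..<n}" "\<lambda>_. borel"]] by simp

lemma enkf_post_cov_measurable:
  assumes i: "i < n"
  shows "(\<lambda>\<omega>. enkf_post_cov n (gram \<phi>) F \<Gamma> y J (\<lambda>j. u j \<omega>) (\<lambda>j. \<eta> j \<omega>) i k) \<in> borel_measurable \<Omega>"
  unfolding enkf_post_cov_def
proof (rule borel_measurable_ens_cov[OF _ i])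
  fix j i assume j: "j < J" and i: "i < n"
  let ?G = "gram \<phi>"
  let ?C = "\<lambda>\<omega>. ens_cov n ?G J (\<lambda>j. u j \<omega>)"
  let ?S = "\<lambda>\<omega>. matrix (\<lambda>z. obs n F (mat_vec n (?C \<omega>) (obs_adj n ?G F z))) + \<Gamma>"
  have C: "(\<lambda>\<omega>. ?C \<omega> i k) \<in> borel_measurable \<Omega>" if "i < n" for i k
    using that by (intro borel_measurable_ens_cov u_component_measurable)
  \<comment> \<open>True at every outcome, not just almost surely, because sample covariances are
    always positive operators.\<close>
  have inv: "invertible (?S \<omega>)" for \<omega>
  proof -
    interpret k: kalman \<Gamma> \<gamma> "sample_cov J (U \<omega>) (U \<omega>)" "lift_obs F" "lift_obs_adj F"
      using noise_covariance_axioms J by (intro kalman_sample_cov) auto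
    have "sample_cov J (U \<omega>) (U \<omega>) = lift_op n \<phi> (?C \<omega>)" unfolding lift_ens_cov U_def ..
    then have "obs n F (mat_vec n (?C \<omega>) (obs_adj n ?G F z)) = lift_obs F (sample_cov J (U \<omega>) (U \<omega>) (lift_obs_adj F z))" for z
      by (simp add: lift_obs_adj_def lift_op_synth lift_obs_synth)
    then show ?thesis using k.S_invertible unfolding k.S_def by simp
  qed
  have S: "(\<lambda>\<omega>. ?S \<omega> $ a $ b) \<in> borel_measurable \<Omega>" for a b
  proof -
    have "(\<lambda>\<omega>. obs n F (mat_vec n (?C \<omega>) (obs_adj n ?G F (axis b 1))) $ a + \<Gamma> $ a $ b) \<in> borel_measurable \<Omega>"
      by (intro borel_measurable_add borel_measurable_obs borel_measurable_mat_vec C borel_measurable_const)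
    then show ?thesis by (simp add: matrix_def)
  qed
  have w: "(\<lambda>\<omega>. (y - obs n F (u j \<omega>) + \<eta> j \<omega>) $ a) \<in> borel_measurable \<Omega>" for a
  proof -
    have "(\<lambda>\<omega>. \<eta> j \<omega> \<bullet> axis a 1) \<in> borel_measurable \<Omega>"
      using \<eta>_measurable[OF j] by (intro borel_measurable_inner) auto
    then have "(\<lambda>\<omega>. \<eta> j \<omega> $ a) \<in> borel_measurable \<Omega>" by (simp add: inner_axis)
    then show ?thesis unfolding vector_add_component vector_minus_component
      by (intro borel_measurable_add borel_measurable_diff borel_measurable_const borel_measurable_obs
          u_component_measurable j)
  qed
  have "(\<lambda>\<omega>. kalman_gain n ?G F \<Gamma> (?C \<omega>) (y - obs n F (u j \<omega>) + \<eta> j \<omega>) i) \<in> borel_measurable \<Omega>"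
    unfolding kalman_gain_def
    by (intro borel_measurable_mat_vec borel_measurable_obs_adj borel_measurable_matrix_inv_mult inv S w C i)
  then show "(\<lambda>\<omega>. enkf_update n ?G F \<Gamma> y J (\<lambda>j. u j \<omega>) (\<lambda>j. \<eta> j \<omega>) j i) \<in> borel_measurable \<Omega>"
    unfolding enkf_update_def using i u_component_measurable[OF j i] by simp
qed

end

text \<open>Domination by an integrable variable gives integrability only together with
  measurability; without integrability the integral would be the default value 0 and its bound would
  say nothing.\<close>

lemma enkf_cov_error_measurable:
  fixes \<phi> :: "nat \<Rightarrow> 'h::{real_inner, second_countable_topology}"
  assumes s: "enkf_setting n \<phi> \<Gamma> \<gamma> \<Omega> m C J u \<eta> E" and k: "kalman \<Gamma> \<gamma> \<C> \<F> (adjoint \<F>)"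
  shows "(\<lambda>\<omega>. enkf_cov_error \<C> \<F> \<Gamma> y n \<phi> F J (\<lambda>j. u j \<omega>) (\<lambda>j. \<eta> j \<omega>)) \<in> borel_measurable \<Omega>"
proof -
  interpret enkf_setting n \<phi> \<Gamma> \<gamma> \<Omega> m C J u \<eta> E by fact
  interpret k: kalman \<Gamma> \<gamma> \<C> \<F> "adjoint \<F>" by fact
  show ?thesis unfolding enkf_cov_error_def
  proof (rule borel_measurable_onorm)
    have "bounded_linear (posterior_cov \<C> \<F> \<Gamma>)"
      unfolding posterior_cov_eq_post[OF k, abs_def] by (rule k.post_lin)
    then show "bounded_linear (\<lambda>h. posterior_cov \<C> \<F> \<Gamma> h -
        lift_op n \<phi> (enkf_post_cov n (gram \<phi>) F \<Gamma> y J (\<lambda>j. u j \<omega>) (\<lambda>j. \<eta> j \<omega>)) h)" for \<omega>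
      by (intro bounded_linear_sub bounded_linear_lift_op)
    show "(\<lambda>\<omega>. norm (posterior_cov \<C> \<F> \<Gamma> h -
        lift_op n \<phi> (enkf_post_cov n (gram \<phi>) F \<Gamma> y J (\<lambda>j. u j \<omega>) (\<lambda>j. \<eta> j \<omega>)) h)) \<in> borel_measurable \<Omega>" for h
      unfolding lift_op_eq
      by (intro measurable_compose[OF _ borel_measurable_norm] borel_measurable_diff borel_measurable_sum borel_measurable_scaleR
          borel_measurable_times borel_measurable_const enkf_post_cov_measurable) auto
  qed
qed

section \<open>The error bound\<close>

text \<open>\<open>D\<close> is the discretization error, whose factor only needs a bounded mean.
  The rest has to decay: linear terms go through the weighted inequality \<open>amgm\<close>,
  quadratic ones are absorbed using \<open>1 \<le> s\<close>.\<close>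

lemma scaled_sum_bound:
  fixes X Y Z D s :: real
  assumes "0 \<le> D" "0 \<le> X" "0 \<le> Y" "0 \<le> Z" and s: "1 \<le> s"
  shows "D * (1 + X)\<^sup>2 + (X + Y + Z) * (1 + X)
    \<le> D * (2 + 2 * X\<^sup>2) + 3 * s * (X\<^sup>2 + Y\<^sup>2 + Z\<^sup>2) + 2 / s"
proof -
  have "(1 + X)\<^sup>2 \<le> 2 + 2 * X\<^sup>2"
    using zero_le_power2[of "1 - X"] by (simp add: power2_eq_square algebra_simps)
  then have 1: "D * (1 + X)\<^sup>2 \<le> D * (2 + 2 * X\<^sup>2)" by (rule mult_left_mono) fact
  have amgm: "2 * t \<le> s * t\<^sup>2 + 1 / s" for t
  proof -
    have "0 \<le> (s * t - 1)\<^sup>2 / s" using s by simp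
    also have "\<dots> = s * t\<^sup>2 - 2 * t + 1 / s"
      using s by (simp add: power2_eq_square field_simps)
    finally show ?thesis by simp
  qed
  have sq: "t\<^sup>2 \<le> s * t\<^sup>2" for t :: real using mult_right_mono[OF s, of "t\<^sup>2"] by simp
  have xy: "2 * (X * Y) \<le> X\<^sup>2 + Y\<^sup>2" "2 * (X * Z) \<le> X\<^sup>2 + Z\<^sup>2"
    using zero_le_power2[of "X - Y"] zero_le_power2[of "X - Z"] by (simp_all add: power2_eq_square algebra_simps)
  have e: "(X + Y + Z) * (1 + X) = X + Y + Z + X\<^sup>2 + X * Y + X * Z"
    by (simp add: power2_eq_square algebra_simps)
  have pos: "0 \<le> 1 / s" "0 \<le> s * Y\<^sup>2" "0 \<le> s * Z\<^sup>2" "0 \<le> s * X\<^sup>2" using s by auto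
  have d: "3 * s * (X\<^sup>2 + Y\<^sup>2 + Z\<^sup>2) = 3 * (s * X\<^sup>2) + 3 * (s * Y\<^sup>2) + 3 * (s * Z\<^sup>2)"
    "2 / s = 2 * (1 / s)" by (simp_all add: algebra_simps)
  show ?thesis unfolding e d
    using 1 amgm[of X] amgm[of Y] amgm[of Z] sq[of X] sq[of Y] sq[of Z] xy pos by linarith
qed

text \<open>\<open>B\<close> precedes all error quantities, so it cannot depend on the dimension,
  the ensemble size or the outcome. The random factors are compared with powers of
  \<open>q = 1 + X\<close>.\<close>

lemma error_terms_bound:
  fixes c f d \<gamma> \<kappa> :: real
  assumes nn: "0 \<le> c" "0 \<le> f" "0 \<le> d" "0 < \<gamma>" "0 \<le> \<kappa>"
  obtains B where "0 \<le> B" "\<And>X Y Z D1 D2 s \<kappa>'.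
    0 \<le> X \<Longrightarrow> 0 \<le> Y \<Longrightarrow> 0 \<le> Z \<Longrightarrow> 0 \<le> D1 \<Longrightarrow> 0 \<le> D2 \<Longrightarrow> 1 \<le> s \<Longrightarrow> \<kappa>' = sqrt ((c + d + X) / \<gamma>) \<Longrightarrow>
    (1 + \<kappa> * f) * ((D1 + X) * (1 + \<kappa>' * f)) + (1 + \<kappa> * f) * (c * (D2 * \<kappa>'))
      + \<kappa> * (D2 * ((1 + \<kappa>' * f) * (c + d + X)))
      + \<kappa>' * (Y * \<kappa>') + ((1 + \<kappa>' * f) * (Z * \<kappa>') + \<kappa>' * (Z * (1 + \<kappa>' * f)))
    \<le> B * ((D1 + D2) * (2 + 2 * X\<^sup>2) + 3 * s * (X\<^sup>2 + Y\<^sup>2 + Z\<^sup>2) + 2 / s)"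
proof -
  \<comment> \<open>Coefficients that turn random factors into multiples of \<open>q\<close>:
    \<open>a\<close> for the covariance bound, \<open>b\<close> for \<open>\<kappa>'\<close> and for
    its square alike, \<open>g\<close> for \<open>1 + \<kappa>' * f\<close>, and \<open>h\<close>
    for \<open>(1 + \<kappa>' * f) * \<kappa>'\<close>. The factor \<open>k\<close> is
    deterministic.\<close>
  define a where "a = 1 + c + d"
  define b where "b = 1 + a / \<gamma>"
  define g where "g = 1 + b * f"
  define h where "h = b + f * b"
  define k where "k = 1 + \<kappa> * f"
  have pos: "1 \<le> a" "1 \<le> b" "1 \<le> g" "0 \<le> h" "1 \<le> k"
    using nn by (auto simp: a_def b_def g_def h_def k_def)
  \<comment> \<open>One summand for each of the estimates \<open>t1\<close> to \<open>t5\<close>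
    below.\<close>
  define B where "B = k * g + k * c * b + \<kappa> * (g * a) + b + 2 * h"
  have B0: "0 \<le> B" unfolding B_def using nn pos by (intro add_nonneg_nonneg mult_nonneg_nonneg) auto
  show ?thesis
  proof (rule that[OF B0])
    fix X Y Z D1 D2 s \<kappa>' :: real
    assume p: "0 \<le> X" "0 \<le> Y" "0 \<le> Z" "0 \<le> D1" "0 \<le> D2" "1 \<le> s" and \<kappa>': "\<kappa>' = sqrt ((c + d + X) / \<gamma>)"
    define q where "q = 1 + X"
    define G1 where "G1 = (D1 + D2) * q\<^sup>2"
    define G2 where "G2 = (X + Y + Z) * q"
    have q: "1 \<le> q" "q \<le> q\<^sup>2" using p by (auto simp: q_def power2_eq_square algebra_simps)
    have G: "0 \<le> G1" "0 \<le> G2" using p q by (auto simp: G1_def G2_def)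
    have cq: "c + d + X \<le> a * q"
    proof -
      have "0 \<le> (c + d) * X + 1" using nn p by simp
      then show ?thesis unfolding a_def q_def by (simp add: algebra_simps)
    qed
    have \<kappa>0: "0 \<le> \<kappa>'" using nn p by (simp add: \<kappa>')
    have \<kappa>sq: "\<kappa>'\<^sup>2 = (c + d + X) / \<gamma>" using nn p by (simp add: \<kappa>')
    have ratio: "(c + d + X) / \<gamma> \<le> a / \<gamma> * q" using divide_right_mono[OF cq, of \<gamma>] nn by simp
    \<comment> \<open>The square of the gain bound is only linear in \<open>q\<close>; this keeps
      the noise and cross terms quadratic in the errors.\<close>
    have \<kappa>2: "\<kappa>' * \<kappa>' \<le> b * q"
    proof -
      have "\<kappa>' * \<kappa>' \<le> a / \<gamma> * q" using \<kappa>sq ratio by (simp add: power2_eq_square)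
      then show ?thesis using q by (simp add: b_def algebra_simps)
    qed
    have \<kappa>1: "\<kappa>' \<le> b * q"
    proof -
      have "\<kappa>' \<le> 1 + \<kappa>' * \<kappa>'" using zero_le_power2[of "\<kappa>' - 1"] \<kappa>0 by (simp add: power2_eq_square algebra_simps)
      also have "\<dots> \<le> q + a / \<gamma> * q" using \<kappa>sq ratio q by (simp add: power2_eq_square)
      finally show ?thesis by (simp add: b_def algebra_simps)
    qed
    have g1: "1 + \<kappa>' * f \<le> g * q"
      using mult_right_mono[OF \<kappa>1 nn(2)] q by (simp add: g_def algebra_simps)
    have h1: "(1 + \<kappa>' * f) * \<kappa>' \<le> h * q"
    proof -
      have "(1 + \<kappa>' * f) * \<kappa>' = \<kappa>' + f * (\<kappa>' * \<kappa>')" by (simp add: algebra_simps)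
      also have "\<dots> \<le> b * q + f * (b * q)" using \<kappa>1 mult_left_mono[OF \<kappa>2 nn(2)] by linarith
      finally show ?thesis by (simp add: h_def algebra_simps)
    qed
    have Dq: "D1 * q \<le> D1 * q\<^sup>2" "D2 * q \<le> D2 * q\<^sup>2" using q p by (auto intro!: mult_left_mono)
    have nD: "0 \<le> D1 * q\<^sup>2" "0 \<le> D2 * q\<^sup>2" "0 \<le> X * q" "0 \<le> Y * q" "0 \<le> Z * q" using p q by auto
    have G1e: "G1 = D1 * q\<^sup>2 + D2 * q\<^sup>2" and G2e: "G2 = X * q + Y * q + Z * q"
      by (simp_all add: G1_def G2_def algebra_simps)
    have S1: "(D1 + X) * q \<le> G1 + G2" "D2 * q \<le> G1 + G2" "D2 * q\<^sup>2 \<le> G1 + G2" "Y * q \<le> G1 + G2" "Z * q \<le> G1 + G2"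
      unfolding G1e G2e distrib_right using Dq nD by linarith+
    have t1: "k * ((D1 + X) * (1 + \<kappa>' * f)) \<le> k * g * (G1 + G2)"
    proof -
      have "(D1 + X) * (1 + \<kappa>' * f) \<le> (D1 + X) * (g * q)" using g1 p by (intro mult_left_mono) auto
      also have "\<dots> = g * ((D1 + X) * q)" by (simp add: algebra_simps)
      also have "\<dots> \<le> g * (G1 + G2)" using S1(1) pos by (intro mult_left_mono) auto
      finally have "k * ((D1 + X) * (1 + \<kappa>' * f)) \<le> k * (g * (G1 + G2))" using pos by (intro mult_left_mono) auto
      then show ?thesis by (simp add: mult.assoc)
    qed
    have t2: "k * (c * (D2 * \<kappa>')) \<le> k * c * b * (G1 + G2)"
    proof -
      have "D2 * \<kappa>' \<le> D2 * (b * q)" using \<kappa>1 p by (intro mult_left_mono) auto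
      also have "\<dots> = b * (D2 * q)" by (simp add: algebra_simps)
      also have "\<dots> \<le> b * (G1 + G2)" using S1(2) pos by (intro mult_left_mono) auto
      finally have "(k * c) * (D2 * \<kappa>') \<le> (k * c) * (b * (G1 + G2))" using pos nn by (intro mult_left_mono) auto
      then show ?thesis by (simp add: mult.assoc)
    qed
    have t3: "\<kappa> * (D2 * ((1 + \<kappa>' * f) * (c + d + X))) \<le> \<kappa> * (g * a) * (G1 + G2)"
    proof -
      have "(1 + \<kappa>' * f) * (c + d + X) \<le> (g * q) * (a * q)"
        using g1 cq pos q nn p by (intro mult_mono) auto
      then have "D2 * ((1 + \<kappa>' * f) * (c + d + X)) \<le> D2 * ((g * q) * (a * q))"
        using p by (intro mult_left_mono) auto
      also have "\<dots> = (g * a) * (D2 * q\<^sup>2)" by (simp add: power2_eq_square algebra_simps)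
      also have "\<dots> \<le> (g * a) * (G1 + G2)" using S1(3) pos by (intro mult_left_mono) auto
      finally have "\<kappa> * (D2 * ((1 + \<kappa>' * f) * (c + d + X))) \<le> \<kappa> * ((g * a) * (G1 + G2))"
        using nn by (intro mult_left_mono) auto
      then show ?thesis by (simp add: mult.assoc)
    qed
    have t4: "\<kappa>' * (Y * \<kappa>') \<le> b * (G1 + G2)"
    proof -
      have "\<kappa>' * (Y * \<kappa>') = Y * (\<kappa>' * \<kappa>')" by (simp add: algebra_simps)
      also have "\<dots> \<le> Y * (b * q)" using \<kappa>2 p by (intro mult_left_mono) auto
      also have "\<dots> = b * (Y * q)" by (simp add: algebra_simps)
      also have "\<dots> \<le> b * (G1 + G2)" using S1(4) pos by (intro mult_left_mono) auto
      finally show ?thesis .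
    qed
    have t5: "(1 + \<kappa>' * f) * (Z * \<kappa>') + \<kappa>' * (Z * (1 + \<kappa>' * f)) \<le> 2 * h * (G1 + G2)"
    proof -
      have "Z * ((1 + \<kappa>' * f) * \<kappa>') \<le> Z * (h * q)" using h1 p by (intro mult_left_mono) auto
      also have "\<dots> = h * (Z * q)" by (simp add: algebra_simps)
      also have "\<dots> \<le> h * (G1 + G2)" using S1(5) pos by (intro mult_left_mono) auto
      finally show ?thesis by (simp add: algebra_simps)
    qed
    have "k * ((D1 + X) * (1 + \<kappa>' * f)) + k * (c * (D2 * \<kappa>'))
      + \<kappa> * (D2 * ((1 + \<kappa>' * f) * (c + d + X)))
      + \<kappa>' * (Y * \<kappa>') + ((1 + \<kappa>' * f) * (Z * \<kappa>') + \<kappa>' * (Z * (1 + \<kappa>' * f))) \<le> B * (G1 + G2)"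
    proof -
      have "B * (G1 + G2) = k * g * (G1 + G2) + k * c * b * (G1 + G2) + \<kappa> * (g * a) * (G1 + G2)
          + b * (G1 + G2) + 2 * h * (G1 + G2)"
        unfolding B_def by (simp only: distrib_right)
      then show ?thesis using t1 t2 t3 t4 t5 by linarith
    qed
    also have "\<dots> \<le> B * ((D1 + D2) * (2 + 2 * X\<^sup>2) + 3 * s * (X\<^sup>2 + Y\<^sup>2 + Z\<^sup>2) + 2 / s)"
      unfolding G1_def G2_def q_def using p B0 by (intro mult_left_mono scaled_sum_bound) auto
    finally show "(1 + \<kappa> * f) * ((D1 + X) * (1 + \<kappa>' * f)) + (1 + \<kappa> * f) * (c * (D2 * \<kappa>'))
      + \<kappa> * (D2 * ((1 + \<kappa>' * f) * (c + d + X)))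
      + \<kappa>' * (Y * \<kappa>') + ((1 + \<kappa>' * f) * (Z * \<kappa>') + \<kappa>' * (Z * (1 + \<kappa>' * f)))
    \<le> B * ((D1 + D2) * (2 + 2 * X\<^sup>2) + 3 * s * (X\<^sup>2 + Y\<^sup>2 + Z\<^sup>2) + 2 / s)"
      unfolding k_def .
  qed
qed

section \<open>The pathwise error bound\<close>

context enkf_setting
begin

text \<open>Six terms, three from \<open>posterior_difference\<close> and three from
  \<open>lift_enkf_post_cov\<close>. The gain bound \<open>\<kappa>'\<close> belongs to the sample
  covariance and is random, while \<open>\<kappa>\<close> belongs to the continuum prior.\<close>

lemma enkf_cov_error_le:
  assumes k: "kalman \<Gamma> \<gamma> \<C> \<F> (adjoint \<F>)"
    and c: "\<And>h. norm (\<C> h) \<le> c * norm h" "0 \<le> c"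
    and f: "\<And>h. norm (\<F> h) \<le> f * norm h" "\<And>h. norm (lift_obs F h) \<le> f * norm h" "0 \<le> f"
    and D1: "\<And>h. norm (\<C> h - CH h) \<le> D1 * norm h" "0 \<le> D1" "D1 \<le> d"
    and D2: "\<And>h. norm (\<F> h - lift_obs F h) \<le> D2 * norm h" "0 \<le> D2"
  defines "\<kappa> \<equiv> sqrt (c / \<gamma>)"
  shows "\<exists>X Y Z \<kappa>'. X = sqrt (errU \<omega>) \<and> Y = sqrt (errN \<omega>) \<and> Z = sqrt (errX \<omega>) \<and>
    \<kappa>' = sqrt ((c + d + X) / \<gamma>) \<and>
    enkf_cov_error \<C> \<F> \<Gamma> y n \<phi> F J (\<lambda>j. u j \<omega>) (\<lambda>j. \<eta> j \<omega>) \<le>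
    (1 + \<kappa> * f) * ((D1 + X) * (1 + \<kappa>' * f)) + (1 + \<kappa> * f) * (c * (D2 * \<kappa>'))
      + \<kappa> * (D2 * ((1 + \<kappa>' * f) * (c + d + X)))
      + \<kappa>' * (Y * \<kappa>') + ((1 + \<kappa>' * f) * (Z * \<kappa>') + \<kappa>' * (Z * (1 + \<kappa>' * f)))"
proof -
  define X where "X = sqrt (errU \<omega>)"
  define Y where "Y = sqrt (errN \<omega>)"
  define Z where "Z = sqrt (errX \<omega>)"
  \<comment> \<open>Norm bound for the sample covariance by the triangle inequality: continuum
    prior, discretization error at most \<open>d\<close>, sampling error \<open>X\<close>.\<close>
  define c' where "c' = c + d + X"
  define \<kappa>' where "\<kappa>' = sqrt (c' / \<gamma>)"
  define W where "W = U \<omega>"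
  define C' where "C' = sample_cov J W W"
  have p: "0 \<le> X" "0 \<le> Y" "0 \<le> Z" "0 \<le> d" "0 \<le> c'" "0 \<le> \<kappa>" "0 \<le> \<kappa>'"
    using c(2) D1(2,3) \<gamma>_pos
    by (auto simp: X_def Y_def Z_def errU_def errN_def errX_def c'_def \<kappa>_def \<kappa>'_def sum_nonneg)
  interpret k: kalman \<Gamma> \<gamma> \<C> \<F> "adjoint \<F>" by fact
  have k': "kalman \<Gamma> \<gamma> C' (lift_obs F) (lift_obs_adj F)"
    unfolding C'_def using noise_covariance_axioms J by (intro kalman_sample_cov) auto
  interpret k': kalman \<Gamma> \<gamma> C' "lift_obs F" "lift_obs_adj F" by (rule k')
  have X: "norm (C' h - CH h) \<le> X * norm h" for h unfolding C'_def W_def X_def by (rule errU_bound)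
  have dC: "norm (\<C> h - C' h) \<le> (D1 + X) * norm h" for h
  proof -
    have "\<C> h - C' h = (\<C> h - CH h) - (C' h - CH h)" by simp
    then have "norm (\<C> h - C' h) \<le> norm (\<C> h - CH h) + norm (C' h - CH h)"
      using norm_triangle_ineq4[of "\<C> h - CH h" "C' h - CH h"] by simp
    then show ?thesis using D1(1)[of h] X[of h] by (simp add: distrib_right)
  qed
  have C': "norm (C' h) \<le> c' * norm h" for h
  proof -
    have "norm (C' h) \<le> norm (\<C> h) + norm (\<C> h - C' h)"
      using norm_triangle_ineq4[of "\<C> h" "\<C> h - C' h"] by simp
    moreover have "D1 * norm h \<le> d * norm h" using D1(3) by (rule mult_right_mono) simp
    ultimately show ?thesis using c(1)[of h] dC[of h] by (simp add: c'_def distrib_right)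
  qed
  \<comment> \<open>The adjoints differ by no more than the observation maps do.\<close>
  have dFs: "norm (lift_obs_adj F w - adjoint \<F> w) \<le> D2 * norm w" for w
  proof -
    have "norm (adjoint \<F> w - lift_obs_adj F w) \<le> D2 * norm w"
    proof (rule norm_adjoint_le[OF _ D2])
      show "(\<F> x - lift_obs F x) \<bullet> w = x \<bullet> (adjoint \<F> w - lift_obs_adj F w)" for x w
        by (simp add: inner_diff_left inner_diff_right k.F_adj k'.F_adj)
    qed
    then show ?thesis by (simp add: norm_minus_commute)
  qed
  note An = k.A_norm[OF c f(1,3), folded \<kappa>_def] and Kn = k.K_norm[OF c f(1,3), folded \<kappa>_def]
    and postn = k.post_norm[OF c f(1,3), folded \<kappa>_def]
  note A'n = k'.A_norm[OF C' p(5) f(2,3), folded \<kappa>'_def] and As'n = k'.As_norm[OF C' p(5) f(2,3), folded \<kappa>'_def]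
    and K'n = k'.K_norm[OF C' p(5) f(2,3), folded \<kappa>'_def] and Ks'n = k'.Ks_norm[OF C' p(5) f(2,3), folded \<kappa>'_def]
    and post'n = k'.post_norm[OF C' p(5) f(2,3), folded \<kappa>'_def]
  have a0: "0 \<le> 1 + \<kappa> * f" "0 \<le> 1 + \<kappa>' * f" using p f(3) by auto
  let ?N = "sample_cov J (\<lambda>j. \<eta> j \<omega>) (\<lambda>j. \<eta> j \<omega>)"
  let ?D = "sample_cov J W (\<lambda>j. \<eta> j \<omega>)" and ?Ds = "sample_cov J (\<lambda>j. \<eta> j \<omega>) W"
  let ?B = "(1 + \<kappa> * f) * ((D1 + X) * (1 + \<kappa>' * f)) + (1 + \<kappa> * f) * (c * (D2 * \<kappa>'))
      + \<kappa> * (D2 * ((1 + \<kappa>' * f) * c'))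
      + \<kappa>' * (Y * \<kappa>') + ((1 + \<kappa>' * f) * (Z * \<kappa>') + \<kappa>' * (Z * (1 + \<kappa>' * f)))"
  have "norm (posterior_cov \<C> \<F> \<Gamma> h - lift_op n \<phi> (enkf_post_cov n (gram \<phi>) F \<Gamma> y J (\<lambda>j. u j \<omega>) (\<lambda>j. \<eta> j \<omega>)) h)
      \<le> ?B * norm h" for h
  proof -
    let ?K = "k'.Ks h" and ?A = "k'.As h" and ?P = "k'.post h"
    define t1 where "t1 = k.A (\<C> ?A - C' ?A)"
    define t2 where "t2 = k.post (lift_obs_adj F ?K - adjoint \<F> ?K)"
    define t3 where "t3 = k.K (\<F> ?P - lift_obs F ?P)"
    define t4 where "t4 = k'.K (?N ?K - \<Gamma> *v ?K)"
    define t5 where "t5 = k'.A (?D ?K)"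
    define t6 where "t6 = k'.K (?Ds ?A)"
    have "lift_op n \<phi> (enkf_post_cov n (gram \<phi>) F \<Gamma> y J (\<lambda>j. u j \<omega>) (\<lambda>j. \<eta> j \<omega>)) h = ?P + t4 + (t5 + t6)"
      using lift_enkf_post_cov[where J = J and u = "\<lambda>j. u j \<omega>" and F = F and y = y
          and \<eta> = "\<lambda>j. \<eta> j \<omega>" and h = h, OF noise_covariance_axioms] J
      unfolding t4_def t5_def t6_def C'_def W_def U_def by simp
    moreover have "posterior_cov \<C> \<F> \<Gamma> h - ?P = t1 + t2 - t3"
      unfolding posterior_cov_eq_post[OF k] t1_def t2_def t3_def by (rule posterior_difference[OF k k'])
    ultimately have eq: "posterior_cov \<C> \<F> \<Gamma> h
        - lift_op n \<phi> (enkf_post_cov n (gram \<phi>) F \<Gamma> y J (\<lambda>j. u j \<omega>) (\<lambda>j. \<eta> j \<omega>)) h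
        = t1 + t2 - t3 - t4 - (t5 + t6)" by (simp add: algebra_simps)
    have "norm (t1 + t2 - t3 - t4 - (t5 + t6))
        \<le> norm t1 + norm t2 + norm t3 + norm t4 + (norm t5 + norm t6)"
      using norm_triangle_ineq4[of "t1 + t2 - t3 - t4" "t5 + t6"] norm_triangle_ineq4[of "t1 + t2 - t3" t4]
        norm_triangle_ineq4[of "t1 + t2" t3] norm_triangle_ineq[of t1 t2] norm_triangle_ineq[of t5 t6] by linarith
    also have "norm t1 \<le> (1 + \<kappa> * f) * ((D1 + X) * ((1 + \<kappa>' * f) * norm h))"
      unfolding t1_def using a0 p D1(2)
      by (intro order_trans[OF An] mult_left_mono order_trans[OF dC] As'n) auto
    also have "norm t2 \<le> (1 + \<kappa> * f) * (c * (D2 * (\<kappa>' * norm h)))"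
      unfolding t2_def using a0 c(2) D2(2)
      by (intro order_trans[OF postn] mult_left_mono order_trans[OF dFs] Ks'n) auto
    also have "norm t3 \<le> \<kappa> * (D2 * ((1 + \<kappa>' * f) * (c' * norm h)))"
      unfolding t3_def using p D2(2)
      by (intro order_trans[OF Kn] mult_left_mono order_trans[OF D2(1)] post'n) auto
    also have "norm t4 \<le> \<kappa>' * (Y * (\<kappa>' * norm h))"
      unfolding t4_def using p unfolding Y_def
      by (intro order_trans[OF K'n] mult_left_mono order_trans[OF errN_bound] Ks'n) auto
    also have "norm t5 \<le> (1 + \<kappa>' * f) * (Z * (\<kappa>' * norm h))"
      unfolding t5_def W_def using a0 p unfolding Z_def
      by (intro order_trans[OF A'n] mult_left_mono order_trans[OF errX_bound] Ks'n) auto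
    also have "norm t6 \<le> \<kappa>' * (Z * ((1 + \<kappa>' * f) * norm h))"
      unfolding t6_def W_def using p unfolding Z_def
      by (intro order_trans[OF K'n] mult_left_mono order_trans[OF errX_bound'] As'n) auto
    finally show ?thesis unfolding eq by (simp only: distrib_right mult.assoc)
  qed
  moreover have "0 \<le> ?B"
    using p a0 c(2) f(3) D1(2) D2(2) by (intro add_nonneg_nonneg mult_nonneg_nonneg) auto
  ultimately have "enkf_cov_error \<C> \<F> \<Gamma> y n \<phi> F J (\<lambda>j. u j \<omega>) (\<lambda>j. \<eta> j \<omega>) \<le> ?B"
    unfolding enkf_cov_error_def by (intro onorm_bound)
  then show ?thesis unfolding c'_def X_def Y_def Z_def \<kappa>'_def by blast
qed

end

section \<open>Uniform traces and integration of the pathwise bound\<close>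

text \<open>Positivity lets an effective dimension be multiplied back into a trace; the upper bound
  transfers because \<open>synth\<close> carries the weighted norm to the Hilbert space
  norm.\<close>

lemma (in discretization) opnorm_G_bounds:
  assumes A: "pos_def_covariance_G n (gram \<phi>) A" and n: "1 \<le> n"
    and K: "\<And>h. norm (lift_op n \<phi> A h) \<le> K * norm h"
  shows "0 < opnorm_G n (gram \<phi>) A" "opnorm_G n (gram \<phi>) A \<le> K"
proof -
  let ?X = "{x \<in> Rn n. \<exists>i<n. x i \<noteq> 0}"
  let ?r = "\<lambda>x. norm_G n (gram \<phi>) (mat_vec n A x) / norm_G n (gram \<phi>) x"
  have r: "0 < ?r x \<and> ?r x \<le> K" if "x \<in> ?X" for x
  proof -
    have "0 < inner_G n (gram \<phi>) x (mat_vec n A x)"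
      using A that unfolding pos_def_covariance_G_def by blast
    then have pos: "0 < synth n \<phi> x \<bullet> lift_op n \<phi> A (synth n \<phi> x)"
      by (simp add: inner_gram lift_op_synth)
    then have "synth n \<phi> x \<noteq> 0" "lift_op n \<phi> A (synth n \<phi> x) \<noteq> 0" by auto
    then show ?thesis using K[of "synth n \<phi> x"]
      by (simp add: norm_gram lift_op_synth[symmetric] divide_le_eq)
  qed
  have one: "(\<lambda>i\<in>{..<n}. 1) \<in> ?X" using n by (auto simp: Rn_def intro!: exI[of _ 0])
  have bdd: "bdd_above (?r ` ?X)" using r by (intro bdd_aboveI2) blast
  have "0 < ?r (\<lambda>i\<in>{..<n}. 1)" using r[OF one] by blast
  also have "\<dots> \<le> opnorm_G n (gram \<phi>) A"
    unfolding opnorm_G_def using one bdd by (rule cSUP_upper)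
  finally show "0 < opnorm_G n (gram \<phi>) A" .
  show "opnorm_G n (gram \<phi>) A \<le> K"
    unfolding opnorm_G_def using one r by (intro cSUP_least) blast+
qed

text \<open>The final constants must serve every dimension, while the effective dimension is
  controlled only for large ones; the finitely many others are absorbed into
  \<open>\<tau>\<close>.\<close>

lemma eventually_bounded_imp_bounded:
  fixes t :: "nat \<Rightarrow> real"
  assumes "\<forall>\<^sub>F n in sequentially. t n \<le> K"
  obtains \<tau> where "0 \<le> \<tau>" "\<And>n. t n \<le> \<tau>"
proof -
  obtain N where N: "\<And>n. N \<le> n \<Longrightarrow> t n \<le> K" using assms by (auto simp: eventually_sequentially)
  define \<tau> where "\<tau> = \<bar>K\<bar> + (\<Sum>n<N. \<bar>t n\<bar>)"
  have nn: "0 \<le> (\<Sum>n<N. \<bar>t n\<bar>)" by (rule sum_nonneg) simp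
  have "t n \<le> \<tau>" for n
  proof (cases "N \<le> n")
    case True then show ?thesis using N[OF True] nn unfolding \<tau>_def by linarith
  next
    case False
    then have "\<bar>t n\<bar> \<le> (\<Sum>n<N. \<bar>t n\<bar>)" by (intro member_le_sum) auto
    then show ?thesis unfolding \<tau>_def by linarith
  qed
  then show ?thesis using that[of \<tau>] nn by (simp add: \<tau>_def)
qed

text \<open>Second moments of order \<open>1 / J\<close> against the weight \<open>sqrt J\<close>
  give the rate. The numbers 144 and 216 are 2 and 3 times the 72 of the entrywise estimate.\<close>

lemma (in enkf_setting) integrable_error_bound:
  fixes err :: "'w \<Rightarrow> real"
  assumes meas: "err \<in> borel_measurable \<Omega>" and nonneg: "\<And>\<omega>. 0 \<le> err \<omega>"
    and le: "\<And>\<omega>. err \<omega> \<le> B * (D * (2 + 2 * errU \<omega>)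
      + 3 * sqrt (real J) * (errU \<omega> + errN \<omega> + errX \<omega>) + 2 / sqrt (real J))"
    and B: "0 \<le> B" and D: "0 \<le> D"
    and \<tau>: "(\<Sum>i<n. C i i) \<le> \<tau>"
  defines "b \<equiv> \<Sum>w\<in>Basis. \<beta> w"
  shows "integrable \<Omega> err"
    "O.expectation err \<le> B * (D * (2 + 144 * \<tau>\<^sup>2) + (216 * (\<tau>\<^sup>2 + b\<^sup>2 + \<tau> * b) + 2) * (1 / sqrt (real J)))"
proof -
  let ?s = "sqrt (real J)" and ?a = "\<Sum>e\<in>E. \<alpha> e"
  let ?R = "\<lambda>\<omega>. B * (D * (2 + 2 * errU \<omega>) + 3 * ?s * (errU \<omega> + errN \<omega> + errX \<omega>) + 2 / ?s)"
  have J1: "1 \<le> real J" "0 < real J" using J by auto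
  have s: "0 < ?s" "?s * ?s = real J" using J1 by auto
  have iR: "integrable \<Omega> ?R" using errU_moment(1) errN_moment(1) errX_moment(1) by auto
  show i: "integrable \<Omega> err"
    by (rule Bochner_Integration.integrable_bound[OF iR meas])
       (use le nonneg in \<open>auto intro!: AE_I2 intro: order_trans[OF _ abs_ge_self]\<close>)
  have a: "0 \<le> ?a" "?a \<le> \<tau>" using \<alpha>_pos \<alpha>_sum \<tau> by (auto intro!: sum_nonneg intro: less_imp_le)
  have b: "0 \<le> b" unfolding b_def using \<beta>_pos by (auto intro!: sum_nonneg intro: less_imp_le)
  have eU: "O.expectation errU \<le> 72 * \<tau>\<^sup>2 / real J"
  proof -
    have "?a * ?a \<le> \<tau> * \<tau>" using a by (intro mult_mono) auto
    then have "72 * ?a * ?a / real J \<le> 72 * \<tau>\<^sup>2 / real J"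
      using J1 by (intro divide_right_mono) (auto simp: power2_eq_square)
    then show ?thesis using errU_moment(2) by linarith
  qed
  have eN: "O.expectation errN \<le> 72 * b\<^sup>2 / real J"
    using errN_moment(2) by (simp add: b_def power2_eq_square mult.assoc)
  have eX: "O.expectation errX \<le> 72 * (\<tau> * b) / real J"
  proof -
    have "?a * b \<le> \<tau> * b" using a b by (intro mult_right_mono) auto
    then have "72 * ?a * b / real J \<le> 72 * (\<tau> * b) / real J" using J1 by (intro divide_right_mono) auto
    then show ?thesis using errX_moment(2) unfolding b_def by linarith
  qed
  \<comment> \<open>The factor of \<open>D\<close> needs no decay, just a bound free of
    \<open>J\<close>.\<close>
  have eU': "O.expectation errU \<le> 72 * \<tau>\<^sup>2"
  proof -
    have "72 * \<tau>\<^sup>2 / real J \<le> 72 * \<tau>\<^sup>2 / 1" using J1 by (intro divide_left_mono) auto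
    then show ?thesis using eU by simp
  qed
  have "O.expectation err \<le> O.expectation ?R" using i iR le by (rule integral_mono)
  also have "O.expectation ?R = B * (D * (2 + 2 * O.expectation errU)
      + 3 * ?s * (O.expectation errU + O.expectation errN + O.expectation errX) + 2 / ?s)"
    using errU_moment(1) errN_moment(1) errX_moment(1) by (simp add: O.prob_space)
  also have "\<dots> \<le> B * (D * (2 + 2 * (72 * \<tau>\<^sup>2))
      + 3 * ?s * (72 * \<tau>\<^sup>2 / real J + 72 * b\<^sup>2 / real J + 72 * (\<tau> * b) / real J) + 2 / ?s)"
    using B D s(1) eU eN eX eU' by (intro mult_left_mono add_mono) auto
  also have "\<dots> = B * (D * (2 + 144 * \<tau>\<^sup>2) + (216 * (\<tau>\<^sup>2 + b\<^sup>2 + \<tau> * b) + 2) * (1 / ?s))"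
  proof -
    have "?s / real J = 1 / ?s" using s by (metis mult.right_neutral nonzero_divide_mult_cancel_left less_irrefl)
    moreover have "3 * ?s * (72 * \<tau>\<^sup>2 / real J + 72 * b\<^sup>2 / real J + 72 * (\<tau> * b) / real J)
        = 216 * (\<tau>\<^sup>2 + b\<^sup>2 + \<tau> * b) * (?s / real J)"
      by (simp add: divide_inverse algebra_simps)
    ultimately have "3 * ?s * (72 * \<tau>\<^sup>2 / real J + 72 * b\<^sup>2 / real J + 72 * (\<tau> * b) / real J)
        = 216 * (\<tau>\<^sup>2 + b\<^sup>2 + \<tau> * b) * (1 / ?s)" by simp
    then show ?thesis by (simp add: algebra_simps)
  qed
  finally show "O.expectation err \<le> B * (D * (2 + 144 * \<tau>\<^sup>2) + (216 * (\<tau>\<^sup>2 + b\<^sup>2 + \<tau> * b) + 2) * (1 / ?s))" .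
qed

section \<open>Uniform constants and the error estimate\<close>

theorem theorem4p2:
  fixes prior :: "'h::{real_inner, polish_space} measure"
    and m\<^sub>0 :: 'h
    and \<C>\<^sub>0 :: "'h \<Rightarrow> 'h"
    and \<F> :: "'h \<Rightarrow> real^'d"
    and \<Gamma> :: "real^'d^'d"
    and y :: "real^'d"
    and \<phi> :: "nat \<Rightarrow> nat \<Rightarrow> 'h"
    and F :: "nat \<Rightarrow> nat \<Rightarrow> real^'d"
    and C\<^sub>0 :: "nat \<Rightarrow> nat \<Rightarrow> nat \<Rightarrow> real"
    and \<iota> :: "'k::{real_inner, complete_space} \<Rightarrow> 'h"
    and \<psi>\<^sub>1 \<psi>\<^sub>2 \<psi>\<^sub>3 :: "nat \<Rightarrow> real"
    and r\<^sub>1 r\<^sub>2 r\<^sub>3 c :: real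
  assumes infinite_dim: "\<not> (\<exists>B::'h set. finite B \<and> span B = UNIV)"
    and prior: "is_gaussian prior m\<^sub>0 \<C>\<^sub>0"
    and cov: "trace_class_covariance \<C>\<^sub>0"
    and mean: "m\<^sub>0 \<in> range (op_sqrt \<C>\<^sub>0)"
    and forward: "bounded_linear \<F>"
    and noise_sym: "transpose \<Gamma> = \<Gamma>"
    and noise_pos: "\<And>w. w \<noteq> 0 \<Longrightarrow> 0 < w \<bullet> (\<Gamma> *v w)"
    and basis: "\<And>n. 1 \<le> n \<Longrightarrow> inj_on (\<phi> n) {..<n} \<and> independent (\<phi> n ` {..<n})"
    and disc_cov: "\<And>n. 1 \<le> n \<Longrightarrow> pos_def_covariance_G n (gram (\<phi> n)) (C\<^sub>0 n)"
    and psi1: "\<psi>\<^sub>1 \<longlonglongrightarrow> 0"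
    and cov_err: "\<And>n. 1 \<le> n \<Longrightarrow>
        onorm (\<lambda>h. \<C>\<^sub>0 h - lift_op n (\<phi> n) (C\<^sub>0 n) h) \<le> r\<^sub>1 * \<psi>\<^sub>1 n"
    and psi2: "\<psi>\<^sub>2 \<longlonglongrightarrow> 0"
    and forward_err: "\<And>n. 1 \<le> n \<Longrightarrow>
        onorm (\<lambda>h. \<F> h - obs n (F n) (proj_coeffs n (\<phi> n) h)) \<le> r\<^sub>2 * \<psi>\<^sub>2 n"
    and embed: "bounded_linear \<iota>" "inj \<iota>"
    and psi3: "\<psi>\<^sub>3 \<longlonglongrightarrow> 0"
    and proj_err: "\<And>n u. 1 \<le> n \<Longrightarrow>
        norm (\<iota> u - synth n (\<phi> n) (proj_coeffs n (\<phi> n) (\<iota> u))) \<le> r\<^sub>3 * \<psi>\<^sub>3 n * norm u"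
    and eff_dim: "\<forall>\<^sub>F n in sequentially.
        effective_dim_G n (gram (\<phi> n)) (C\<^sub>0 n) \<le> c * effective_dim \<C>\<^sub>0"
  shows "\<exists>r\<^sub>1' r\<^sub>2' r\<^sub>3'. \<forall>n J. 1 \<le> n \<longrightarrow> 2 \<le> J \<longrightarrow>
      effective_dim_G n (gram (\<phi> n)) (C\<^sub>0 n) \<le> real J \<longrightarrow>
      (\<forall>(\<Omega> :: 'w measure) u \<eta>.
        enkf_sample \<Omega> n (gram (\<phi> n)) (proj_coeffs n (\<phi> n) m\<^sub>0) (C\<^sub>0 n) \<Gamma> J u \<eta> \<longrightarrow>
        integrable \<Omega> (\<lambda>\<omega>. enkf_cov_error \<C>\<^sub>0 \<F> \<Gamma> y n (\<phi> n) (F n) J (\<lambda>j. u j \<omega>) (\<lambda>j. \<eta> j \<omega>)) \<and>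
        (\<integral>\<omega>. enkf_cov_error \<C>\<^sub>0 \<F> \<Gamma> y n (\<phi> n) (F n) J (\<lambda>j. u j \<omega>) (\<lambda>j. \<eta> j \<omega>) \<partial>\<Omega>)
          \<le> r\<^sub>1' * \<psi>\<^sub>1 n + r\<^sub>2' * \<psi>\<^sub>2 n + r\<^sub>3' * (1 / sqrt (real J)))"
proof -
  obtain \<gamma> where \<gamma>: "0 < \<gamma>" "\<And>w. \<gamma> * (norm w)\<^sup>2 \<le> w \<bullet> (\<Gamma> *v w)"
    using pos_def_lower_bound[OF noise_pos] by blast
  have noise: "noise_covariance \<Gamma> \<gamma>" by unfold_locales (use noise_sym \<gamma> in auto)
  have C0: "bounded_linear \<C>\<^sub>0" "self_adjoint \<C>\<^sub>0" "positive_op \<C>\<^sub>0"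
    using cov by (auto simp: trace_class_covariance_def)
  have k: "kalman \<Gamma> \<gamma> \<C>\<^sub>0 \<F> (adjoint \<F>)"
    by (intro kalman.intro noise kalman_axioms.intro C0 forward adjoint_bounded_linear_works)
  interpret k: kalman \<Gamma> \<gamma> \<C>\<^sub>0 \<F> "adjoint \<F>" by (rule k)
  have disc: "discretization n (\<phi> n)" if "1 \<le> n" for n
    using basis[OF that] by unfold_locales auto
  \<comment> \<open>Convergent sequences are bounded, so a single \<open>d\<close> dominates both
    discretization errors in all dimensions.\<close>
  obtain d where d: "0 \<le> d" "\<And>n. r\<^sub>1 * \<psi>\<^sub>1 n \<le> d" "\<And>n. r\<^sub>2 * \<psi>\<^sub>2 n \<le> d"
  proof -
    have "Bseq (\<lambda>n. r\<^sub>1 * \<psi>\<^sub>1 n)" "Bseq (\<lambda>n. r\<^sub>2 * \<psi>\<^sub>2 n)"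
      using tendsto_mult_left[OF psi1, of r\<^sub>1] tendsto_mult_left[OF psi2, of r\<^sub>2]
      by (auto intro!: convergent_imp_Bseq convergentI)
    then obtain d1 d2 where "0 < d1" "\<And>n. norm (r\<^sub>1 * \<psi>\<^sub>1 n) \<le> d1" "0 < d2" "\<And>n. norm (r\<^sub>2 * \<psi>\<^sub>2 n) \<le> d2"
      unfolding Bseq_def by metis
    then show ?thesis using that[of "max d1 d2"] by (auto simp: le_max_iff_disj) (meson abs_le_D1 le_max_iff_disj)+
  qed
  define cc where "cc = onorm \<C>\<^sub>0"
  define f where "f = onorm \<F> + d"
  have cc: "0 \<le> cc" "\<And>h. norm (\<C>\<^sub>0 h) \<le> cc * norm h"
    using onorm_pos_le[OF C0(1)] onorm[OF C0(1)] by (auto simp: cc_def)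
  have f: "0 \<le> f" "\<And>h. norm (\<F> h) \<le> onorm \<F> * norm h"
    using onorm_pos_le[OF forward] onorm[OF forward] d(1) by (auto simp: f_def)
  \<comment> \<open>The signs of the constant and of the rate function are free; that their product
    is nonnegative follows from the norm it bounds.\<close>
  have D1: "norm (\<C>\<^sub>0 h - lift_op n (\<phi> n) (C\<^sub>0 n) h) \<le> r\<^sub>1 * \<psi>\<^sub>1 n * norm h" "0 \<le> r\<^sub>1 * \<psi>\<^sub>1 n" if n: "1 \<le> n" for n h
  proof -
    interpret discretization n "\<phi> n" using n by (rule disc)
    have bl: "bounded_linear (\<lambda>h. \<C>\<^sub>0 h - lift_op n (\<phi> n) (C\<^sub>0 n) h)"
      by (intro bounded_linear_sub C0 bounded_linear_lift_op)
    show "norm (\<C>\<^sub>0 h - lift_op n (\<phi> n) (C\<^sub>0 n) h) \<le> r\<^sub>1 * \<psi>\<^sub>1 n * norm h"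
      using onorm[OF bl, of h] mult_right_mono[OF cov_err[OF n], of "norm h"] by simp
    show "0 \<le> r\<^sub>1 * \<psi>\<^sub>1 n" using onorm_pos_le[OF bl] cov_err[OF n] by linarith
  qed
  have D2: "norm (\<F> h - discretization.lift_obs n (\<phi> n) (F n) h) \<le> r\<^sub>2 * \<psi>\<^sub>2 n * norm h" "0 \<le> r\<^sub>2 * \<psi>\<^sub>2 n" if n: "1 \<le> n" for n h
  proof -
    interpret discretization n "\<phi> n" using n by (rule disc)
    have bl: "bounded_linear (\<lambda>h. \<F> h - lift_obs (F n) h)"
      by (intro bounded_linear_sub forward bounded_linear_lift_obs)
    have le: "onorm (\<lambda>h. \<F> h - lift_obs (F n) h) \<le> r\<^sub>2 * \<psi>\<^sub>2 n"
      using forward_err[OF n] by (simp add: lift_obs_def)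
    show "norm (\<F> h - lift_obs (F n) h) \<le> r\<^sub>2 * \<psi>\<^sub>2 n * norm h"
      using onorm[OF bl, of h] mult_right_mono[OF le, of "norm h"] by simp
    show "0 \<le> r\<^sub>2 * \<psi>\<^sub>2 n" using onorm_pos_le[OF bl] le by linarith
  qed
  have lift_le: "norm (lift_op n (\<phi> n) (C\<^sub>0 n) h) \<le> (cc + d) * norm h" if "1 \<le> n" for n h
  proof -
    have "norm (lift_op n (\<phi> n) (C\<^sub>0 n) h) \<le> norm (\<C>\<^sub>0 h) + norm (\<C>\<^sub>0 h - lift_op n (\<phi> n) (C\<^sub>0 n) h)"
      using norm_triangle_ineq4[of "\<C>\<^sub>0 h" "\<C>\<^sub>0 h - lift_op n (\<phi> n) (C\<^sub>0 n) h"] by simp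
    then show ?thesis using cc(2)[of h] D1(1)[OF that, of h] mult_right_mono[OF d(2), of "norm h" n]
      by (simp add: distrib_right)
  qed
  have obs_le: "norm (discretization.lift_obs n (\<phi> n) (F n) h) \<le> f * norm h" if "1 \<le> n" for n h
  proof -
    have "norm (discretization.lift_obs n (\<phi> n) (F n) h) \<le> norm (\<F> h) + norm (\<F> h - discretization.lift_obs n (\<phi> n) (F n) h)"
      using norm_triangle_ineq4[of "\<F> h" "\<F> h - discretization.lift_obs n (\<phi> n) (F n) h"] by simp
    then show ?thesis using f(2)[of h] D2(1)[OF that, of h] mult_right_mono[OF d(3), of "norm h" n]
      by (simp add: distrib_right f_def)
  qed
  have f': "norm (\<F> h) \<le> f * norm h" for h
    using f(2)[of h] mult_nonneg_nonneg[OF d(1) norm_ge_zero[of h]] by (simp add: f_def distrib_right)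
  have "\<forall>\<^sub>F n in sequentially. (\<Sum>i<n. C\<^sub>0 n i i) \<le> \<bar>c * effective_dim \<C>\<^sub>0\<bar> * (cc + d)"
    using eff_dim eventually_ge_at_top[of 1]
  proof eventually_elim
    case (elim n)
    interpret discretization n "\<phi> n" using elim(2) by (rule disc)
    \<comment> \<open>The trace is the effective dimension times this norm, and the norm is at most
      \<open>cc + d\<close>. The absolute value below covers any sign of \<open>c\<close>.\<close>
    let ?o = "opnorm_G n (gram (\<phi> n)) (C\<^sub>0 n)"
    note o = opnorm_G_bounds[OF disc_cov[OF elim(2)] elim(2) lift_le[OF elim(2)]]
    have "(\<Sum>i<n. C\<^sub>0 n i i) = effective_dim_G n (gram (\<phi> n)) (C\<^sub>0 n) * ?o"
      using o(1) by (simp add: effective_dim_G_def)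
    also have "\<dots> \<le> \<bar>c * effective_dim \<C>\<^sub>0\<bar> * ?o" using elim(1) o(1) by (intro mult_right_mono) auto
    also have "\<dots> \<le> \<bar>c * effective_dim \<C>\<^sub>0\<bar> * (cc + d)" using o(2) by (intro mult_left_mono) auto
    finally show ?case .
  qed
  then obtain \<tau> where \<tau>: "0 \<le> \<tau>" "\<And>n. (\<Sum>i<n. C\<^sub>0 n i i) \<le> \<tau>"
    by (rule eventually_bounded_imp_bounded) blast
  define \<kappa> where "\<kappa> = sqrt (cc / \<gamma>)"
  have \<kappa>: "0 \<le> \<kappa>" using cc \<gamma> by (simp add: \<kappa>_def)
  \<comment> \<open>Like \<open>d\<close> and \<open>\<tau>\<close>, \<open>B\<close> is fixed
    before the dimension, the ensemble size and the probability space are introduced; this makes the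
    constants uniform.\<close>
  obtain B where B: "0 \<le> B" "\<And>X Y Z D1 D2 s \<kappa>'.
    0 \<le> X \<Longrightarrow> 0 \<le> Y \<Longrightarrow> 0 \<le> Z \<Longrightarrow> 0 \<le> D1 \<Longrightarrow> 0 \<le> D2 \<Longrightarrow> 1 \<le> s \<Longrightarrow> \<kappa>' = sqrt ((cc + d + X) / \<gamma>) \<Longrightarrow>
    (1 + \<kappa> * f) * ((D1 + X) * (1 + \<kappa>' * f)) + (1 + \<kappa> * f) * (cc * (D2 * \<kappa>'))
      + \<kappa> * (D2 * ((1 + \<kappa>' * f) * (cc + d + X)))
      + \<kappa>' * (Y * \<kappa>') + ((1 + \<kappa>' * f) * (Z * \<kappa>') + \<kappa>' * (Z * (1 + \<kappa>' * f)))
    \<le> B * ((D1 + D2) * (2 + 2 * X\<^sup>2) + 3 * s * (X\<^sup>2 + Y\<^sup>2 + Z\<^sup>2) + 2 / s)"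
    using error_terms_bound[OF cc(1) f(1) d(1) \<gamma>(1) \<kappa>] by metis
  define b where "b = (\<Sum>w\<in>Basis. w \<bullet> (\<Gamma> *v w))"
  define Q where "Q = 2 + 144 * \<tau>\<^sup>2"
  have main: "integrable \<Omega> (\<lambda>\<omega>. enkf_cov_error \<C>\<^sub>0 \<F> \<Gamma> y n (\<phi> n) (F n) J (\<lambda>j. u j \<omega>) (\<lambda>j. \<eta> j \<omega>)) \<and>
        (\<integral>\<omega>. enkf_cov_error \<C>\<^sub>0 \<F> \<Gamma> y n (\<phi> n) (F n) J (\<lambda>j. u j \<omega>) (\<lambda>j. \<eta> j \<omega>) \<partial>\<Omega>)
          \<le> (B * Q * r\<^sub>1) * \<psi>\<^sub>1 n + (B * Q * r\<^sub>2) * \<psi>\<^sub>2 n + (B * (216 * (\<tau>\<^sup>2 + b\<^sup>2 + \<tau> * b) + 2)) * (1 / sqrt (real J))"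
    if n: "1 \<le> n" and J: "2 \<le> J"
      and sample: "enkf_sample \<Omega> n (gram (\<phi> n)) (proj_coeffs n (\<phi> n) m\<^sub>0) (C\<^sub>0 n) \<Gamma> J u \<eta>"
    for n J u \<eta> and \<Omega> :: "'w measure"
  proof -
    interpret discretization n "\<phi> n" using n by (rule disc)
    obtain E where E: "orthonormal_family E" "span E = V" using orthonormal_V by blast
    have "prob_space \<Omega>" using sample by (simp add: enkf_sample_def)
    then have set: "enkf_setting n (\<phi> n) \<Gamma> \<gamma> \<Omega> (proj_coeffs n (\<phi> n) m\<^sub>0) (C\<^sub>0 n) J u \<eta> E"
      by (intro enkf_setting.intro enkf_setting_axioms.intro noise disc n J disc_cov sample E)
    interpret enkf_setting n "\<phi> n" \<Gamma> \<gamma> \<Omega> "proj_coeffs n (\<phi> n) m\<^sub>0" "C\<^sub>0 n" J u \<eta> E by (rule set)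
    let ?e = "\<lambda>\<omega>. enkf_cov_error \<C>\<^sub>0 \<F> \<Gamma> y n (\<phi> n) (F n) J (\<lambda>j. u j \<omega>) (\<lambda>j. \<eta> j \<omega>)"
    have nn: "0 \<le> errU \<omega>" "0 \<le> errN \<omega>" "0 \<le> errX \<omega>" for \<omega>
      by (auto simp: errU_def errN_def errX_def intro!: sum_nonneg)
    have le: "?e \<omega> \<le> B * ((r\<^sub>1 * \<psi>\<^sub>1 n + r\<^sub>2 * \<psi>\<^sub>2 n) * (2 + 2 * errU \<omega>)
      + 3 * sqrt (real J) * (errU \<omega> + errN \<omega> + errX \<omega>) + 2 / sqrt (real J))" for \<omega>
    proof -
      obtain X Y Z \<kappa>' where x: "X = sqrt (errU \<omega>)" "Y = sqrt (errN \<omega>)" "Z = sqrt (errX \<omega>)"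
        "\<kappa>' = sqrt ((cc + d + X) / \<gamma>)" and e: "?e \<omega> \<le>
          (1 + \<kappa> * f) * ((r\<^sub>1 * \<psi>\<^sub>1 n + X) * (1 + \<kappa>' * f)) + (1 + \<kappa> * f) * (cc * (r\<^sub>2 * \<psi>\<^sub>2 n * \<kappa>'))
          + \<kappa> * (r\<^sub>2 * \<psi>\<^sub>2 n * ((1 + \<kappa>' * f) * (cc + d + X)))
          + \<kappa>' * (Y * \<kappa>') + ((1 + \<kappa>' * f) * (Z * \<kappa>') + \<kappa>' * (Z * (1 + \<kappa>' * f)))"
        using enkf_cov_error_le[OF k cc(2) cc(1) f' obs_le[OF n] f(1) D1(1)[OF n, folded CH_def] D1(2)[OF n] d(2)
            D2[OF n], of \<omega> y] unfolding \<kappa>_def by blast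
      have "0 \<le> X" "0 \<le> Y" "0 \<le> Z" and sq: "X\<^sup>2 = errU \<omega>" "Y\<^sup>2 = errN \<omega>" "Z\<^sup>2 = errX \<omega>"
        using nn by (auto simp: x)
      moreover have "1 \<le> sqrt (real J)" using J by simp
      ultimately show ?thesis
        using order_trans[OF e B(2)[OF _ _ _ D1(2)[OF n] D2(2)[OF n] _ x(4)]] by simp
    qed
    have bl: "bounded_linear (\<lambda>h. posterior_cov \<C>\<^sub>0 \<F> \<Gamma> h - lift_op n (\<phi> n) A h)" for A
      unfolding posterior_cov_eq_post[OF k] by (intro bounded_linear_sub k.post_lin bounded_linear_lift_op)
    have e0: "0 \<le> ?e \<omega>" for \<omega> unfolding enkf_cov_error_def by (rule onorm_pos_le[OF bl])
    have D: "0 \<le> r\<^sub>1 * \<psi>\<^sub>1 n + r\<^sub>2 * \<psi>\<^sub>2 n" using D1(2)[OF n] D2(2)[OF n] by simp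
    note I = integrable_error_bound[OF enkf_cov_error_measurable[OF set k] e0 le B(1) D \<tau>(2)]
    have b: "(\<Sum>w\<in>Basis. \<beta> w) = b" by (simp add: b_def \<beta>_def)
    have "(\<integral>\<omega>. ?e \<omega> \<partial>\<Omega>) \<le> B * ((r\<^sub>1 * \<psi>\<^sub>1 n + r\<^sub>2 * \<psi>\<^sub>2 n) * Q
        + (216 * (\<tau>\<^sup>2 + b\<^sup>2 + \<tau> * b) + 2) * (1 / sqrt (real J)))"
      using I(2) unfolding b Q_def .
    also have "\<dots> = (B * Q * r\<^sub>1) * \<psi>\<^sub>1 n + (B * Q * r\<^sub>2) * \<psi>\<^sub>2 n
        + (B * (216 * (\<tau>\<^sup>2 + b\<^sup>2 + \<tau> * b) + 2)) * (1 / sqrt (real J))"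
      by (simp only: distrib_left distrib_right mult.assoc mult.commute[of Q] mult.left_commute[of _ Q])
    finally show ?thesis using I(1) by blast
  qed
  show ?thesis
    by (rule exI[of _ "B * Q * r\<^sub>1"], rule exI[of _ "B * Q * r\<^sub>2"],
        rule exI[of _ "B * (216 * (\<tau>\<^sup>2 + b\<^sup>2 + \<tau> * b) + 2)"]) (use main in blast)
qed

end
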